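(* Let $A$, $H$, $\mathcal H$, $\mathcal A_0$, $\mathcal B$, $\mathcal A_{\mathcal B}=\mathcal A_0-\mathcal B$, $\lambda_k$, $V_k$, $P^N$, $(\nu_k,U_k)$, $\eta_k^N$, $\mu(\mathcal A_{\mathcal B})$ and $\mu_r(P^N\mathcal A_{\mathcal B})$ be as defined in the context. Assume that: (H1) $\mathcal A_0:\mathcal D(\mathcal A_0)\subset\mathcal H\to\mathcal H$ is skew-adjoint with simple eigenvalues $\{\lambda_n\}_{n\in\mathbb Z^*}$. (H2) $|\lambda_{j+1}-\lambda_j|>2\|\mathcal B\|$ for all $j\in\mathbb Z^*$ with $j+1\in\mathbb Z^*$. (H3) $\|\mathcal B\|\le|\lambda_1|$. (H4) The eigenvectors $\{U_j\}_{j\in\mathbb Z^*}$ of $\mathcal A_{\mathcal B}$ constitute a Riesz basis of $\mathcal H$, i.e. there exist constants $m,M>0$ such that $$m\sum_{j\in\mathbb Z^*}|c_j|^2\le\Big\|\sum_{j\in\mathbb Z^*}c_jU_j\Big\|_{\mathcal H}^2\le M\sum_{j\in\mathbb Z^*}|c_j|^2\quad\text{for all }\{c_j\}\in\ell^2(\mathbb Z^* ).$$ (H5) For each $\varepsilon>0$ there exists $r_1>0$ such that $$\max_{|i|\le p}\ \sum_{|j|\ge p+r_1}|\langle\mathcal BV_i,V_j\rangle_{\mathcal H}|^2<\varepsilon\quad\text{for all integers }p>0,$$ where $i,j$ range over $\mathbb Z^*$. (H6) Given $\varepsilon>0$, there exist $N_1$ and $\alpha\in\mathbb R$ such that $$|\mathrm{Re}(\nu_k)-\alpha|\le\varepsilon\quad\text{for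 all }k\in\mathbb Z^*\text{ with }|k|>N_1.$$ Then, for each $\varepsilon>0$ there exist positive integers $N_1$ and $r$, independent of $N$, with $N_1\ge r$, such that $$|\mu(\mathcal A_{\mathcal B})-\mu_r(P^N\mathcal A_{\mathcal B})|\le\varepsilon\quad\text{for all integers }N>N_1.$$
   Context: $\mathbb Z^*=\mathbb Z\setminus\{0\}$ and $\mathbb N^*=\{1,2,\dots\}$. $H$ is an infinite-dimensional complex Hilbert space and $A$ is an unbounded self-adjoint, positive operator on $H$ with domain $\mathcal D(A)$ and compact inverse. Its eigenvalues $\{\mu_k\}_{k\ge1}$ are assumed simple and are ordered increasingly, $0<\mu_1<\mu_2<\cdots\to+\infty$; $\{v_k\}_{k\ge1}$ are associated eigenvectors normalized in $H$. $H_{1/2}=\mathcal D(A^{1/2})$ has the norm $\|z\|_{1/2}=\|A^{1/2}z\|_H$, and $\mathcal H=H_{1/2}\times H$ has the inner product $\langle[f,g],[u,v]\rangle_{\mathcal H}=\langle A^{1/2}f,A^{1/2}u\rangle_H+\langle g,v\rangle_H$. $\|\cdot\|$ denotes the norm of $\mathcal H$ or the operator norm of $\mathcal L(\mathcal H)$. $\mathcal A_0=\begin{pmatrix}0&I\\-A&0\end{pmatrix}$ with domain $\mathcal D(\mathcal A_0)=\mathcal D(A)\times H_{1/2}$. $\mathcal B\in\mathcal L(\mathcal H)$ is a bounded operator with $\langle\mathcal BY,Y\rangle_{\mathcal H}\ge0$ for all $Y\in\mathcal H$, and $\mathcal A_{\mathcal B}=\mathcal A_0-\mathcal B$ with domain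 $\mathcal D(\mathcal A_{\mathcal B})=\mathcal D(\mathcal A_0)$. The eigenvalues of $\mathcal A_0$ are $\lambda_{\pm n}=\pm i\sqrt{\mu_n}$, $n\in\mathbb N^*$, with eigenvectors $V_k=\frac{1}{\sqrt2}\big[\frac{1}{\lambda_k}v_k,\,v_k\big]$, $k\in\mathbb Z^*$, where $v_{-n}=v_n$; $\{V_k\}_{k\in\mathbb Z^*}$ is an orthonormal basis of $\mathcal H$. For $N\in\mathbb N^*$, $\mathcal H^N=\mathrm{span}\{V_k: k\in\mathbb Z^*,\ |k|\le N\}$, $P^N:\mathcal H\to\mathcal H^N$ is the orthogonal projection, and $P^N\mathcal A_{\mathcal B}$ is regarded as an operator on the $2N$-dimensional space $\mathcal H^N$ (its eigenvalues are the $\lambda\in\mathbb C$ for which there is $W\in\mathcal H^N$, $W\ne0$, with $P^N\mathcal A_{\mathcal B}W=\lambda W$). $\{(\nu_k,U_k)\}_{k\in\mathbb Z^*}$ denote the eigenvalues and associated normalized eigenvectors of $\mathcal A_{\mathcal B}$, and $\{\eta_k^N\}_{k\in\mathbb Z^*,\,|k|\le N}$ the $2N$ eigenvalues (counted with multiplicity) of $P^N\mathcal A_{\mathcal B}$. They are ordered by nondecreasing imaginary part as the index increases through $\mathbb Z^*$ (the successor of $-1$ being $1$): $\mathrm{Im}(\nu_k)\le\mathrm{Im}(\nu_{k+1})$ and, when equal, $|\nu_{k+1}|\le|\nu_k|$; likewise $\mathrm{Im}(\eta_k^N)\le\mathrm{Im}(\eta_{k+1}^N)$. This is the same ordering as for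 $\{\lambda_k\}_{k\in\mathbb Z^*}$. The spectral abscissa of $\mathcal A_{\mathcal B}$ is $\mu(\mathcal A_{\mathcal B})=\sup\{\mathrm{Re}(\lambda):\lambda\in\sigma(\mathcal A_{\mathcal B})\}$, where $\sigma(\mathcal A_{\mathcal B})$ is the spectrum. For integers $N>r>0$, the modified discrete spectral abscissa (with the highest frequencies removed) is $$\mu_r(P^N\mathcal A_{\mathcal B})=\max_{j\in\mathbb Z^*,\,|j|\le N-r}\mathrm{Re}(\eta_j^N).$$ *)

theory Defs
  imports "HOL-Analysis.Analysis"
begin

section \<open>Complex Hilbert spaces\<close>

class scaleC = scaleR +
  fixes scaleC :: "complex \<Rightarrow> 'a \<Rightarrow> 'a" (infixr "*\<^sub>C" 75)

class complex_vector = real_vector + scaleC +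
  assumes scaleR_scaleC: "scaleR r x = scaleC (complex_of_real r) x"
    and scaleC_add_right: "scaleC a (x + y) = scaleC a x + scaleC a y"
    and scaleC_add_left: "scaleC (a + b) x = scaleC a x + scaleC b x"
    and scaleC_scaleC: "scaleC a (scaleC b x) = scaleC (a * b) x"
    and scaleC_one: "scaleC 1 x = x"

global_interpretation complex_vector:
  vector_space "scaleC :: complex \<Rightarrow> 'a \<Rightarrow> 'a::complex_vector"
  by unfold_locales (rule scaleC_add_right scaleC_add_left scaleC_scaleC scaleC_one)+

text \<open>The inner product is linear in its first argument.\<close>

class complex_inner = complex_vector + real_normed_vector +
  fixes cinner :: "'a \<Rightarrow> 'a \<Rightarrow> complex"
  assumes cinner_commute: "cinner x y = cnj (cinner y x)"
    and cinner_add_left: "cinner (x + y) z = cinner x z + cinner y z"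
    and cinner_scaleC_left: "cinner (scaleC a x) y = a * cinner x y"
    and cinner_self: "cinner x x = complex_of_real ((norm x)\<^sup>2)"

class chilbert_space = complex_inner + complete_space

instantiation prod :: (complex_vector, complex_vector) complex_vector
begin

definition scaleC_prod :: "complex \<Rightarrow> 'a \<times> 'b \<Rightarrow> 'a \<times> 'b" where
  "scaleC_prod c Y = (c *\<^sub>C fst Y, c *\<^sub>C snd Y)"

instance
  by standard
    (simp_all add: scaleC_prod_def prod_eq_iff scaleR_scaleC scaleC_add_right
      scaleC_add_left scaleC_scaleC scaleC_one)

end


section \<open>Operators on a space given by a carrier and an inner product\<close>

text \<open>
  The energy space is a subspace of \<open>'h \<times> 'h\<close> whose inner product is not the one
  of the product type.  The notions below therefore take the carrier \<open>V\<close> and the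
  inner product \<open>ip\<close> of the ambient Hilbert space as arguments; they are used
  with \<open>UNIV\<close> and \<open>cinner\<close> for \<open>H\<close>.  An unbounded operator is a
  domain \<open>D\<close> with a function \<open>T\<close>, whose values outside \<open>D\<close> are irrelevant.
\<close>

definition vnorm :: "('a \<Rightarrow> 'a \<Rightarrow> complex) \<Rightarrow> 'a \<Rightarrow> real" where
  "vnorm ip x = sqrt (Re (ip x x))"

definition dense_in ::
  "'a::complex_vector set \<Rightarrow> ('a \<Rightarrow> 'a \<Rightarrow> complex) \<Rightarrow> 'a set \<Rightarrow> bool" where
  "dense_in V ip D \<longleftrightarrow>
     D \<subseteq> V \<and> (\<forall>x\<in>V. \<forall>e>0. \<exists>d\<in>D. vnorm ip (x - d) < e)"

definition linear_op ::
  "'a::complex_vector set \<Rightarrow> 'a set \<Rightarrow> ('a \<Rightarrow> 'a) \<Rightarrow> bool" where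
  "linear_op V D T \<longleftrightarrow>
     complex_vector.subspace D \<and> D \<subseteq> V \<and> T ` D \<subseteq> V \<and>
     (\<forall>x\<in>D. \<forall>y\<in>D. T (x + y) = T x + T y) \<and>
     (\<forall>c. \<forall>x\<in>D. T (c *\<^sub>C x) = c *\<^sub>C T x)"

definition bounded_op :: "('a \<Rightarrow> 'a \<Rightarrow> complex) \<Rightarrow> 'a set \<Rightarrow> ('a \<Rightarrow> 'a) \<Rightarrow> bool" where
  "bounded_op ip D T \<longleftrightarrow> (\<exists>C. \<forall>x\<in>D. vnorm ip (T x) \<le> C * vnorm ip x)"

definition op_norm ::
  "'a set \<Rightarrow> ('a \<Rightarrow> 'a \<Rightarrow> complex) \<Rightarrow> ('a \<Rightarrow> 'a) \<Rightarrow> real" where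
  "op_norm V ip T = Sup {vnorm ip (T x) | x. x \<in> V \<and> vnorm ip x \<le> 1}"

definition adjoint_graph ::
  "'a set \<Rightarrow> ('a \<Rightarrow> 'a \<Rightarrow> complex) \<Rightarrow> 'a set \<Rightarrow> ('a \<Rightarrow> 'a) \<Rightarrow> ('a \<times> 'a) set" where
  "adjoint_graph V ip D T =
     {(y, z). y \<in> V \<and> z \<in> V \<and> (\<forall>x\<in>D. ip (T x) y = ip x z)}"

definition self_adjoint ::
  "'a::complex_vector set \<Rightarrow> ('a \<Rightarrow> 'a \<Rightarrow> complex) \<Rightarrow> 'a set \<Rightarrow> ('a \<Rightarrow> 'a) \<Rightarrow> bool" where
  "self_adjoint V ip D T \<longleftrightarrow>
     linear_op V D T \<and> dense_in V ip D \<and>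
     adjoint_graph V ip D T = {(y, T y) | y. y \<in> D}"

definition skew_adjoint ::
  "'a::complex_vector set \<Rightarrow> ('a \<Rightarrow> 'a \<Rightarrow> complex) \<Rightarrow> 'a set \<Rightarrow> ('a \<Rightarrow> 'a) \<Rightarrow> bool" where
  "skew_adjoint V ip D T \<longleftrightarrow>
     linear_op V D T \<and> dense_in V ip D \<and>
     adjoint_graph V ip D T = {(y, - T y) | y. y \<in> D}"

definition positive_op :: "('a \<Rightarrow> 'a \<Rightarrow> complex) \<Rightarrow> 'a set \<Rightarrow> ('a \<Rightarrow> 'a) \<Rightarrow> bool" where
  "positive_op ip D T \<longleftrightarrow> (\<forall>x\<in>D. ip (T x) x \<in> \<real>\<^sub>\<ge>\<^sub>0)"

definition eigenspace ::
  "'a::complex_vector set \<Rightarrow> ('a \<Rightarrow> 'a) \<Rightarrow> complex \<Rightarrow> 'a set" where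
  "eigenspace D T z = {x\<in>D. T x = z *\<^sub>C x}"

definition eigenvalues :: "'a::complex_vector set \<Rightarrow> ('a \<Rightarrow> 'a) \<Rightarrow> complex set" where
  "eigenvalues D T = {z. \<exists>x\<in>D. x \<noteq> 0 \<and> T x = z *\<^sub>C x}"

text \<open>
  Only used for self-adjoint and skew-adjoint operators, for which the geometric
  and the algebraic multiplicity coincide.
\<close>

definition simple_eigenvalue ::
  "'a::complex_vector set \<Rightarrow> ('a \<Rightarrow> 'a) \<Rightarrow> complex \<Rightarrow> bool" where
  "simple_eigenvalue D T z \<longleftrightarrow> complex_vector.dim (eigenspace D T z) = 1"

text \<open>
  Algebraic multiplicity, for an operator that maps the finite-dimensional
  subspace \<open>M\<close> into itself; it is \<open>0\<close> if \<open>z\<close> is not an eigenvalue.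
\<close>

definition alg_multiplicity ::
  "'a::complex_vector set \<Rightarrow> ('a \<Rightarrow> 'a) \<Rightarrow> complex \<Rightarrow> nat" where
  "alg_multiplicity M T z =
     complex_vector.dim {x\<in>M. \<exists>n. ((\<lambda>y. T y - z *\<^sub>C y) ^^ n) x = 0}"

definition resolvent_set ::
  "'a::complex_vector set \<Rightarrow> ('a \<Rightarrow> 'a \<Rightarrow> complex) \<Rightarrow> 'a set \<Rightarrow> ('a \<Rightarrow> 'a) \<Rightarrow> complex set" where
  "resolvent_set V ip D T =
     {z. bij_betw (\<lambda>x. z *\<^sub>C x - T x) D V \<and>
         bounded_op ip V (inv_into D (\<lambda>x. z *\<^sub>C x - T x))}"

definition spectrum ::
  "'a::complex_vector set \<Rightarrow> ('a \<Rightarrow> 'a \<Rightarrow> complex) \<Rightarrow> 'a set \<Rightarrow> ('a \<Rightarrow> 'a) \<Rightarrow> complex set" where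
  "spectrum V ip D T = - resolvent_set V ip D T"

definition spectral_abscissa ::
  "'a::complex_vector set \<Rightarrow> ('a \<Rightarrow> 'a \<Rightarrow> complex) \<Rightarrow> 'a set \<Rightarrow> ('a \<Rightarrow> 'a) \<Rightarrow> real" where
  "spectral_abscissa V ip D T = Sup (Re ` spectrum V ip D T)"

definition orth_proj ::
  "('a \<Rightarrow> 'a \<Rightarrow> complex) \<Rightarrow> 'a::complex_vector set \<Rightarrow> 'a \<Rightarrow> 'a" where
  "orth_proj ip M x = (THE y. y \<in> M \<and> (\<forall>w\<in>M. ip (x - y) w = 0))"

text \<open>Unconditional convergence in the norm of \<open>ip\<close>, as in \<open>has_sum\<close> for type-class norms.\<close>

definition has_ip_sum ::
  "'a::complex_vector set \<Rightarrow> ('a \<Rightarrow> 'a \<Rightarrow> complex) \<Rightarrow> 'i set \<Rightarrow> ('i \<Rightarrow> 'a) \<Rightarrow> 'a \<Rightarrow> bool" where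
  "has_ip_sum V ip J f x \<longleftrightarrow>
     x \<in> V \<and> ((\<lambda>F. vnorm ip (x - sum f F)) \<longlongrightarrow> 0) (finite_subsets_at_top J)"

definition riesz_basis ::
  "'a::complex_vector set \<Rightarrow> ('a \<Rightarrow> 'a \<Rightarrow> complex) \<Rightarrow> 'i set \<Rightarrow> ('i \<Rightarrow> 'a) \<Rightarrow> bool" where
  "riesz_basis V ip J U \<longleftrightarrow>
     U ` J \<subseteq> V \<and> dense_in V ip (complex_vector.span (U ` J)) \<and>
     (\<exists>m>0. \<exists>M>0. \<forall>c :: 'i \<Rightarrow> complex. (\<lambda>j. (cmod (c j))\<^sup>2) summable_on J \<longrightarrow>
        (\<exists>x. has_ip_sum V ip J (\<lambda>j. c j *\<^sub>C U j) x \<and>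
             m * (\<Sum>\<^sub>\<infinity>j\<in>J. (cmod (c j))\<^sup>2) \<le> (vnorm ip x)\<^sup>2 \<and>
             (vnorm ip x)\<^sup>2 \<le> M * (\<Sum>\<^sub>\<infinity>j\<in>J. (cmod (c j))\<^sup>2)))"


section \<open>The undamped and the damped second order system\<close>

text \<open>The index set of nonzero integers, in which the successor of \<open>-1\<close> is \<open>1\<close>.\<close>

definition Zstar :: "int set" where
  "Zstar = {k. k \<noteq> 0}"

definition zsucc :: "int \<Rightarrow> int" where
  "zsucc k = (if k = - 1 then 1 else k + 1)"

definition compact_inverse :: "'h::chilbert_space set \<Rightarrow> ('h \<Rightarrow> 'h) \<Rightarrow> bool" where
  "compact_inverse D T \<longleftrightarrow>
     bij_betw T D UNIV \<and> (\<forall>X. bounded X \<longrightarrow> compact (closure (inv_into D T ` X)))"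

text \<open>\<open>\<mu>\<close> and \<open>v\<close> are indexed from \<open>1\<close>; \<open>\<mu> 0\<close> and \<open>v 0\<close> are irrelevant.\<close>

definition stiffness_operator ::
  "'h::chilbert_space set \<Rightarrow> ('h \<Rightarrow> 'h) \<Rightarrow> (nat \<Rightarrow> real) \<Rightarrow> (nat \<Rightarrow> 'h) \<Rightarrow> bool" where
  "stiffness_operator DA A \<mu> v \<longleftrightarrow>
     \<not> (\<exists>F::'h set. finite F \<and> complex_vector.span F = UNIV) \<and>
     self_adjoint UNIV cinner DA A \<and> \<not> bounded_op cinner DA A \<and>
     positive_op cinner DA A \<and> compact_inverse DA A \<and>
     eigenvalues DA A = {complex_of_real (\<mu> k) | k. k \<ge> 1} \<and>
     (\<forall>k\<ge>1. simple_eigenvalue DA A (complex_of_real (\<mu> k))) \<and>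
     0 < \<mu> 1 \<and> strict_mono_on {1..} \<mu> \<and> filterlim \<mu> at_top sequentially \<and>
     (\<forall>k\<ge>1. v k \<in> DA \<and> A (v k) = complex_of_real (\<mu> k) *\<^sub>C v k \<and> norm (v k) = 1)"

text \<open>\<open>(DS, S)\<close> is the square root of the positive self-adjoint operator \<open>(DA, A)\<close>.\<close>

definition is_sqrt_of ::
  "'h::chilbert_space set \<Rightarrow> ('h \<Rightarrow> 'h) \<Rightarrow> 'h set \<Rightarrow> ('h \<Rightarrow> 'h) \<Rightarrow> bool" where
  "is_sqrt_of DS S DA A \<longleftrightarrow>
     self_adjoint UNIV cinner DS S \<and> positive_op cinner DS S \<and>
     DA = {x\<in>DS. S x \<in> DS} \<and> (\<forall>x\<in>DA. S (S x) = A x)"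

definition energy_space :: "'h::chilbert_space set \<Rightarrow> ('h \<times> 'h) set" where
  "energy_space DS = DS \<times> UNIV"

definition energy_inner :: "('h::chilbert_space \<Rightarrow> 'h) \<Rightarrow> 'h \<times> 'h \<Rightarrow> 'h \<times> 'h \<Rightarrow> complex" where
  "energy_inner S Y Z = cinner (S (fst Y)) (S (fst Z)) + cinner (snd Y) (snd Z)"

definition undamped_op :: "('h::chilbert_space \<Rightarrow> 'h) \<Rightarrow> 'h \<times> 'h \<Rightarrow> 'h \<times> 'h" where
  "undamped_op A Y = (snd Y, - A (fst Y))"

definition damped_op ::
  "('h::chilbert_space \<Rightarrow> 'h) \<Rightarrow> ('h \<times> 'h \<Rightarrow> 'h \<times> 'h) \<Rightarrow> 'h \<times> 'h \<Rightarrow> 'h \<times> 'h" where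
  "damped_op A B Y = undamped_op A Y - B Y"

definition op_domain :: "'h::chilbert_space set \<Rightarrow> 'h set \<Rightarrow> ('h \<times> 'h) set" where
  "op_domain DA DS = DA \<times> DS"

definition damping_operator ::
  "'h::chilbert_space set \<Rightarrow> ('h \<Rightarrow> 'h) \<Rightarrow> ('h \<times> 'h \<Rightarrow> 'h \<times> 'h) \<Rightarrow> bool" where
  "damping_operator DS S B \<longleftrightarrow>
     linear_op (energy_space DS) (energy_space DS) B \<and>
     bounded_op (energy_inner S) (energy_space DS) B \<and>
     positive_op (energy_inner S) (energy_space DS) B"

definition lam :: "(nat \<Rightarrow> real) \<Rightarrow> int \<Rightarrow> complex" where
  "lam \<mu> k = of_int (sgn k) * \<i> * complex_of_real (sqrt (\<mu> (nat \<bar>k\<bar>)))"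

definition Vec :: "(nat \<Rightarrow> real) \<Rightarrow> (nat \<Rightarrow> 'h::chilbert_space) \<Rightarrow> int \<Rightarrow> 'h \<times> 'h" where
  "Vec \<mu> v k = complex_of_real (1 / sqrt 2) *\<^sub>C
     ((1 / lam \<mu> k) *\<^sub>C v (nat \<bar>k\<bar>), v (nat \<bar>k\<bar>))"

text \<open>
  All eigenvalues of the damped operator, with normalized eigenvectors.  That
  every eigenvalue is repeated according to its multiplicity is forced once
  \<open>U\<close> is assumed to be a Riesz basis.
\<close>

definition damped_eigensystem ::
  "'h::chilbert_space set \<Rightarrow> ('h \<Rightarrow> 'h) \<Rightarrow> 'h set \<Rightarrow> ('h \<Rightarrow> 'h) \<Rightarrow> ('h \<times> 'h \<Rightarrow> 'h \<times> 'h) \<Rightarrow>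
   (int \<Rightarrow> complex) \<Rightarrow> (int \<Rightarrow> 'h \<times> 'h) \<Rightarrow> bool" where
  "damped_eigensystem DA A DS S B \<nu> U \<longleftrightarrow>
     eigenvalues (op_domain DA DS) (damped_op A B) = \<nu> ` Zstar \<and>
     (\<forall>k\<in>Zstar. U k \<in> op_domain DA DS \<and> damped_op A B (U k) = \<nu> k *\<^sub>C U k \<and>
        vnorm (energy_inner S) (U k) = 1) \<and>
     (\<forall>k\<in>Zstar. Im (\<nu> k) \<le> Im (\<nu> (zsucc k)) \<and>
        (Im (\<nu> k) = Im (\<nu> (zsucc k)) \<longrightarrow> cmod (\<nu> (zsucc k)) \<le> cmod (\<nu> k)))"

definition galerkin_space ::
  "(nat \<Rightarrow> real) \<Rightarrow> (nat \<Rightarrow> 'h::chilbert_space) \<Rightarrow> nat \<Rightarrow> ('h \<times> 'h) set" where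
  "galerkin_space \<mu> v N = complex_vector.span (Vec \<mu> v ` {k\<in>Zstar. \<bar>k\<bar> \<le> int N})"

definition galerkin_op ::
  "('h::chilbert_space \<Rightarrow> 'h) \<Rightarrow> ('h \<Rightarrow> 'h) \<Rightarrow> ('h \<times> 'h \<Rightarrow> 'h \<times> 'h) \<Rightarrow>
   (nat \<Rightarrow> real) \<Rightarrow> (nat \<Rightarrow> 'h) \<Rightarrow> nat \<Rightarrow> 'h \<times> 'h \<Rightarrow> 'h \<times> 'h" where
  "galerkin_op A S B \<mu> v N W =
     orth_proj (energy_inner S) (galerkin_space \<mu> v N) (damped_op A B W)"

text \<open>\<open>\<eta> k\<close>, for \<open>0 < \<bar>k\<bar> \<le> N\<close>, lists the \<open>2N\<close> eigenvalues with algebraic multiplicity.\<close>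

definition galerkin_eigenvalues ::
  "('h::chilbert_space \<Rightarrow> 'h) \<Rightarrow> ('h \<Rightarrow> 'h) \<Rightarrow> ('h \<times> 'h \<Rightarrow> 'h \<times> 'h) \<Rightarrow>
   (nat \<Rightarrow> real) \<Rightarrow> (nat \<Rightarrow> 'h) \<Rightarrow> nat \<Rightarrow> (int \<Rightarrow> complex) \<Rightarrow> bool" where
  "galerkin_eigenvalues A S B \<mu> v N \<eta> \<longleftrightarrow>
     (\<forall>z. card {k\<in>Zstar. \<bar>k\<bar> \<le> int N \<and> \<eta> k = z} =
        alg_multiplicity (galerkin_space \<mu> v N) (galerkin_op A S B \<mu> v N) z) \<and>
     (\<forall>k\<in>Zstar. \<bar>k\<bar> \<le> int N \<and> \<bar>zsucc k\<bar> \<le> int N \<longrightarrow> Im (\<eta> k) \<le> Im (\<eta> (zsucc k)))"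

definition discrete_abscissa :: "(int \<Rightarrow> complex) \<Rightarrow> nat \<Rightarrow> nat \<Rightarrow> real" where
  "discrete_abscissa \<eta> N r = Max ((\<lambda>j. Re (\<eta> j)) ` {j\<in>Zstar. \<bar>j\<bar> \<le> int N - int r})"

end

theory Submission
  imports Defs
begin

text \<open>
  The map \<open>\<Phi> (f, g) = (S f, g)\<close> identifies the energy space with the Hilbert space \<open>H \<times> H\<close>, and it
  sends the vectors \<open>V\<^sub>k\<close> to an orthonormal basis: compactness of the inverse of \<open>A\<close> makes the
  \<open>v\<^sub>n\<close> complete (\<open>stiffness_eigenvectors_complete\<close>).  In these coordinates the damped operator is
  the diagonal operator with entries \<open>\<lambda>\<^sub>k\<close> minus a bounded positive operator of norm \<open>b\<close>.
  A positive operator of norm \<open>b\<close> on a complex space is self-adjoint and differs from \<open>b/2\<close> by an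
  operator of norm at most \<open>\<beta> = b/2\<close>.  So the damped operator perturbs the diagonal operator with
  entries \<open>a\<^sub>k = \<lambda>\<^sub>k - b/2\<close> by an operator of norm \<open>\<beta>\<close>, while the \<open>a\<^sub>k\<close> are at least
  \<open>2b = 4\<beta>\<close> apart.

  For such a perturbation, and for each of its compressions to coordinate subspaces, every
  eigenvalue lies in the disc of radius \<open>3\<beta>/2\<close> about exactly one \<open>a\<^sub>k\<close>, no disc contains two
  eigenvalues, there are no Jordan chains, and a pair \<open>(z, u)\<close> with residual \<open>f\<close> and \<open>z\<close> in the
  \<open>k\<close>-th disc has \<open>z\<close> within \<open>3 * norm f\<close> of the eigenvalue there
  (\<open>eigenvalue_near_approximate_eigenvalue\<close>).  All of this follows from one estimate, which solves
  the equation off the \<open>k\<close>-th coordinate and inserts the result into the \<open>k\<close>-th one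
  (\<open>stability\<close>).  The \<open>2N\<close> Galerkin eigenvalues, counted with multiplicity, therefore occupy the
  \<open>2N\<close> discs one by one, and since the discs are ordered by their imaginary parts, \<open>\<eta>\<^sub>k\<close> lies in the
  disc of \<open>a\<^sub>k\<close> (\<open>enumerated_eigenvalue_in_disc\<close>).

  For the upper bound, let \<open>W\<close> be a normalized Galerkin eigenvector for \<open>\<eta>\<^sub>k\<close> with \<open>\<bar>k\<bar> \<le> N - r\<close>.
  The defect \<open>\<eta>\<^sub>k W - (A\<^sub>0 - B) W\<close> is the part of \<open>B W\<close> outside the Galerkin space.  The gaps grow
  linearly in the index, so the coordinates of \<open>W\<close> further than \<open>L\<close> from \<open>k\<close> have norm at most
  \<open>1/(2L)\<close>, and for the finitely many remaining ones the decay hypothesis on \<open>B V\<^sub>i\<close> applies; hence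
  the defect is small uniformly in \<open>N\<close> and \<open>k\<close> (\<open>galerkin_residual\<close>).  The Riesz basis gives a resolvent
  bound of the form \<open>K / dist(z, {\<nu>\<^sub>j})\<close> (\<open>resolvent_bound\<close>), so \<open>\<eta>\<^sub>k\<close> is close to some \<open>\<nu>\<^sub>j\<close>.
  The same bound shows that the spectral abscissa is the supremum of the \<open>Re \<nu>\<^sub>j\<close>.

  For the lower bound, a single \<open>\<nu>\<^sub>j\<close> whose real part nearly attains that supremum suffices.  The
  truncations of its eigenvector are approximate eigenvectors of the Galerkin operators with
  residual tending to \<open>0\<close>, so by stability the Galerkin eigenvalues in the disc of \<open>\<nu>\<^sub>j\<close>,
  which have a fixed index \<open>k\<close>, converge to \<open>\<nu>\<^sub>j\<close> (\<open>galerkin_eigenvalues_converge\<close>).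

  If \<open>b = 0\<close> the discs degenerate, but then all eigenvalues are imaginary and both abscissas are \<open>0\<close>.
\<close>

section \<open>Complex inner product spaces and orthonormal bases\<close>

lemma cinner_add_right: "cinner x (y + z) = cinner x y + cinner x z"
  for x y z :: "'a::complex_inner"
  by (metis cinner_add_left cinner_commute complex_cnj_add)

lemma cinner_scaleC_right: "cinner x (a *\<^sub>C y) = cnj a * cinner x y"
  for x y :: "'a::complex_inner"
  by (metis cinner_commute cinner_scaleC_left complex_cnj_cnj complex_cnj_mult)

lemma cinner_zero_left [simp]: "cinner 0 x = 0" for x :: "'a::complex_inner"
  by (metis add_cancel_left_left cinner_add_left)

lemma cinner_zero_right [simp]: "cinner x 0 = 0" for x :: "'a::complex_inner"
  by (metis add_cancel_left_left cinner_add_right)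

lemma cinner_minus_left [simp]: "cinner (- x) y = - cinner x y" for x y :: "'a::complex_inner"
  by (metis add.right_inverse add_eq_0_iff cinner_add_left cinner_zero_left)

lemma cinner_minus_right [simp]: "cinner x (- y) = - cinner x y" for x y :: "'a::complex_inner"
  by (metis add.right_inverse add_eq_0_iff cinner_add_right cinner_zero_right)

lemma cinner_diff_left: "cinner (x - y) z = cinner x z - cinner y z" for x y z :: "'a::complex_inner"
  by (metis cinner_add_left cinner_minus_left diff_conv_add_uminus)

lemma cinner_diff_right: "cinner x (y - z) = cinner x y - cinner x z" for x y z :: "'a::complex_inner"
  by (metis cinner_add_right cinner_minus_right diff_conv_add_uminus)

lemma cinner_sum_left: "cinner (sum f F) y = (\<Sum>i\<in>F. cinner (f i) y)" for y :: "'a::complex_inner"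
  by (induction F rule: infinite_finite_induct) (auto simp: cinner_add_left)

lemma cinner_sum_right: "cinner y (sum f F) = (\<Sum>i\<in>F. cinner y (f i))" for y :: "'a::complex_inner"
  by (induction F rule: infinite_finite_induct) (auto simp: cinner_add_right)

lemmas cinner_simps = cinner_add_left cinner_add_right cinner_diff_left cinner_diff_right
  cinner_scaleC_left cinner_scaleC_right

lemma norm_scaleC: "norm (a *\<^sub>C x) = cmod a * norm x" for x :: "'a::complex_inner"
proof -
  have "complex_of_real ((norm (a *\<^sub>C x))\<^sup>2) = a * cnj a * complex_of_real ((norm x)\<^sup>2)"
    by (metis cinner_scaleC_left cinner_scaleC_right cinner_self mult.assoc)
  also have "\<dots> = complex_of_real ((cmod a * norm x)\<^sup>2)"
    by (simp add: complex_norm_square[symmetric] power_mult_distrib)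
  finally have "(norm (a *\<^sub>C x))\<^sup>2 = (cmod a * norm x)\<^sup>2"
    using of_real_eq_iff by blast
  then show ?thesis
    by (simp add: power2_eq_iff_nonneg)
qed

lemma norm_add_sq: "(norm (x + y))\<^sup>2 = (norm x)\<^sup>2 + 2 * Re (cinner x y) + (norm y)\<^sup>2"
  for x y :: "'a::complex_inner"
proof -
  have "complex_of_real ((norm (x + y))\<^sup>2)
      = of_real ((norm x)\<^sup>2) + (cinner x y + cnj (cinner x y)) + of_real ((norm y)\<^sup>2)"
    by (metis (no_types, lifting) add.assoc cinner_add_left cinner_add_right cinner_commute cinner_self)
  also have "\<dots> = of_real ((norm x)\<^sup>2 + 2 * Re (cinner x y) + (norm y)\<^sup>2)"
    by (simp add: complex_add_cnj)
  finally show ?thesis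
    using of_real_eq_iff by blast
qed

lemma norm_diff_sq: "(norm (x - y))\<^sup>2 = (norm x)\<^sup>2 - 2 * Re (cinner x y) + (norm y)\<^sup>2"
  for x y :: "'a::complex_inner"
  using norm_add_sq[of x "- y"] by simp

lemma norm_cinner_le: "cmod (cinner x y) \<le> norm x * norm y" for x y :: "'a::complex_inner"
proof (cases "y = 0")
  case False
  define t where "t = cinner x y / of_real ((norm y)\<^sup>2)"
  have ny: "(norm y)\<^sup>2 > 0" using False by simp
  have "0 \<le> (norm (x - t *\<^sub>C y))\<^sup>2" by simp
  also have "\<dots> = (norm x)\<^sup>2 - 2 * Re (cnj t * cinner x y) + (cmod t)\<^sup>2 * (norm y)\<^sup>2"
    by (simp add: norm_diff_sq cinner_scaleC_right norm_scaleC power_mult_distrib)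
  also have "cnj t * cinner x y = of_real ((cmod (cinner x y))\<^sup>2 / (norm y)\<^sup>2)"
    unfolding t_def using complex_norm_square[of "cinner x y"] by (simp add: mult.commute)
  also have "(cmod t)\<^sup>2 * (norm y)\<^sup>2 = (cmod (cinner x y))\<^sup>2 / (norm y)\<^sup>2"
  proof -
    have "cmod t = cmod (cinner x y) / (norm y)\<^sup>2"
      unfolding t_def norm_divide norm_of_real by simp
    then show ?thesis using ny by (simp add: power_divide power2_eq_square)
  qed
  finally have "(cmod (cinner x y))\<^sup>2 / (norm y)\<^sup>2 \<le> (norm x)\<^sup>2" by simp
  then have "(cmod (cinner x y))\<^sup>2 \<le> (norm x * norm y)\<^sup>2"
    using ny by (simp add: divide_le_eq power_mult_distrib)
  then show ?thesis by (rule power2_le_imp_le) simp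
qed simp

lemma bounded_bilinear_cinner: "bounded_bilinear (cinner :: 'a::complex_inner \<Rightarrow> 'a \<Rightarrow> complex)"
proof
  show "\<exists>K. \<forall>a b. norm (cinner a b :: complex) \<le> norm (a::'a) * norm b * K"
    by (rule exI[of _ 1]) (simp add: norm_cinner_le)
qed (simp_all add: cinner_simps scaleR_scaleC scaleR_conv_of_real)

lemmas tendsto_cinner = bounded_bilinear.tendsto[OF bounded_bilinear_cinner]

lemma tendsto_scaleC: "(f \<longlongrightarrow> l) F \<Longrightarrow> ((\<lambda>x. a *\<^sub>C f x) \<longlongrightarrow> a *\<^sub>C l) F"
  for l :: "'a::complex_inner"
proof -
  assume *: "(f \<longlongrightarrow> l) F"
  have "bounded_linear (\<lambda>x::'a. a *\<^sub>C x)"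
  proof
    show "\<exists>K. \<forall>x::'a. norm (a *\<^sub>C x) \<le> norm x * K"
      by (rule exI[of _ "cmod a"]) (simp add: norm_scaleC mult.commute)
  qed (simp_all add: scaleC_add_right scaleR_scaleC scaleC_scaleC mult.commute)
  from bounded_linear.tendsto[OF this *] show ?thesis .
qed

instantiation prod :: (complex_inner, complex_inner) complex_inner
begin

definition cinner_prod :: "'a \<times> 'b \<Rightarrow> 'a \<times> 'b \<Rightarrow> complex" where
  "cinner_prod Y Z = cinner (fst Y) (fst Z) + cinner (snd Y) (snd Z)"

instance
proof
  fix x y z :: "'a \<times> 'b" and a :: complex
  show "cinner x y = cnj (cinner y x)"
    unfolding cinner_prod_def by (simp flip: cinner_commute)
  show "cinner (x + y) z = cinner x z + cinner y z"
    by (simp add: cinner_prod_def cinner_simps)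
  show "cinner (a *\<^sub>C x) y = a * cinner x y"
    by (simp add: cinner_prod_def scaleC_prod_def cinner_simps algebra_simps)
  show "cinner x x = complex_of_real ((norm x)\<^sup>2)"
    by (simp add: cinner_prod_def cinner_self norm_prod_def)
qed

end

instance prod :: (chilbert_space, chilbert_space) chilbert_space ..

text \<open>
  Completeness is stated as triviality of the orthogonal complement, the form in which both
  the spectral theorem and the computation in the energy space deliver it.
\<close>
locale onb =
  fixes I :: "'i set" and e :: "'i \<Rightarrow> 'k::chilbert_space"
  assumes orthonormal: "\<And>i j. i \<in> I \<Longrightarrow> j \<in> I \<Longrightarrow> cinner (e i) (e j) = (if i = j then 1 else 0)"
    and complete: "\<And>x. (\<And>i. i \<in> I \<Longrightarrow> cinner x (e i) = 0) \<Longrightarrow> x = 0"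
begin

definition expansion :: "'k \<Rightarrow> 'i set \<Rightarrow> 'k" where
  "expansion x F = (\<Sum>i\<in>F. cinner x (e i) *\<^sub>C e i)"

lemma cinner_basis_sum:
  assumes "finite F" "F \<subseteq> I" "j \<in> I"
  shows "cinner (\<Sum>i\<in>F. c i *\<^sub>C e i) (e j) = (if j \<in> F then c j else 0)"
proof -
  have "cinner (\<Sum>i\<in>F. c i *\<^sub>C e i) (e j) = (\<Sum>i\<in>F. if i = j then c i else 0)"
    unfolding cinner_sum_left using assms by (intro sum.cong) (auto simp: cinner_simps orthonormal)
  then show ?thesis using assms by simp
qed

lemma norm_basis_sum:
  assumes "finite F" "F \<subseteq> I"
  shows "(norm (\<Sum>i\<in>F. c i *\<^sub>C e i))\<^sup>2 = (\<Sum>i\<in>F. (cmod (c i))\<^sup>2)"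
proof -
  have "cinner (\<Sum>i\<in>F. c i *\<^sub>C e i) (\<Sum>i\<in>F. c i *\<^sub>C e i) = (\<Sum>j\<in>F. c j * cnj (c j))"
    unfolding cinner_sum_right[of _ _ F]
    by (intro sum.cong refl) (use assms in \<open>auto simp: cinner_scaleC_right cinner_basis_sum subsetD\<close>)
  also have "\<dots> = of_real (\<Sum>i\<in>F. (cmod (c i))\<^sup>2)"
    unfolding of_real_sum complex_norm_square ..
  finally show ?thesis
    unfolding cinner_self using of_real_eq_iff by blast
qed

lemma norm_minus_expansion:
  assumes "finite F" "F \<subseteq> I"
  shows "(norm (x - expansion x F))\<^sup>2 = (norm x)\<^sup>2 - (\<Sum>i\<in>F. (cmod (cinner x (e i)))\<^sup>2)"
proof -
  have "cinner x (expansion x F) = of_real (\<Sum>i\<in>F. (cmod (cinner x (e i)))\<^sup>2)"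
    unfolding expansion_def cinner_sum_right of_real_sum
    by (intro sum.cong refl) (simp only: cinner_scaleC_right mult.commute complex_norm_square)
  then show ?thesis
    using norm_basis_sum[OF assms, of "\<lambda>i. cinner x (e i)"]
    by (simp add: norm_diff_sq flip: expansion_def)
qed

lemma bessel:
  assumes "finite F" "F \<subseteq> I"
  shows "(\<Sum>i\<in>F. (cmod (cinner x (e i)))\<^sup>2) \<le> (norm x)\<^sup>2"
  using norm_minus_expansion[OF assms, of x] by (metis diff_ge_0_iff_ge zero_le_power2)

text \<open>
  By Bessel's inequality the squared coefficients are summable.  Finite sets that exhaust their
  sum up to \<open>1 / (n + 1)\<close> give partial expansions that form a Cauchy sequence; the
  difference of \<open>x\<close> and the limit is orthogonal to the basis, hence \<open>0\<close>.
\<close>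
theorem parseval: "((\<lambda>i. (cmod (cinner x (e i)))\<^sup>2) has_sum (norm x)\<^sup>2) I"
proof -
  let ?f = "\<lambda>i. (cmod (cinner x (e i)))\<^sup>2"
  have summ: "?f summable_on I"
    by (rule nonneg_bdd_above_summable_on) (use bessel in \<open>auto simp: bdd_above_def\<close>)
  define q where "q = infsum ?f I"
  have le_q: "sum ?f F \<le> q" if "finite F" "F \<subseteq> I" for F
    unfolding q_def by (rule finite_sum_le_infsum) (use that summ in auto)
  have "\<exists>F. finite F \<and> F \<subseteq> I \<and> sum ?f F > q - 1 / (real n + 1)" for n :: nat
  proof -
    have "(sum ?f \<longlongrightarrow> q) (finite_subsets_at_top I)"
      using has_sum_infsum[OF summ] unfolding q_def has_sum_def .
    then have "eventually (\<lambda>F. sum ?f F > q - 1 / (real n + 1)) (finite_subsets_at_top I)"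
      by (rule order_tendstoD) simp
    then show ?thesis unfolding eventually_finite_subsets_at_top by blast
  qed
  then obtain F where F: "\<And>n. finite (F n)" "\<And>n. F n \<subseteq> I"
      "\<And>n. sum ?f (F n) > q - 1 / (real n + 1)"
    by metis
  have outside: "sum ?f G \<le> 1 / (real n + 1)" if "finite G" "G \<subseteq> I" "G \<inter> F n = {}" for G n
  proof -
    have "sum ?f G + sum ?f (F n) = sum ?f (G \<union> F n)"
      by (rule sum.union_disjoint[symmetric]) (use that F in auto)
    also have "\<dots> \<le> q" by (rule le_q) (use that F in auto)
    finally show ?thesis using F(3)[of n] by simp
  qed
  define y where "y n = expansion x (F n)" for n
  have diff: "norm (y n - y m) \<le> 2 * sqrt (1 / (real m + 1))" if "m \<le> n" for m n
  proof -
    have *: "y n - y m = expansion x (F n - F m) - expansion x (F m - F n)"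
      unfolding y_def expansion_def
      using sum.Int_Diff[OF F(1)[of n], of "\<lambda>i. cinner x (e i) *\<^sub>C e i" "F m"]
            sum.Int_Diff[OF F(1)[of m], of "\<lambda>i. cinner x (e i) *\<^sub>C e i" "F n"]
      by (simp add: Int_commute)
    have 1: "(norm (expansion x (F n - F m)))\<^sup>2 \<le> 1 / (real m + 1)"
      unfolding expansion_def using F outside[of "F n - F m" m]
      by (subst norm_basis_sum) auto
    have "(norm (expansion x (F m - F n)))\<^sup>2 \<le> 1 / (real n + 1)"
      unfolding expansion_def using F outside[of "F m - F n" n]
      by (subst norm_basis_sum) auto
    also have "\<dots> \<le> 1 / (real m + 1)" using that by (simp add: frac_le)
    finally have 2: "(norm (expansion x (F m - F n)))\<^sup>2 \<le> 1 / (real m + 1)" .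
    show ?thesis unfolding *
      using norm_triangle_ineq4[of "expansion x (F n - F m)" "expansion x (F m - F n)"]
        real_le_rsqrt[OF 1] real_le_rsqrt[OF 2] by linarith
  qed
  have lim0: "(\<lambda>m. 2 * sqrt (1 / (real m + 1))) \<longlonglongrightarrow> 0"
    using tendsto_mult_right_zero[OF tendsto_real_sqrt[OF LIMSEQ_inverse_real_of_nat, simplified], of 2]
    by (simp add: inverse_eq_divide add.commute)
  have "Cauchy y"
  proof (rule metric_CauchyI)
    fix d :: real assume "d > 0"
    then obtain M where M: "2 * sqrt (1 / (real M + 1)) < d / 2"
      using order_tendstoD(2)[OF lim0, of "d / 2"] eventually_sequentially by auto
    have "dist (y m) (y n) < d" if "m \<ge> M" "n \<ge> M" for m n
    proof -
      have "dist (y m) (y n) \<le> dist (y m) (y M) + dist (y n) (y M)"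
        by (rule dist_triangle2)
      then show ?thesis using diff[OF that(1)] diff[OF that(2)] M by (simp add: dist_norm)
    qed
    then show "\<exists>M. \<forall>m\<ge>M. \<forall>n\<ge>M. dist (y m) (y n) < d" by blast
  qed
  then obtain l where l: "y \<longlonglongrightarrow> l" using Cauchy_convergent convergent_def by blast
  have "cinner (x - l) (e i) = 0" if i: "i \<in> I" for i
  proof -
    have c: "cinner (y n) (e i) = (if i \<in> F n then cinner x (e i) else 0)" for n
      unfolding y_def expansion_def using cinner_basis_sum[OF F(1,2) i] .
    have "norm (cinner (y n) (e i) - cinner x (e i)) \<le> 2 * sqrt (1 / (real n + 1))" for n
    proof (cases "i \<in> F n")
      case False
      then have "?f i \<le> 1 / (real n + 1)" using outside[of "{i}" n] i by auto
      then have "cmod (cinner x (e i)) \<le> sqrt (1 / (real n + 1))" by (rule real_le_rsqrt)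
      moreover have "0 \<le> sqrt (1 / (real n + 1))" by simp
      moreover have "norm (cinner (y n) (e i) - cinner x (e i)) = cmod (cinner x (e i))"
        using False by (simp add: c)
      ultimately show ?thesis by linarith
    qed (simp add: c)
    then have "(\<lambda>n. cinner (y n) (e i) - cinner x (e i)) \<longlonglongrightarrow> 0"
      by (intro Lim_null_comparison[OF _ lim0] always_eventually) simp
    then have "(\<lambda>n. cinner (y n) (e i)) \<longlonglongrightarrow> cinner x (e i)" by (simp add: LIM_zero_iff)
    moreover have "(\<lambda>n. cinner (y n) (e i)) \<longlonglongrightarrow> cinner l (e i)"
      by (rule tendsto_cinner[OF l tendsto_const])
    ultimately show ?thesis using LIMSEQ_unique by (fastforce simp: cinner_simps)
  qed
  then have "x - l = 0" by (rule complete)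
  then have "y \<longlonglongrightarrow> x" using l by simp
  then have lim: "(\<lambda>n. (norm (x - y n))\<^sup>2) \<longlonglongrightarrow> (norm (x - x))\<^sup>2"
    by (intro tendsto_intros) have "(norm (x - y n))\<^sup>2 \<ge> (norm x)\<^sup>2 - q" for n
    unfolding y_def norm_minus_expansion[OF F(1,2)] using le_q[OF F(1,2), of n] by simp
  then have "(norm x)\<^sup>2 - q \<le> (norm (x - x))\<^sup>2"
    by (intro LIMSEQ_le_const[OF lim]) auto
  then have "(norm x)\<^sup>2 - q \<le> 0" by simp
  moreover have "q \<le> (norm x)\<^sup>2"
    unfolding q_def by (rule infsum_le_finite_sums[OF summ]) (use bessel in auto)
  ultimately show ?thesis using summ unfolding q_def
    by (metis diff_le_0_iff_le has_sum_infsum order_antisym)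
qed

lemma coordinate_eqI: "(\<And>i. i \<in> I \<Longrightarrow> cinner x (e i) = cinner y (e i)) \<Longrightarrow> x = y"
  using complete[of "x - y"] by (simp add: cinner_simps)

text \<open>The only way in which coordinates are turned into norm estimates below.\<close>
lemma norm_le_coordinatewise:
  assumes "\<kappa> \<ge> 0" "\<And>i. i \<in> I \<Longrightarrow> \<kappa> * cmod (cinner x (e i)) \<le> cmod (cinner y (e i))"
  shows "\<kappa> * norm x \<le> norm y"
proof -
  have "\<kappa>\<^sup>2 * (norm x)\<^sup>2 \<le> (norm y)\<^sup>2"
  proof (rule has_sum_mono[OF has_sum_cmult_right[OF parseval] parseval])
    fix i assume "i \<in> I"
    then have "(\<kappa> * cmod (cinner x (e i)))\<^sup>2 \<le> (cmod (cinner y (e i)))\<^sup>2"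
      using assms by (intro power_mono) auto
    then show "\<kappa>\<^sup>2 * (cmod (cinner x (e i)))\<^sup>2 \<le> (cmod (cinner y (e i)))\<^sup>2"
      by (simp add: power_mult_distrib)
  qed
  then have "(\<kappa> * norm x)\<^sup>2 \<le> (norm y)\<^sup>2" by (simp add: power_mult_distrib)
  then show ?thesis by (rule power2_le_imp_le) simp
qed

lemma norm_basis: "i \<in> I \<Longrightarrow> norm (e i) = 1"
proof -
  assume "i \<in> I"
  then have "complex_of_real ((norm (e i))\<^sup>2) = of_real 1"
    using orthonormal[of i i] by (metis cinner_self of_real_1)
  then have "(norm (e i))\<^sup>2 = 1" unfolding of_real_eq_iff .
  then show ?thesis unfolding power2_eq_1_iff using norm_ge_zero[of "e i"] by linarith
qed

lemma cinner_minus_expansion: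
  assumes "finite F" "F \<subseteq> I" "j \<in> I"
  shows "cinner (x - expansion x F) (e j) = (if j \<in> F then 0 else cinner x (e j))"
  using cinner_basis_sum[OF assms, of "\<lambda>i. cinner x (e i)"]
  by (simp add: cinner_simps expansion_def)

lemma expansion_tendsto: "((\<lambda>F. norm (x - expansion x F)) \<longlongrightarrow> 0) (finite_subsets_at_top I)"
proof -
  have "((\<lambda>F. (norm x)\<^sup>2 - (\<Sum>i\<in>F. (cmod (cinner x (e i)))\<^sup>2)) \<longlongrightarrow> (norm x)\<^sup>2 - (norm x)\<^sup>2)
     (finite_subsets_at_top I)"
    using parseval[of x] unfolding has_sum_def by (intro tendsto_intros)
  then have "((\<lambda>F. sqrt ((norm x)\<^sup>2 - (\<Sum>i\<in>F. (cmod (cinner x (e i)))\<^sup>2))) \<longlongrightarrow> sqrt 0)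
     (finite_subsets_at_top I)"
    by (intro tendsto_real_sqrt) simp
  moreover have "eventually (\<lambda>F. sqrt ((norm x)\<^sup>2 - (\<Sum>i\<in>F. (cmod (cinner x (e i)))\<^sup>2))
       = norm (x - expansion x F)) (finite_subsets_at_top I)"
    by (rule eventually_finite_subsets_at_top_weakI) (simp flip: norm_minus_expansion)
  ultimately show ?thesis by (simp add: tendsto_cong)
qed

end

section \<open>Completeness of the eigenvectors of the stiffness operator\<close>

lemma simple_eigenvalue_multiple:
  assumes "simple_eigenvalue D T z" "x \<in> eigenspace D T z" "x \<noteq> 0" "y \<in> eigenspace D T z"
  obtains c where "y = c *\<^sub>C x"
proof -
  let ?E = "eigenspace D T z"
  obtain X where X: "X \<subseteq> ?E" "complex_vector.independent X" "?E \<subseteq> complex_vector.span X"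
    "card X = complex_vector.dim ?E"
    by (rule complex_vector.basis_exists)
  then obtain w where "X = {w}"
    using assms(1) unfolding simple_eigenvalue_def by (metis card_1_singletonE)
  with X(3) have "x \<in> range (\<lambda>k. k *\<^sub>C w)" "y \<in> range (\<lambda>k. k *\<^sub>C w)"
    using assms(2,4) by (auto simp: complex_vector.span_singleton)
  then obtain a b where ab: "x = a *\<^sub>C w" "y = b *\<^sub>C w" by auto
  with assms(3) have "y = (b / a) *\<^sub>C x" by (auto simp: scaleC_scaleC)
  then show ?thesis by (rule that)
qed

text \<open>
  Let \<open>s\<close> be the norm of \<open>G\<close> on the invariant subspace.  Compactness provides a point \<open>g\<close> of norm
  \<open>s\<close> that is a limit of images of vectors \<open>x n\<close> in the unit ball; expanding the square shows that
  \<open>G (G (x n)) - s\<^sup>2 x n\<close> tends to \<open>0\<close>, so \<open>x n\<close> converges to some \<open>u\<close> with \<open>G (G u) = s\<^sup>2 u\<close>.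
  Then \<open>G u + s u\<close> is an eigenvector for \<open>s\<close>; positivity of \<open>G\<close> ensures that it does not vanish.
\<close>
lemma compact_positive_eigenvector:
  fixes G :: "'h::chilbert_space \<Rightarrow> 'h"
  assumes add: "\<And>x y. G (x + y) = G x + G y" and scale: "\<And>c x. G (c *\<^sub>C x) = c *\<^sub>C G x"
    and sym: "\<And>x y. cinner (G x) y = cinner x (G y)"
    and pos: "\<And>x. 0 \<le> Re (cinner (G x) x)"
    and inj: "\<And>x. G x = 0 \<Longrightarrow> x = 0"
    and comp: "\<And>X. bounded X \<Longrightarrow> compact (closure (G ` X))"
    and M: "closed M" "complex_vector.subspace M" "G ` M \<subseteq> M" "x0 \<in> M" "x0 \<noteq> 0"
  obtains y s where "y \<in> M" "y \<noteq> 0" "s > 0" "G y = complex_of_real s *\<^sub>C y"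
proof -
  have G0: "G 0 = 0" using scale[of 0 0] by simp
  have Mscale: "c *\<^sub>C x \<in> M" if "x \<in> M" for c x
    using M(2) that by (simp add: complex_vector.subspace_scale)
  define X where "X = M \<inter> cball 0 1"
  have "bounded (G ` X)"
    using comp[of X] bounded_subset[OF compact_imp_bounded closure_subset]
    unfolding X_def by (meson bounded_Int bounded_cball)
  then obtain K where K: "\<And>x. x \<in> X \<Longrightarrow> norm (G x) \<le> K"
    unfolding bounded_iff by blast
  have "compact (closure (G ` X))" using comp unfolding X_def by (meson bounded_Int bounded_cball)
  moreover have "0 \<in> X" using M(2) by (simp add: X_def complex_vector.subspace_0)
  then have "closure (G ` X) \<noteq> {}" using closure_subset by blast
  ultimately obtain g where g: "g \<in> closure (G ` X)"
      and g_max: "\<And>h. h \<in> closure (G ` X) \<Longrightarrow> norm h \<le> norm g"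
    using continuous_attains_sup[of "closure (G ` X)" norm] continuous_on_norm_id by blast
  define s where "s = norm g"
  have le_s: "norm (G x) \<le> s * norm x" if x: "x \<in> M" for x
  proof (cases "x = 0")
    case False
    let ?c = "complex_of_real (1 / norm x)"
    have "?c *\<^sub>C x \<in> X" using False x by (simp add: X_def Mscale norm_scaleC norm_divide)
    then have "norm (G (?c *\<^sub>C x)) \<le> s" using g_max closure_subset unfolding s_def by blast
    then show ?thesis using False by (simp add: scale norm_scaleC norm_divide field_simps)
  qed (simp add: G0)
  have "s > 0"
  proof -
    have "norm (G x0) > 0" using inj M(5) by auto
    then have "0 < s * norm x0" using le_s[OF M(4)] by linarith
    then show ?thesis using M(5) by (metis norm_ge_zero not_less_iff_gr_or_eq zero_less_mult_pos2 zero_less_norm_iff)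
  qed
  obtain f where f: "\<And>n. f n \<in> G ` X" "f \<longlonglongrightarrow> g" using g closure_sequential by blast
  have "\<forall>n. \<exists>x. x \<in> X \<and> G x = f n" using f(1) by (auto simp: image_iff) metis
  then obtain x where x: "\<And>n. x n \<in> X" "\<And>n. G (x n) = f n" by metis
  have xM: "x n \<in> M" "norm (x n) \<le> 1" for n using x(1) by (auto simp: X_def)
  have gM: "g \<in> M"
  proof (rule closed_sequentially[OF M(1) _ f(2)])
    show "f n \<in> M" for n using xM(1)[of n] x(2)[of n] M(3) by auto
  qed
  have Gdiff: "G (u - w) = G u - G w" for u w
    using add[of "u - w" w] by (simp add: algebra_simps)
  have "(\<lambda>n. G (f n)) \<longlonglongrightarrow> G g"
  proof (rule LIM_zero_cancel, rule Lim_null_comparison)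
    show "\<forall>\<^sub>F n in sequentially. norm (G (f n) - G g) \<le> s * norm (f n - g)"
    proof (rule always_eventually, rule allI)
      fix n
      have "f n - g \<in> M" using xM(1)[of n] x(2)[of n] M(2,3) gM
        by (metis complex_vector.subspace_diff image_subset_iff)
      from le_s[OF this] show "norm (G (f n) - G g) \<le> s * norm (f n - g)" by (simp add: Gdiff)
    qed
    show "(\<lambda>n. s * norm (f n - g)) \<longlonglongrightarrow> 0"
      using f(2) by (intro tendsto_mult_right_zero tendsto_norm_zero) (rule LIM_zero)
  qed
  have sq: "(norm (G (f n) - complex_of_real (s\<^sup>2) *\<^sub>C x n))\<^sup>2 \<le> s\<^sup>2 * (s\<^sup>2 - (norm (f n))\<^sup>2)" for n
  proof -
    have "cinner (G (f n)) (complex_of_real (s\<^sup>2) *\<^sub>C x n) = complex_of_real (s\<^sup>2 * (norm (f n))\<^sup>2)"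
      unfolding cinner_scaleC_right sym x(2) by (simp add: cinner_self)
    moreover have "f n \<in> M" using xM(1)[of n] x(2)[of n] M(3) by auto
    then have "(norm (G (f n)))\<^sup>2 \<le> s\<^sup>2 * (norm (f n))\<^sup>2"
      using power_mono[OF le_s, of "f n" 2] by (simp add: power_mult_distrib)
    moreover have "(norm (complex_of_real (s\<^sup>2) *\<^sub>C x n))\<^sup>2 \<le> s\<^sup>2 * s\<^sup>2"
    proof -
      have "(norm (x n))\<^sup>2 \<le> 1" using xM(2)[of n] by (simp add: power_le_one)
      then have "s\<^sup>2 * s\<^sup>2 * (norm (x n))\<^sup>2 \<le> s\<^sup>2 * s\<^sup>2 * 1" by (intro mult_left_mono) auto
      then show ?thesis by (simp add: norm_scaleC power_mult_distrib power2_eq_square norm_mult algebra_simps)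
    qed
    ultimately show ?thesis unfolding norm_diff_sq by (simp add: algebra_simps)
  qed
  have "(\<lambda>n. s\<^sup>2 * (s\<^sup>2 - (norm (f n))\<^sup>2)) \<longlonglongrightarrow> s\<^sup>2 * (s\<^sup>2 - (norm g)\<^sup>2)"
    by (intro tendsto_intros f(2))
  then have "(\<lambda>n. sqrt (s\<^sup>2 * (s\<^sup>2 - (norm (f n))\<^sup>2))) \<longlonglongrightarrow> 0"
    using tendsto_real_sqrt by (fastforce simp: s_def)
  then have "(\<lambda>n. G (f n) - complex_of_real (s\<^sup>2) *\<^sub>C x n) \<longlonglongrightarrow> 0"
    by (rule Lim_null_comparison[OF always_eventually, rotated]) (use sq real_le_rsqrt in blast)
  from tendsto_diff[OF \<open>(\<lambda>n. G (f n)) \<longlonglongrightarrow> G g\<close> this]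
  have "(\<lambda>n. complex_of_real (s\<^sup>2) *\<^sub>C x n) \<longlonglongrightarrow> G g" by simp
  from tendsto_scaleC[OF this, of "complex_of_real (1 / s\<^sup>2)"]
  have xlim: "x \<longlonglongrightarrow> complex_of_real (1 / s\<^sup>2) *\<^sub>C G g"
    using \<open>s > 0\<close> by (simp add: scaleC_scaleC scaleC_one)
  define u where "u = complex_of_real (1 / s\<^sup>2) *\<^sub>C G g"
  have uM: "u \<in> M" using gM M(3) by (auto simp: u_def Mscale)
  have Gg: "G g = complex_of_real (s\<^sup>2) *\<^sub>C u"
    using \<open>s > 0\<close> by (simp add: u_def scaleC_scaleC scaleC_one)
  have "f \<longlonglongrightarrow> G u"
  proof (rule LIM_zero_cancel, rule Lim_null_comparison)
    show "\<forall>\<^sub>F n in sequentially. norm (f n - G u) \<le> s * norm (x n - u)"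
    proof (rule always_eventually, rule allI)
      fix n
      have "x n - u \<in> M" using xM(1)[of n] uM M(2) by (simp add: complex_vector.subspace_diff)
      from le_s[OF this] show "norm (f n - G u) \<le> s * norm (x n - u)" by (simp add: Gdiff x(2))
    qed
    show "(\<lambda>n. s * norm (x n - u)) \<longlonglongrightarrow> 0"
      using xlim unfolding u_def[symmetric]
      by (intro tendsto_mult_right_zero tendsto_norm_zero) (rule LIM_zero)
  qed
  with f(2) have gu: "G u = g" using LIMSEQ_unique by blast
  define y where "y = G u + complex_of_real s *\<^sub>C u"
  have "u \<noteq> 0" using gu \<open>s > 0\<close> G0 by (auto simp: s_def)
  have "Re (cinner y u) = Re (cinner (G u) u) + s * (norm u)\<^sup>2"
    by (simp add: y_def cinner_simps cinner_self)
  also have "\<dots> > 0" using pos[of u] \<open>s > 0\<close> \<open>u \<noteq> 0\<close> by (simp add: add_nonneg_pos)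
  finally have "y \<noteq> 0" by auto
  moreover have "G y = complex_of_real s *\<^sub>C y"
    unfolding y_def add scale by (simp add: gu Gg scaleC_add_right scaleC_scaleC power2_eq_square)
  moreover have "y \<in> M"
    unfolding y_def using uM M(2,3) by (auto intro!: complex_vector.subspace_add Mscale)
  ultimately show ?thesis using that \<open>s > 0\<close> by blast
qed

text \<open>
  The orthogonal complement of all \<open>v n\<close> is invariant under the inverse of \<open>A\<close>.  If it were not
  trivial, it would contain an eigenvector of \<open>A\<close>; all eigenvalues being simple and listed, this
  eigenvector would be a multiple of some \<open>v n\<close> and orthogonal to it.
\<close>
lemma stiffness_eigenvectors_complete:
  fixes A :: "'h::chilbert_space \<Rightarrow> 'h"
  assumes A: "stiffness_operator DA A \<mu> v"
    and x: "\<And>n. n \<ge> 1 \<Longrightarrow> cinner x (v n) = 0"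
  shows "x = 0"
proof (rule ccontr)
  assume "x \<noteq> 0"
  note A = A[unfolded stiffness_operator_def]
  have sa: "linear_op UNIV DA A" "adjoint_graph UNIV cinner DA A = {(y, A y) | y. y \<in> DA}"
    using A by (auto simp: self_adjoint_def)
  have DA: "complex_vector.subspace DA" and Aadd: "\<And>x y. x \<in> DA \<Longrightarrow> y \<in> DA \<Longrightarrow> A (x + y) = A x + A y"
    and Ascale: "\<And>c x. x \<in> DA \<Longrightarrow> A (c *\<^sub>C x) = c *\<^sub>C A x"
    using sa(1) by (auto simp: linear_op_def)
  have Asym: "cinner (A x) y = cinner x (A y)" if "x \<in> DA" "y \<in> DA" for x y
    using sa(2) that by (auto simp: adjoint_graph_def set_eq_iff)
  have bij: "bij_betw A DA UNIV" and comp: "\<And>X. bounded X \<Longrightarrow> compact (closure (inv_into DA A ` X))"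
    using A by (auto simp: compact_inverse_def)
  define G where "G = inv_into DA A"
  have AG [simp]: "A (G x) = x" for x
    unfolding G_def using bij by (simp add: bij_betw_inv_into_right)
  have GD [simp]: "G x \<in> DA" for x
    unfolding G_def using bij by (metis UNIV_I bij_betw_imp_surj_on inv_into_into)
  have GA: "G (A x) = x" if "x \<in> DA" for x
    unfolding G_def using bij that by (simp add: bij_betw_inv_into_left)
  have Gadd: "G (x + y) = G x + G y" for x y
    by (metis AG Aadd DA GA GD complex_vector.subspace_add)
  have Gscale: "G (c *\<^sub>C x) = c *\<^sub>C G x" for c x
    by (metis AG Ascale DA GA GD complex_vector.subspace_scale)
  have Gsym: "cinner (G x) y = cinner x (G y)" for x y
    using Asym[of "G x" "G y"] by simp
  have Gpos: "0 \<le> Re (cinner (G x) x)" for x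
  proof -
    have "positive_op cinner DA A" using A by blast
    then have "cinner (A (G x)) (G x) \<in> \<real>\<^sub>\<ge>\<^sub>0" unfolding positive_op_def using GD by blast
    then have "cinner x (G x) \<in> \<real>\<^sub>\<ge>\<^sub>0" by simp
    then show ?thesis by (metis Gsym complex_nonneg_Reals_iff)
  qed
  have v: "v n \<in> DA" "A (v n) = complex_of_real (\<mu> n) *\<^sub>C v n" "norm (v n) = 1" if "n \<ge> 1" for n
  proof -
    have "\<forall>k\<ge>1. v k \<in> DA \<and> A (v k) = complex_of_real (\<mu> k) *\<^sub>C v k \<and> norm (v k) = 1"
      using A by blast
    with that show "v n \<in> DA" "A (v n) = complex_of_real (\<mu> n) *\<^sub>C v n" "norm (v n) = 1" by blast+
  qed
  have mu_pos: "\<mu> n > 0" if "n \<ge> 1" for n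
  proof -
    have mono: "strict_mono_on {1..} \<mu>" and "0 < \<mu> 1" using A by blast+
    then show ?thesis
      using strict_mono_onD[OF mono, of 1 n] that by (cases "n = 1") auto
  qed
  define M where "M = {x. \<forall>n\<ge>1. cinner x (v n) = 0}"
  have "closed M"
  proof (rule closed_sequential_limits[THEN iffD2], intro allI impI)
    fix f l assume *: "(\<forall>n. f n \<in> M) \<and> f \<longlonglongrightarrow> l"
    have "cinner l (v n) = 0" if "n \<ge> 1" for n
      using tendsto_cinner[OF conjunct2[OF *] tendsto_const, of "v n"] * that
      by (simp add: M_def LIMSEQ_const_iff)
    then show "l \<in> M" by (simp add: M_def)
  qed
  moreover have "complex_vector.subspace M"
    unfolding M_def complex_vector.subspace_def by (auto simp: cinner_simps)
  moreover have "G ` M \<subseteq> M"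
  proof safe
    fix x assume xM: "x \<in> M"
    have "cinner (G x) (v n) = 0" if n: "n \<ge> 1" for n
    proof -
      have "complex_of_real (\<mu> n) *\<^sub>C G (v n) = v n" by (metis GA Gscale n v(1,2))
      then have "cnj (\<mu> n) * cinner x (G (v n)) = cinner x (v n)" by (metis cinner_scaleC_right)
      then show ?thesis using xM n mu_pos[OF n] by (auto simp: M_def Gsym)
    qed
    then show "G x \<in> M" by (simp add: M_def)
  qed
  moreover have "x \<in> M" using x by (simp add: M_def)
  moreover have "x = 0" if "G x = 0" for x
    by (metis AG Ascale GD complex_vector.scale_zero_left that)
  ultimately obtain y s where y: "y \<in> M" "y \<noteq> 0" "s > 0" "G y = complex_of_real s *\<^sub>C y"
    using compact_positive_eigenvector[of G M x] Gadd Gscale Gsym Gpos comp \<open>x \<noteq> 0\<close>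
    unfolding G_def[symmetric] by metis
  have "y = complex_of_real (1 / s) *\<^sub>C G y"
    using y(3) unfolding y(4) by (simp add: scaleC_scaleC scaleC_one)
  then have yD: "y \<in> DA" by (metis DA GD complex_vector.subspace_scale)
  have Ay: "A y = complex_of_real (1 / s) *\<^sub>C y"
    by (metis AG Ascale GD \<open>y = complex_of_real (1 / s) *\<^sub>C G y\<close>)
  then have "complex_of_real (1 / s) \<in> eigenvalues DA A"
    using yD y(2) by (auto simp: eigenvalues_def)
  then obtain n where n: "n \<ge> 1" "complex_of_real (1 / s) = complex_of_real (\<mu> n)"
    using A by auto
  have "simple_eigenvalue DA A (complex_of_real (\<mu> n))" using A n(1) by blast
  moreover have "v n \<in> eigenspace DA A (complex_of_real (\<mu> n))" "v n \<noteq> 0"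
    using v[OF n(1)] by (auto simp: eigenspace_def)
  moreover have "y \<in> eigenspace DA A (complex_of_real (\<mu> n))"
    using Ay yD n(2) by (simp add: eigenspace_def)
  ultimately obtain c where c: "y = c *\<^sub>C v n" by (rule simple_eigenvalue_multiple)
  have "cinner y (v n) = 0" using y(1) n(1) by (simp add: M_def)
  then have "c = 0" using c v(3)[OF n(1)] by (simp add: cinner_simps cinner_self)
  then show False using c y(2) by simp
qed

lemma stiffness_eigenvectors_orthonormal:
  fixes A :: "'h::chilbert_space \<Rightarrow> 'h"
  assumes A: "stiffness_operator DA A \<mu> v" and mn: "m \<ge> 1" "n \<ge> 1"
  shows "cinner (v m) (v n) = (if m = n then 1 else 0)"
proof (cases "m = n")
  case True
  then show ?thesis using A mn by (simp add: stiffness_operator_def cinner_self)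
next
  case False
  note A = A[unfolded stiffness_operator_def]
  have v: "v n \<in> DA" "A (v n) = complex_of_real (\<mu> n) *\<^sub>C v n" if "n \<ge> 1" for n
  proof -
    have "\<forall>k\<ge>1. v k \<in> DA \<and> A (v k) = complex_of_real (\<mu> k) *\<^sub>C v k \<and> norm (v k) = 1"
      using A by blast
    with that show "v n \<in> DA" "A (v n) = complex_of_real (\<mu> n) *\<^sub>C v n" by blast+
  qed
  have "adjoint_graph UNIV cinner DA A = {(y, A y) | y. y \<in> DA}"
    using A by (auto simp: self_adjoint_def)
  then have "cinner (A (v m)) (v n) = cinner (v m) (A (v n))"
    using v(1) mn by (auto simp: adjoint_graph_def set_eq_iff)
  then have "(complex_of_real (\<mu> m) - complex_of_real (\<mu> n)) * cinner (v m) (v n) = 0"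
    using mn by (simp add: v cinner_simps algebra_simps)
  moreover have "\<mu> m \<noteq> \<mu> n"
  proof -
    have mono: "strict_mono_on {1..} \<mu>" using A by blast
    show ?thesis
      using strict_mono_onD[OF mono, of m n] strict_mono_onD[OF mono, of n m] mn False
      by (cases "m < n") auto
  qed
  ultimately show ?thesis using False by simp
qed

section \<open>Perturbations of a diagonal operator with separated eigenvalues\<close>

text \<open>
  The operator under study is the diagonal operator with entries \<open>a\<close> minus \<open>C\<close>.  It appears only
  through its coordinates, so that unbounded diagonals need no domain.
\<close>
locale diagonal_perturbation = onb I e for I :: "'i set" and e :: "'i \<Rightarrow> 'k::chilbert_space" +
  fixes a :: "'i \<Rightarrow> complex" and C :: "'k \<Rightarrow> 'k" and \<beta> :: real
  assumes C_add: "C (x + y) = C x + C y"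
    and C_scale: "C (c *\<^sub>C x) = c *\<^sub>C C x"
    and norm_C: "norm (C x) \<le> \<beta> * norm x"
    and \<beta>_pos: "\<beta> > 0"
    and gap: "i \<in> I \<Longrightarrow> j \<in> I \<Longrightarrow> i \<noteq> j \<Longrightarrow> cmod (a i - a j) \<ge> 4 * \<beta>"
begin

lemma C_diff: "C (x - y) = C x - C y"
  using C_add[of "x - y" y] by (simp add: algebra_simps)

text \<open>
  This says that \<open>x\<close> is supported in \<open>J\<close> and that the compression of the operator to \<open>J\<close>,
  minus \<open>z\<close>, maps \<open>x\<close> to the compression of \<open>f\<close>.  Finite \<open>J\<close> are Galerkin operators and
  \<open>J = I\<close> is the full operator, so that both are treated by the same lemmas.
\<close>
definition solves :: "'i set \<Rightarrow> complex \<Rightarrow> 'k \<Rightarrow> 'k \<Rightarrow> bool" where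
  "solves J z x f \<longleftrightarrow> (\<forall>j\<in>I - J. cinner x (e j) = 0) \<and>
     (\<forall>j\<in>J. (a j - z) * cinner x (e j) = cinner (C x) (e j) + cinner f (e j))"

lemma solves_diff:
  assumes "solves J z x f" "solves J z y g"
  shows "solves J z (x - y) (f - g)"
  using assms unfolding solves_def by (simp add: cinner_simps C_diff algebra_simps)

lemma solves_scale:
  assumes "solves J z x f"
  shows "solves J z (c *\<^sub>C x) (c *\<^sub>C f)"
  using assms unfolding solves_def by (auto simp: cinner_simps C_scale simp flip: distrib_left)

lemma norm_solves_le:
  assumes J: "J \<subseteq> I" and \<kappa>: "\<kappa> \<ge> \<beta>" "\<And>j. j \<in> J \<Longrightarrow> cinner x (e j) \<noteq> 0 \<Longrightarrow> cmod (a j - z) \<ge> \<kappa>"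
    and x: "\<And>j. j \<in> I - J \<Longrightarrow> cinner x (e j) = 0"
      "\<And>j. j \<in> J \<Longrightarrow> cinner x (e j) \<noteq> 0 \<Longrightarrow>
        (a j - z) * cinner x (e j) = cinner (C x) (e j) + cinner f (e j)"
  shows "(\<kappa> - \<beta>) * norm x \<le> norm f"
proof -
  have "\<kappa> * norm x \<le> norm (C x + f)"
  proof (rule norm_le_coordinatewise)
    show "\<kappa> * cmod (cinner x (e j)) \<le> cmod (cinner (C x + f) (e j))" if j: "j \<in> I" for j
    proof (cases "cinner x (e j) = 0")
      case False
      then have jJ: "j \<in> J" using j x(1) by blast
      have "\<kappa> * cmod (cinner x (e j)) \<le> cmod (a j - z) * cmod (cinner x (e j))"
        by (intro mult_right_mono \<kappa>(2)[OF jJ False]) auto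
      then show ?thesis
        using x(2)[OF jJ False] by (simp add: cinner_simps flip: norm_mult)
    qed simp
  qed (use \<kappa> \<beta>_pos in auto)
  also have "\<dots> \<le> \<beta> * norm x + norm f"
    using norm_triangle_ineq[of "C x" f] norm_C[of x] by linarith
  finally show ?thesis by (simp add: algebra_simps)
qed

text \<open>
  Eigenvalues lie within \<open>\<beta>\<close> of some \<open>a k\<close>.  A larger radius leaves room for the strict
  lower bound that \<open>norm_solves_le\<close> needs to rule out eigenvalues outside all discs, while a point
  of the \<open>k\<close>-th disc still has distance at least \<open>5/2 \<beta>\<close> from every other \<open>a j\<close>, more than
  the norm of \<open>C\<close>.
\<close>
definition in_disc :: "complex \<Rightarrow> 'i \<Rightarrow> bool" where
  "in_disc z k \<longleftrightarrow> cmod (a k - z) < 3 / 2 * \<beta>"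

lemma far_from_other_discs:
  assumes "in_disc z k" "k \<in> I" "j \<in> I" "j \<noteq> k"
  shows "cmod (a j - z) \<ge> 5 / 2 * \<beta>"
proof -
  have "cmod (a j - a k) \<le> cmod (a j - z) + cmod (a k - z)"
    by (metis norm_triangle_ineq4 diff_diff_eq2 diff_add_cancel)
  then show ?thesis using gap[of j k] assms by (simp add: in_disc_def)
qed

text \<open>
  Off the \<open>k\<close>-th coordinate the diagonal part minus \<open>z\<close> is bounded below by \<open>5/2 \<beta>\<close>, of which
  \<open>C\<close> takes away at most \<open>\<beta>\<close>.
\<close>
lemma off_disc_estimate:
  assumes J: "J \<subseteq> I" and k: "in_disc z k" "k \<in> J"
    and y: "cinner y (e k) = 0" "\<And>j. j \<in> I - J \<Longrightarrow> cinner y (e j) = 0"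
      "\<And>j. j \<in> J - {k} \<Longrightarrow> (a j - z) * cinner y (e j) = cinner (C y) (e j) + cinner f (e j)"
  shows "3 / 2 * \<beta> * norm y \<le> norm f"
proof -
  have "(5 / 2 * \<beta> - \<beta>) * norm y \<le> norm f"
  proof (rule norm_solves_le[OF J])
    show "cmod (a j - z) \<ge> 5 / 2 * \<beta>" if "j \<in> J" "cinner y (e j) \<noteq> 0" for j
      using far_from_other_discs[of z k j] k that y(1) J by blast
    show "(a j - z) * cinner y (e j) = cinner (C y) (e j) + cinner f (e j)"
      if "j \<in> J" "cinner y (e j) \<noteq> 0" for j
      using y(1) y(3)[of j] that by blast
  qed (use y \<beta>_pos in auto)
  then show ?thesis by (simp add: algebra_simps)
qed

lemma eigenvector_disc:
  assumes J: "J \<subseteq> I" and x: "solves J z x 0" "x \<noteq> 0"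
  obtains k where "k \<in> J" "in_disc z k" "cinner x (e k) \<noteq> 0"
proof -
  have "\<exists>k\<in>J. in_disc z k \<and> cinner x (e k) \<noteq> 0"
  proof (rule ccontr)
    assume no: "\<not> ?thesis"
    have "(3 / 2 * \<beta> - \<beta>) * norm x \<le> norm (0::'k)"
      by (rule norm_solves_le[OF J, where z = z])
        (use no x(1) \<beta>_pos in \<open>auto simp: solves_def in_disc_def not_less\<close>)
    then show False using \<beta>_pos x(2) by (simp add: mult_le_0_iff)
  qed
  then show ?thesis using that by blast
qed

lemma eigenvector_component:
  assumes J: "J \<subseteq> I" and x: "solves J z x 0" "x \<noteq> 0" and k: "k \<in> J" "in_disc z k"
  shows "cinner x (e k) \<noteq> 0"
proof
  assume "cinner x (e k) = 0"
  then have "3 / 2 * \<beta> * norm x \<le> norm (0::'k)"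
    by (intro off_disc_estimate[OF J k(2,1)]) (use x in \<open>auto simp: solves_def\<close>)
  then show False using \<beta>_pos x(2) by (simp add: mult_le_0_iff)
qed

text \<open>
  An eigenvector for an eigenvalue in the \<open>k\<close>-th disc is dominated by its \<open>k\<close>-th coordinate:
  the rest solves an equation with right-hand side \<open>C (e k)\<close>.
\<close>
lemma normalized_eigenvector:
  assumes J: "J \<subseteq> I" and x: "solves J z x 0" "x \<noteq> 0" and k: "k \<in> J" "in_disc z k"
  defines "u \<equiv> (1 / cinner x (e k)) *\<^sub>C x"
  shows "solves J z u 0" "cinner u (e k) = 1" "norm (u - e k) \<le> 2 / 3"
proof -
  show u: "solves J z u 0" using solves_scale[OF x(1), of "1 / cinner x (e k)"] by (simp add: u_def)
  show uk: "cinner u (e k) = 1"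
    using eigenvector_component[OF J x k] by (simp add: u_def cinner_simps)
  have kI: "k \<in> I" using J k by blast
  have "3 / 2 * \<beta> * norm (u - e k) \<le> norm (C (e k))"
  proof (rule off_disc_estimate[OF J k(2,1)])
    show "cinner (u - e k) (e k) = 0" using uk kI by (simp add: cinner_simps orthonormal)
    show "cinner (u - e k) (e j) = 0" if "j \<in> I - J" for j
      using that u k kI by (auto simp: solves_def cinner_simps orthonormal)
    show "(a j - z) * cinner (u - e k) (e j) = cinner (C (u - e k)) (e j) + cinner (C (e k)) (e j)"
      if "j \<in> J - {k}" for j
    proof -
      have "cinner (e k) (e j) = 0" using that J kI by (subst orthonormal) auto
      then show ?thesis using that u by (auto simp: solves_def cinner_simps C_diff)
    qed
  qed
  also have "\<dots> \<le> \<beta>" using norm_C[of "e k"] norm_basis[OF kI] by simp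
  finally show "norm (u - e k) \<le> 2 / 3" using \<beta>_pos by (simp add: field_simps)
qed

text \<open>
  The equation off the \<open>k\<close>-th coordinate bounds \<open>y\<close> by \<open>\<bar>c\<bar>\<close> and \<open>f\<close>; the \<open>k\<close>-th coordinate of the
  equation in turn bounds \<open>\<bar>c\<bar>\<close> by \<open>y\<close> and \<open>f\<close>.  The composite factor in front of \<open>\<bar>c\<bar>\<close> is \<open>4/9\<close>, so
  the two bounds close up.  With \<open>f = 0\<close> this excludes a second eigenvalue in the disc and a
  Jordan chain at the first.
\<close>
lemma stability:
  assumes J: "J \<subseteq> I" and k: "k \<in> J" "in_disc z k"
    and u: "cinner u (e k) = 1" "norm (u - e k) \<le> 2 / 3"
    and y: "solves J z y (c *\<^sub>C u + f)" "cinner y (e k) = 0"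
  shows "cmod c \<le> 3 * norm f"
proof -
  have kI: "k \<in> I" using J k by blast
  have "3 / 2 * \<beta> * norm y \<le> norm (c *\<^sub>C (u - e k) + f)"
  proof (rule off_disc_estimate[OF J k(2,1) y(2)])
    show "cinner y (e j) = 0" if "j \<in> I - J" for j using that y(1) by (auto simp: solves_def)
    show "(a j - z) * cinner y (e j) = cinner (C y) (e j) + cinner (c *\<^sub>C (u - e k) + f) (e j)"
      if "j \<in> J - {k}" for j
    proof -
      have "cinner (e k) (e j) = 0" using that J kI by (subst orthonormal) auto
      then show ?thesis using that y(1) by (auto simp: solves_def cinner_simps)
    qed
  qed
  also have "\<dots> \<le> cmod c * (2 / 3) + norm f"
    using norm_triangle_ineq[of "c *\<^sub>C (u - e k)" f] mult_left_mono[OF u(2), of "cmod c"]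
    by (simp add: norm_scaleC)
  finally have 1: "3 / 2 * (\<beta> * norm y) \<le> cmod c * (2 / 3) + norm f" by simp
  have "(a k - z) * cinner y (e k) = cinner (C y) (e k) + cinner (c *\<^sub>C u + f) (e k)"
    using y(1) k(1) by (auto simp: solves_def)
  then have "c = - (cinner (C y) (e k) + cinner f (e k))"
    using y(2) u(1) by (simp add: cinner_simps) algebra
  then have "cmod c \<le> cmod (cinner (C y) (e k)) + cmod (cinner f (e k))"
    by (metis norm_minus_cancel norm_triangle_ineq)
  also have "\<dots> \<le> norm (C y) + norm f"
    using norm_cinner_le[of "C y" "e k"] norm_cinner_le[of f "e k"] norm_basis[OF kI] by simp
  also have "\<dots> \<le> \<beta> * norm y + norm f" using norm_C by simp
  finally show ?thesis using 1 by linarith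
qed

text \<open>
  The difference of the approximate and the exact eigenvector, both with \<open>k\<close>-th coordinate \<open>1\<close>,
  solves the equation at \<open>z\<close> with right-hand side \<open>(z' - z) u + f\<close>.
\<close>
lemma eigenvalue_near_approximate_eigenvalue:
  assumes J: "J \<subseteq> I" and k: "k \<in> J" "in_disc z k"
    and x: "solves J z x 0" "x \<noteq> 0"
    and u: "solves J z' u f" "cinner u (e k) = 1" "norm (u - e k) \<le> 2 / 3"
  shows "cmod (z' - z) \<le> 3 * norm f"
proof -
  define w where "w = (1 / cinner x (e k)) *\<^sub>C x"
  note w = normalized_eigenvector[OF J x k, folded w_def]
  have "solves J z u ((z' - z) *\<^sub>C u + f)"
    using u(1) unfolding solves_def by (auto simp: cinner_simps algebra_simps)
  from solves_diff[OF this w(1)] have "solves J z (u - w) ((z' - z) *\<^sub>C u + f)" by simp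
  moreover have "cinner (u - w) (e k) = 0" using u(2) w(2) by (simp add: cinner_simps)
  ultimately show ?thesis by (rule stability[OF J k u(2,3)])
qed

lemma eigenvalue_in_disc_unique:
  assumes "J \<subseteq> I" "k \<in> J" "in_disc z k" "in_disc z' k"
    and "solves J z x 0" "x \<noteq> 0" "solves J z' x' 0" "x' \<noteq> 0"
  shows "z = z'"
  using eigenvalue_near_approximate_eigenvalue[OF assms(1,2,3,5,6)
      normalized_eigenvector[OF assms(1,7,8,2,4)]] by simp

lemma no_jordan_chain:
  assumes J: "J \<subseteq> I" and x: "solves J z x 0" "x \<noteq> 0"
    and y: "solves J z y (c *\<^sub>C x)"
  shows "c = 0"
proof -
  obtain k where k: "k \<in> J" "in_disc z k" "cinner x (e k) \<noteq> 0"
    using eigenvector_disc[OF J x] .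
  define u where "u = (1 / cinner x (e k)) *\<^sub>C x"
  note u = normalized_eigenvector[OF J x k(1,2), folded u_def]
  have xu: "x = cinner x (e k) *\<^sub>C u" using k(3) by (simp add: u_def scaleC_scaleC scaleC_one)
  let ?y = "y - cinner y (e k) *\<^sub>C u"
  have "solves J z ?y (c *\<^sub>C x - cinner y (e k) *\<^sub>C 0)"
    by (rule solves_diff[OF y solves_scale[OF u(1)]])
  then have "solves J z ?y ((c * cinner x (e k)) *\<^sub>C u + 0)"
    by (subst (asm) xu) (simp add: scaleC_scaleC)
  moreover have "cinner ?y (e k) = 0" using u(2) by (simp add: cinner_simps)
  ultimately have "cmod (c * cinner x (e k)) \<le> 3 * norm (0::'k)"
    by (rule stability[OF J k(1,2) u(2,3)])
  then show ?thesis using k(3) by simp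
qed

lemma eigenvector_unique:
  assumes J: "J \<subseteq> I" and x: "solves J z x 0" "x \<noteq> 0" and y: "solves J z y 0"
  obtains c where "y = c *\<^sub>C x"
proof -
  obtain k where k: "k \<in> J" "in_disc z k" "cinner x (e k) \<noteq> 0"
    using eigenvector_disc[OF J x] .
  define c where "c = cinner y (e k) / cinner x (e k)"
  have "solves J z (y - c *\<^sub>C x) (0 - c *\<^sub>C 0)"
    by (rule solves_diff[OF y solves_scale[OF x(1)]])
  moreover have "cinner (y - c *\<^sub>C x) (e k) = 0" using k(3) by (simp add: c_def cinner_simps)
  ultimately have "y - c *\<^sub>C x = 0"
    using eigenvector_component[OF J _ _ k(1,2), of "y - c *\<^sub>C x"] by auto
  then have "y = c *\<^sub>C x" by simp
  then show ?thesis by (rule that)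
qed

end

section \<open>Eigenvalues of finite sections\<close>

text \<open>The last nonzero vector in the chain that starts at a generalized eigenvector.\<close>
lemma eigenvector_of_alg_multiplicity:
  assumes mult: "alg_multiplicity M T z > 0"
    and inv: "\<And>x. x \<in> M \<Longrightarrow> T x - z *\<^sub>C x \<in> M"
  shows "\<exists>x\<in>M. x \<noteq> 0 \<and> T x = z *\<^sub>C x"
proof -
  let ?N = "\<lambda>x. T x - z *\<^sub>C x"
  have ev: "\<exists>x\<in>M. x \<noteq> 0 \<and> T x = z *\<^sub>C x" if "x \<in> M" "x \<noteq> 0" "(?N ^^ n) x = 0" for n x
    using that
  proof (induction n arbitrary: x)
    case (Suc n)
    have "(?N ^^ n) (?N x) = 0" using Suc.prems(3) unfolding funpow_Suc_right comp_def .
    then show ?case using Suc.IH[of "?N x"] inv[OF Suc.prems(1)] Suc.prems(1,2)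
      by (cases "?N x = 0") auto
  qed simp
  have "\<exists>x\<in>M. x \<noteq> 0 \<and> (\<exists>n. (?N ^^ n) x = 0)"
  proof (rule ccontr)
    assume "\<not> ?thesis"
    then have "{x \<in> M. \<exists>n. (?N ^^ n) x = 0} \<subseteq> complex_vector.span {}" by auto
    from complex_vector.dim_le_card[OF this] show False
      using mult by (simp add: alg_multiplicity_def)
  qed
  then show ?thesis using ev by blast
qed

text \<open>
  \<open>\<Phi>\<close> carries the abstract finite-dimensional space \<open>M\<close> into the coordinate space; \<open>T\<close> is then the
  compression of the perturbed diagonal operator to the coordinates in \<open>J\<close>.  \<open>T\<close> stays on its own
  space because the multiplicities to be counted are defined there.
\<close>
locale finite_section = diagonal_perturbation I e a C \<beta>
  for I :: "'i::linorder set" and e :: "'i \<Rightarrow> 'k::chilbert_space" and a C \<beta> +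
  fixes J :: "'i set" and M :: "'a::complex_vector set" and T :: "'a \<Rightarrow> 'a" and \<Phi> :: "'a \<Rightarrow> 'k"
  assumes J: "J \<subseteq> I" "finite J"
    and M: "complex_vector.subspace M"
    and T_in: "x \<in> M \<Longrightarrow> T x \<in> M"
    and T_add: "x \<in> M \<Longrightarrow> y \<in> M \<Longrightarrow> T (x + y) = T x + T y"
    and T_scale: "x \<in> M \<Longrightarrow> T (c *\<^sub>C x) = c *\<^sub>C T x"
    and \<Phi>_diff: "x \<in> M \<Longrightarrow> y \<in> M \<Longrightarrow> \<Phi> (x - y) = \<Phi> x - \<Phi> y"
    and \<Phi>_scale: "x \<in> M \<Longrightarrow> \<Phi> (c *\<^sub>C x) = c *\<^sub>C \<Phi> x"
    and \<Phi>_inj: "x \<in> M \<Longrightarrow> \<Phi> x = 0 \<Longrightarrow> x = 0"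
    and \<Phi>_support: "x \<in> M \<Longrightarrow> j \<in> I - J \<Longrightarrow> cinner (\<Phi> x) (e j) = 0"
    and \<Phi>_T: "x \<in> M \<Longrightarrow> j \<in> J \<Longrightarrow>
      cinner (\<Phi> (T x)) (e j) = a j * cinner (\<Phi> x) (e j) - cinner (C (\<Phi> x)) (e j)"
begin

abbreviation shifted :: "complex \<Rightarrow> 'a \<Rightarrow> 'a" where
  "shifted z \<equiv> (\<lambda>y. T y - z *\<^sub>C y)"

lemma shifted_in: "x \<in> M \<Longrightarrow> shifted z x \<in> M"
  using M T_in by (simp add: complex_vector.subspace_diff complex_vector.subspace_scale)

lemma \<Phi>_0: "\<Phi> 0 = 0"
  using \<Phi>_diff[of 0 0] M by (simp add: complex_vector.subspace_0)

lemma solves_shifted: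
  assumes x: "x \<in> M"
  shows "solves J z (\<Phi> x) (\<Phi> (shifted z x))"
proof -
  have "\<Phi> (shifted z x) = \<Phi> (T x) - z *\<^sub>C \<Phi> x"
    using x T_in M by (simp add: \<Phi>_diff \<Phi>_scale complex_vector.subspace_scale)
  then show ?thesis using x
    by (simp add: solves_def \<Phi>_support \<Phi>_T cinner_simps left_diff_distrib)
qed

lemma solves_eigenvector:
  assumes "x \<in> M" "T x = z *\<^sub>C x"
  shows "solves J z (\<Phi> x) 0"
  using solves_shifted[OF assms(1), of z] assms(2) by (simp add: \<Phi>_0)

text \<open>Without Jordan chains, every generalized eigenvector is an eigenvector.\<close>
lemma generalized_eigenvector:
  assumes "x \<in> M" "(shifted z ^^ n) x = 0"
  shows "T x = z *\<^sub>C x"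
  using assms
proof (induction n arbitrary: x)
  case 0
  then show ?case using T_scale[of 0 0] M by (simp add: complex_vector.subspace_0)
next
  case (Suc n)
  let ?y = "shifted z x"
  have y: "?y \<in> M" using Suc.prems(1) by (rule shifted_in)
  have "(shifted z ^^ n) ?y = 0" using Suc.prems(2) unfolding funpow_Suc_right comp_def .
  then have Ty: "T ?y = z *\<^sub>C ?y" by (rule Suc.IH[OF y])
  have "?y = 0"
  proof (rule ccontr)
    assume "?y \<noteq> 0"
    then have nz: "\<Phi> ?y \<noteq> 0" using \<Phi>_inj[OF y] by blast
    have "solves J z (\<Phi> x) (1 *\<^sub>C \<Phi> ?y)"
      using solves_shifted[OF Suc.prems(1), of z] by (simp add: scaleC_one)
    from no_jordan_chain[OF J(1) solves_eigenvector[OF y Ty] nz this] show False by simp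
  qed
  then show ?case by simp
qed

lemma alg_multiplicity_le_1: "alg_multiplicity M T z \<le> 1"
proof (cases "\<exists>x\<in>M. x \<noteq> 0 \<and> T x = z *\<^sub>C x")
  case True
  then obtain x where x: "x \<in> M" "x \<noteq> 0" "T x = z *\<^sub>C x" by blast
  have "{x \<in> M. \<exists>n. (shifted z ^^ n) x = 0} \<subseteq> complex_vector.span {x}"
  proof safe
    fix y n assume y: "y \<in> M" "(shifted z ^^ n) y = 0"
    then have "T y = z *\<^sub>C y" by (rule generalized_eigenvector)
    then obtain c where "\<Phi> y = c *\<^sub>C \<Phi> x"
      using eigenvector_unique[OF J(1) solves_eigenvector[OF x(1,3)] _ solves_eigenvector[OF y(1)]]
        \<Phi>_inj[OF x(1)] x(2) by blast
    then have "\<Phi> (y - c *\<^sub>C x) = 0"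
      using x(1) y(1) M by (simp add: \<Phi>_diff \<Phi>_scale complex_vector.subspace_scale)
    then have "y - c *\<^sub>C x = 0"
      using x(1) y(1) M by (intro \<Phi>_inj) (auto simp: complex_vector.subspace_scale complex_vector.subspace_diff)
    then show "y \<in> complex_vector.span {x}" by (auto simp: complex_vector.span_singleton)
  qed
  from complex_vector.dim_le_card[OF this] show ?thesis by (simp add: alg_multiplicity_def)
next
  case False
  then have "{x \<in> M. \<exists>n. (shifted z ^^ n) x = 0} \<subseteq> complex_vector.span {}"
    using generalized_eigenvector by fastforce
  from complex_vector.dim_le_card[OF this] show ?thesis by (simp add: alg_multiplicity_def)
qed



text \<open>
  Existence of an eigenvalue in each disc comes from counting alone: the listed eigenvalues are
  as many as the discs, each lies in a disc, and no two lie in the same one.  The resulting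
  permutation of \<open>J\<close> is monotone because the discs have disjoint, ordered imaginary parts, and the
  only monotone permutation of a finite linear order is the identity.
\<close>
lemma enumerated_eigenvalue_in_disc:
  assumes count: "\<And>z. card {k \<in> J. \<eta> k = z} = alg_multiplicity M T z"
    and mono: "\<And>k l. k \<in> J \<Longrightarrow> l \<in> J \<Longrightarrow> k \<le> l \<Longrightarrow> Im (\<eta> k) \<le> Im (\<eta> l)"
    and sep: "\<And>k l. k \<in> J \<Longrightarrow> l \<in> J \<Longrightarrow> k < l \<Longrightarrow> Im (a k) + 3 * \<beta> \<le> Im (a l)"
    and k: "k \<in> J"
  shows "in_disc (\<eta> k) k" "\<exists>x\<in>M. x \<noteq> 0 \<and> T x = \<eta> k *\<^sub>C x"
proof -
  have ev: "\<exists>x\<in>M. x \<noteq> 0 \<and> T x = \<eta> k *\<^sub>C x" if "k \<in> J" for k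
  proof -
    have "card {l \<in> J. \<eta> l = \<eta> k} \<noteq> 0" using that J(2) by auto
    then have "alg_multiplicity M T (\<eta> k) > 0" using count[of "\<eta> k"] by simp
    then show ?thesis by (rule eigenvector_of_alg_multiplicity) (rule shifted_in)
  qed
  have "\<forall>k\<in>J. \<exists>l\<in>J. in_disc (\<eta> k) l"
  proof
    fix k assume "k \<in> J"
    from ev[OF this] obtain x where x: "x \<in> M" "x \<noteq> 0" "T x = \<eta> k *\<^sub>C x" by blast
    then show "\<exists>l\<in>J. in_disc (\<eta> k) l"
      using eigenvector_disc[OF J(1) solves_eigenvector[OF x(1,3)]] \<Phi>_inj by blast
  qed
  then obtain \<sigma> where \<sigma>: "\<And>k. k \<in> J \<Longrightarrow> \<sigma> k \<in> J" "\<And>k. k \<in> J \<Longrightarrow> in_disc (\<eta> k) (\<sigma> k)"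
    by metis
  have inj: "\<sigma> k \<noteq> \<sigma> l" if kl: "k \<in> J" "l \<in> J" "k \<noteq> l" for k l
  proof
    assume eq: "\<sigma> k = \<sigma> l"
    obtain x where x: "x \<in> M" "x \<noteq> 0" "T x = \<eta> k *\<^sub>C x" using ev[OF kl(1)] by blast
    obtain y where y: "y \<in> M" "y \<noteq> 0" "T y = \<eta> l *\<^sub>C y" using ev[OF kl(2)] by blast
    have "solves J (\<eta> k) (\<Phi> x) 0" "solves J (\<eta> l) (\<Phi> y) 0"
      by (rule solves_eigenvector; fact)+
    moreover have "\<Phi> x \<noteq> 0" "\<Phi> y \<noteq> 0" using \<Phi>_inj x y by blast+
    moreover have "in_disc (\<eta> l) (\<sigma> k)" using \<sigma>(2)[OF kl(2)] eq by simp
    ultimately have "\<eta> k = \<eta> l"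
      using eigenvalue_in_disc_unique[OF J(1) \<sigma>(1)[OF kl(1)] \<sigma>(2)[OF kl(1)]] by blast
    then have "card {k, l} \<le> card {i \<in> J. \<eta> i = \<eta> k}"
      using kl J(2) by (intro card_mono) auto
    then show False using alg_multiplicity_le_1[of "\<eta> k"] count[of "\<eta> k"] kl(3) by simp
  qed
  have less: "\<sigma> k < \<sigma> l" if kl: "k \<in> J" "l \<in> J" "k < l" for k l
  proof (rule ccontr)
    assume "\<not> \<sigma> k < \<sigma> l"
    then have "\<sigma> l < \<sigma> k" using inj[OF kl(1,2)] less_imp_neq[OF kl(3)] by (auto simp: not_less le_less)
    then have "Im (a (\<sigma> l)) + 3 * \<beta> \<le> Im (a (\<sigma> k))" by (rule sep[OF \<sigma>(1)[OF kl(2)] \<sigma>(1)[OF kl(1)]])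
    moreover have "\<bar>Im (a (\<sigma> l)) - Im (\<eta> l)\<bar> < 3 / 2 * \<beta>" "\<bar>Im (a (\<sigma> k)) - Im (\<eta> k)\<bar> < 3 / 2 * \<beta>"
      using \<sigma>(2)[OF kl(1)] \<sigma>(2)[OF kl(2)] abs_Im_le_cmod[of "a (\<sigma> l) - \<eta> l"]
        abs_Im_le_cmod[of "a (\<sigma> k) - \<eta> k"] by (auto simp: in_disc_def)
    moreover have "Im (\<eta> k) \<le> Im (\<eta> l)" using mono[OF kl(1,2)] kl(3) by simp
    ultimately show False by linarith
  qed
  let ?L = "sorted_list_of_set J"
  have sorted: "sorted_wrt (<) ?L" by (simp add: strict_sorted_iff)
  then have "sorted_wrt (<) (map \<sigma> ?L)"
    unfolding sorted_wrt_map
    by (rule sorted_wrt_mono_rel[rotated]) (use less J(2) in auto)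
  moreover have "\<sigma> ` J = J"
    using J(2) \<sigma>(1) inj by (intro card_subset_eq) (auto intro!: card_image inj_onI)
  ultimately have "map \<sigma> ?L = ?L"
    using J(2) sorted by (intro strict_sorted_equal) auto
  then have "\<sigma> k = k" using k J(2) by (metis map_eq_conv map_ident set_sorted_list_of_set)
  then show "in_disc (\<eta> k) k" using \<sigma>(2)[OF k] by simp
  show "\<exists>x\<in>M. x \<noteq> 0 \<and> T x = \<eta> k *\<^sub>C x" by (rule ev[OF k])
qed

end

section \<open>Bounded positive operators\<close>

text \<open>Polarization with \<open>x + y\<close> and \<open>x + \<i> y\<close>.\<close>
lemma positive_imp_symmetric:
  fixes T :: "'k::complex_inner \<Rightarrow> 'k"
  assumes add: "\<And>x y. T (x + y) = T x + T y" and scale: "\<And>c x. T (c *\<^sub>C x) = c *\<^sub>C T x"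
    and pos: "\<And>x. cinner (T x) x \<in> \<real>\<^sub>\<ge>\<^sub>0"
  shows "cinner (T x) y = cinner x (T y)"
proof -
  have real: "Im (cinner (T x) x) = 0" for x using pos[of x] by (simp add: complex_nonneg_Reals_iff)
  have 1: "Im (cinner (T x) y) + Im (cinner (T y) x) = 0"
    using real[of "x + y"] real[of x] real[of y] by (simp add: add cinner_simps)
  have 2: "Re (cinner (T y) x) = Re (cinner (T x) y)"
    using real[of "x + \<i> *\<^sub>C y"] real[of x] real[of y] by (simp add: add scale cinner_simps)
  have "cinner (T x) y = cnj (cinner (T y) x)"
    using 1 2 by (simp add: complex_eq_iff)
  then show ?thesis by (metis cinner_commute)
qed

text \<open>
  Positivity tested at \<open>x - T x / b\<close> yields \<open>\<parallel>T x\<parallel>\<^sup>2 \<le> b \<langle>T x, x\<rangle>\<close>, which is the claim after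
  expanding the square.
\<close>
lemma norm_positive_minus_half_bound:
  fixes T :: "'k::complex_inner \<Rightarrow> 'k"
  assumes add: "\<And>x y. T (x + y) = T x + T y" and scale: "\<And>c x. T (c *\<^sub>C x) = c *\<^sub>C T x"
    and pos: "\<And>x. cinner (T x) x \<in> \<real>\<^sub>\<ge>\<^sub>0"
    and bound: "\<And>x. norm (T x) \<le> b * norm x" and b: "b > 0"
  shows "norm (T x - complex_of_real (b / 2) *\<^sub>C x) \<le> b / 2 * norm x"
proof -
  have sym: "cinner (T x) y = cinner x (T y)" for x y
    by (rule positive_imp_symmetric[OF add scale pos])
  have diff: "T (x - y) = T x - T y" for x y
    using add[of "x - y" y] by (simp add: algebra_simps)
  let ?t = "complex_of_real (1 / b)"
  have "0 \<le> Re (cinner (T (x - ?t *\<^sub>C T x)) (x - ?t *\<^sub>C T x))"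
    using pos by (metis complex_nonneg_Reals_iff)
  also have "\<dots> = Re (cinner (T x) x) - 2 / b * (norm (T x))\<^sup>2 + Re (cinner (T (T x)) (T x)) / b\<^sup>2"
    by (simp add: diff scale cinner_simps sym[of "T x" x] cinner_self power2_eq_square algebra_simps)
  also have "Re (cinner (T (T x)) (T x)) \<le> b * (norm (T x))\<^sup>2"
  proof -
    have "Re (cinner (T (T x)) (T x)) \<le> norm (T (T x)) * norm (T x)"
      using complex_Re_le_cmod norm_cinner_le order_trans by blast
    also have "\<dots> \<le> b * norm (T x) * norm (T x)" by (intro mult_right_mono bound) simp
    finally show ?thesis by (simp add: power2_eq_square mult.assoc)
  qed
  finally have "(norm (T x))\<^sup>2 \<le> b * Re (cinner (T x) x)"
    using b by (simp add: divide_right_mono field_simps power2_eq_square)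
  then have "(norm (T x - complex_of_real (b / 2) *\<^sub>C x))\<^sup>2 \<le> (b / 2 * norm x)\<^sup>2"
    using b by (simp add: norm_diff_sq cinner_scaleC_right norm_scaleC power_mult_distrib power_divide)
  then show ?thesis by (rule power2_le_imp_le) (use b in simp)
qed

section \<open>The energy space in the coordinates of the undamped eigenvectors\<close>

locale damped_system =
  fixes A S :: "'h::chilbert_space \<Rightarrow> 'h" and DA DS :: "'h set"
    and \<mu> :: "nat \<Rightarrow> real" and v :: "nat \<Rightarrow> 'h"
    and B :: "'h \<times> 'h \<Rightarrow> 'h \<times> 'h"
  assumes A: "stiffness_operator DA A \<mu> v"
    and S: "is_sqrt_of DS S DA A"
    and B: "damping_operator DS S B"
    and skew: "skew_adjoint (energy_space DS) (energy_inner S) (op_domain DA DS) (undamped_op A)"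
begin

abbreviation "V \<equiv> energy_space DS"
abbreviation "ip \<equiv> energy_inner S"
abbreviation "Dom \<equiv> op_domain DA DS"

text \<open>
  An isometry of the energy space onto \<open>H \<times> H\<close> with its product norm, where the topology and the
  completeness provided by type classes are available.
\<close>
definition \<Phi> :: "'h \<times> 'h \<Rightarrow> 'h \<times> 'h" where
  "\<Phi> Y = (S (fst Y), snd Y)"

definition \<Psi> :: "'h \<times> 'h \<Rightarrow> 'h \<times> 'h" where
  "\<Psi> Z = (inv_into DS S (fst Z), snd Z)"

definition e :: "int \<Rightarrow> 'h \<times> 'h" where
  "e k = \<Phi> (Vec \<mu> v k)"

definition b :: real where "b = op_norm V ip B"

lemma ip_eq: "ip Y Z = cinner (\<Phi> Y) (\<Phi> Z)"
  by (simp add: energy_inner_def \<Phi>_def cinner_prod_def)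

lemma vnorm_eq: "vnorm ip Y = norm (\<Phi> Y)"
  by (simp add: vnorm_def ip_eq cinner_self)

lemma A_props:
  shows A_v: "n \<ge> 1 \<Longrightarrow> A (v n) = complex_of_real (\<mu> n) *\<^sub>C v n"
    and v_DA: "n \<ge> 1 \<Longrightarrow> v n \<in> DA"
    and \<mu>_less: "1 \<le> m \<Longrightarrow> m < n \<Longrightarrow> \<mu> m < \<mu> n"
    and \<mu>_1: "0 < \<mu> 1"
    and bij_A: "bij_betw A DA UNIV"
    and lin_A: "linear_op UNIV DA A"
proof -
  note A' = A[unfolded stiffness_operator_def]
  have v: "\<forall>k\<ge>1. v k \<in> DA \<and> A (v k) = complex_of_real (\<mu> k) *\<^sub>C v k \<and> norm (v k) = 1"
    using A' by blast
  then show "n \<ge> 1 \<Longrightarrow> A (v n) = complex_of_real (\<mu> n) *\<^sub>C v n" "n \<ge> 1 \<Longrightarrow> v n \<in> DA"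
    by blast+
  have "strict_mono_on {1..} \<mu>" using A' by blast
  then show "1 \<le> m \<Longrightarrow> m < n \<Longrightarrow> \<mu> m < \<mu> n" by (rule strict_mono_onD) auto
  show "0 < \<mu> 1" using A' by blast
  have "compact_inverse DA A" "self_adjoint UNIV cinner DA A" using A' by blast+
  then show "bij_betw A DA UNIV" "linear_op UNIV DA A"
    by (simp_all add: compact_inverse_def self_adjoint_def)
qed

lemma \<mu>_pos: "n \<ge> 1 \<Longrightarrow> \<mu> n > 0"
  using \<mu>_1 \<mu>_less[of 1 n] by (cases "n = 1") auto

lemma S_props:
  shows DS: "complex_vector.subspace DS"
    and S_add: "x \<in> DS \<Longrightarrow> y \<in> DS \<Longrightarrow> S (x + y) = S x + S y"
    and S_scale: "x \<in> DS \<Longrightarrow> S (c *\<^sub>C x) = c *\<^sub>C S x"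
    and S_pos: "x \<in> DS \<Longrightarrow> cinner (S x) x \<in> \<real>\<^sub>\<ge>\<^sub>0"
    and DA_iff: "x \<in> DA \<longleftrightarrow> x \<in> DS \<and> S x \<in> DS"
    and SS: "x \<in> DA \<Longrightarrow> S (S x) = A x"
  using S unfolding is_sqrt_of_def self_adjoint_def linear_op_def positive_op_def by auto

lemma S_0: "S 0 = 0"
  using S_scale[of 0 0] DS by (simp add: complex_vector.subspace_0)

lemma S_diff: "x \<in> DS \<Longrightarrow> y \<in> DS \<Longrightarrow> S (x - y) = S x - S y"
  using S_add[of "x - y" y] DS by (simp add: complex_vector.subspace_diff algebra_simps)

text \<open>
  \<open>u = S v - \<surd>\<mu> v\<close> satisfies \<open>S u = - \<surd>\<mu> u\<close>, and \<open>S\<close> is positive.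
\<close>
lemma S_v:
  assumes n: "n \<ge> 1"
  shows "S (v n) = complex_of_real (sqrt (\<mu> n)) *\<^sub>C v n"
proof -
  let ?s = "complex_of_real (sqrt (\<mu> n))"
  have ss: "?s * ?s = complex_of_real (\<mu> n)"
    using \<mu>_pos[OF n] by (simp flip: of_real_mult)
  have v: "v n \<in> DS" "S (v n) \<in> DS" using v_DA[OF n] DA_iff by blast+
  define u where "u = S (v n) - ?s *\<^sub>C v n"
  have u: "u \<in> DS"
    using v DS by (simp add: u_def complex_vector.subspace_diff complex_vector.subspace_scale)
  have "S u = A (v n) - ?s *\<^sub>C S (v n)"
    using v DS SS[OF v_DA[OF n]]
    by (simp add: u_def S_diff S_scale complex_vector.subspace_scale)
  also have "\<dots> = (- ?s) *\<^sub>C u"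
    using ss by (simp add: A_v[OF n] u_def complex_vector.scale_right_diff_distrib scaleC_scaleC)
  finally have "cinner (S u) u = - ?s * complex_of_real ((norm u)\<^sup>2)"
    by (metis cinner_scaleC_left cinner_self)
  then have "- (sqrt (\<mu> n) * (norm u)\<^sup>2) \<ge> 0"
    using S_pos[OF u] by (simp add: complex_nonneg_Reals_iff)
  moreover have "sqrt (\<mu> n) > 0" using \<mu>_pos[OF n] by simp
  ultimately have "u = 0" by (simp add: mult_le_0_iff)
  then show ?thesis by (simp add: u_def)
qed

lemma bij_S: "bij_betw S DS UNIV"
proof (rule bij_betw_imageI)
  have ker: "x = 0" if "x \<in> DS" "S x = 0" for x
  proof -
    have x: "x \<in> DA" using that DS DA_iff by (simp add: complex_vector.subspace_0)
    moreover have "A x = 0" using SS[OF x] that S_0 by simp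
    moreover have "0 \<in> DA" "A 0 = 0"
      using DS DA_iff SS[of 0] S_0 by (auto simp: complex_vector.subspace_0)
    ultimately show "x = 0" using bij_A by (metis bij_betw_imp_inj_on inj_onD)
  qed
  show "inj_on S DS"
  proof (rule inj_onI)
    fix x y assume "x \<in> DS" "y \<in> DS" "S x = S y"
    then show "x = y" using ker[of "x - y"] DS S_diff by (simp add: complex_vector.subspace_diff)
  qed
  show "S ` DS = UNIV"
  proof -
    have "y \<in> S ` DS" for y
    proof -
      have "y \<in> A ` DA" using bij_A by (simp add: bij_betw_def)
      then obtain x where x: "x \<in> DA" "A x = y" by blast
      then have "S x \<in> DS" "S (S x) = y" using SS[OF x(1)] DA_iff[of x] by simp_all
      then show ?thesis by blast
    qed
    then show ?thesis by blast
  qed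
qed

lemma V_subspace: "complex_vector.subspace V"
  using DS by (auto simp: energy_space_def complex_vector.subspace_def scaleC_prod_def zero_prod_def)

lemma V_iff: "Y \<in> V \<longleftrightarrow> fst Y \<in> DS"
  by (auto simp: energy_space_def mem_Times_iff)

lemma \<Phi>_add: "Y \<in> V \<Longrightarrow> Z \<in> V \<Longrightarrow> \<Phi> (Y + Z) = \<Phi> Y + \<Phi> Z"
  by (simp add: \<Phi>_def V_iff S_add)

lemma \<Phi>_diff: "Y \<in> V \<Longrightarrow> Z \<in> V \<Longrightarrow> \<Phi> (Y - Z) = \<Phi> Y - \<Phi> Z"
  by (simp add: \<Phi>_def V_iff S_diff)

lemma \<Phi>_scale: "Y \<in> V \<Longrightarrow> \<Phi> (c *\<^sub>C Y) = c *\<^sub>C \<Phi> Y"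
  by (simp add: \<Phi>_def V_iff S_scale scaleC_prod_def)

lemma \<Phi>_0 [simp]: "\<Phi> 0 = 0"
  by (simp add: \<Phi>_def S_0 zero_prod_def)

lemma \<Phi>_sum: "(\<And>i. i \<in> F \<Longrightarrow> f i \<in> V) \<Longrightarrow> \<Phi> (sum f F) = (\<Sum>i\<in>F. \<Phi> (f i))"
  by (induction F rule: infinite_finite_induct)
    (auto simp: \<Phi>_add V_subspace complex_vector.subspace_sum)

lemma \<Psi>_in [simp]: "\<Psi> Z \<in> V"
  using bij_S by (simp add: V_iff \<Psi>_def bij_betw_def inv_into_into)

lemma \<Phi>\<Psi> [simp]: "\<Phi> (\<Psi> Z) = Z"
  using bij_S by (simp add: \<Phi>_def \<Psi>_def bij_betw_inv_into_right)

lemma \<Psi>\<Phi>: "Y \<in> V \<Longrightarrow> \<Psi> (\<Phi> Y) = Y"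
  using bij_S by (simp add: \<Phi>_def \<Psi>_def V_iff bij_betw_inv_into_left)

lemma \<Phi>_inj: "Y \<in> V \<Longrightarrow> Z \<in> V \<Longrightarrow> \<Phi> Y = \<Phi> Z \<Longrightarrow> Y = Z"
  by (metis \<Psi>\<Phi>)

lemma \<Psi>_add: "\<Psi> (Y + Z) = \<Psi> Y + \<Psi> Z"
  by (rule \<Phi>_inj) (auto simp: \<Phi>_add V_subspace complex_vector.subspace_add)

lemma \<Psi>_scale: "\<Psi> (c *\<^sub>C Z) = c *\<^sub>C \<Psi> Z"
  by (rule \<Phi>_inj) (auto simp: \<Phi>_scale V_subspace complex_vector.subspace_scale)

lemma lam_square:
  assumes "k \<in> Zstar"
  shows "lam \<mu> k * lam \<mu> k = - complex_of_real (\<mu> (nat \<bar>k\<bar>))" "lam \<mu> k \<noteq> 0"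
    "cnj (lam \<mu> k) = - lam \<mu> k"
proof -
  have "nat \<bar>k\<bar> \<ge> 1" using assms by (auto simp: Zstar_def)
  from \<mu>_pos[OF this] have pos: "0 < \<mu> (nat \<bar>k\<bar>)" .
  define s where "s = sqrt (\<mu> (nat \<bar>k\<bar>))"
  have s: "\<mu> (nat \<bar>k\<bar>) = s * s" "s \<noteq> 0" using pos by (simp_all add: s_def)
  have "sgn k = 1 \<or> sgn k = - 1" using assms by (simp add: Zstar_def sgn_if)
  then have "lam \<mu> k = \<i> * s \<or> lam \<mu> k = - (\<i> * s)"
    by (auto simp: lam_def s_def)
  then show "lam \<mu> k * lam \<mu> k = - complex_of_real (\<mu> (nat \<bar>k\<bar>))"
    "lam \<mu> k \<noteq> 0" "cnj (lam \<mu> k) = - lam \<mu> k"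
    unfolding s(1) using s(2) by (auto simp: complex_eq_iff)
qed

lemma e_eq:
  assumes k: "k \<in> Zstar"
  shows "e k = complex_of_real (1 / sqrt 2) *\<^sub>C
    ((- \<i> * of_int (sgn k)) *\<^sub>C v (nat \<bar>k\<bar>), v (nat \<bar>k\<bar>))"
proof -
  have n: "nat \<bar>k\<bar> \<ge> 1" using k by (auto simp: Zstar_def)
  have "v (nat \<bar>k\<bar>) \<in> DS" using v_DA[OF n] DA_iff by blast
  moreover have "1 / lam \<mu> k * complex_of_real (sqrt (\<mu> (nat \<bar>k\<bar>))) = - \<i> * of_int (sgn k)"
    using \<mu>_pos[OF n] k by (auto simp: lam_def Zstar_def sgn_if field_simps)
  moreover have "S (r *\<^sub>C c *\<^sub>C v (nat \<bar>k\<bar>)) = r *\<^sub>C (c * complex_of_real (sqrt (\<mu> (nat \<bar>k\<bar>)))) *\<^sub>C v (nat \<bar>k\<bar>)"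
    for r c
    using calculation(1) unfolding scaleC_scaleC by (simp add: S_scale S_v[OF n] scaleC_scaleC mult.assoc)
  ultimately show ?thesis
    unfolding e_def Vec_def \<Phi>_def scaleC_prod_def fst_conv snd_conv by presburger
qed

lemma cinner_e:
  assumes k: "k \<in> Zstar"
  shows "cinner Z (e k) = complex_of_real (1 / sqrt 2) *
    (\<i> * of_int (sgn k) * cinner (fst Z) (v (nat \<bar>k\<bar>)) + cinner (snd Z) (v (nat \<bar>k\<bar>)))"
  unfolding e_eq[OF k] by (simp add: cinner_prod_def scaleC_prod_def cinner_simps distrib_left)

sublocale onb Zstar e
proof
  fix i j assume i: "i \<in> Zstar" and j: "j \<in> Zstar"
  have n: "nat \<bar>i\<bar> \<ge> 1" "nat \<bar>j\<bar> \<ge> 1" using i j by (auto simp: Zstar_def)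
  have two: "complex_of_real (1 / sqrt 2) * complex_of_real (1 / sqrt 2) = 1 / 2"
    unfolding of_real_mult[symmetric] by simp
  have fe: "fst (e i) = (complex_of_real (1 / sqrt 2) * (- \<i> * of_int (sgn i))) *\<^sub>C v (nat \<bar>i\<bar>)"
    "snd (e i) = complex_of_real (1 / sqrt 2) *\<^sub>C v (nat \<bar>i\<bar>)"
    unfolding e_eq[OF i] by (simp_all add: scaleC_prod_def scaleC_scaleC)
  have "cinner (e i) (e j) = complex_of_real (1 / sqrt 2) * complex_of_real (1 / sqrt 2) *
      (of_int (sgn i) * of_int (sgn j) + 1) * cinner (v (nat \<bar>i\<bar>)) (v (nat \<bar>j\<bar>))"
    unfolding cinner_e[OF j] fe cinner_scaleC_left
    by (simp only: distrib_left distrib_right mult.assoc mult.left_commute mult.commute) simp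
  also have "\<dots> = 1 / 2 * (of_int (sgn i * sgn j) + 1) * (if nat \<bar>i\<bar> = nat \<bar>j\<bar> then 1 else 0)"
    unfolding two stiffness_eigenvectors_orthonormal[OF A n] by simp
  also have "\<dots> = (if i = j then 1 else 0)"
    using i j by (auto simp: Zstar_def sgn_if)
  finally show "cinner (e i) (e j) = (if i = j then 1 else 0)" .
next
  fix Z assume Z: "\<And>i. i \<in> Zstar \<Longrightarrow> cinner Z (e i) = 0"
  have "cinner (fst Z) (v n) = 0 \<and> cinner (snd Z) (v n) = 0" if n: "n \<ge> 1" for n
  proof -
    have "int n \<in> Zstar" "- int n \<in> Zstar" using n by (auto simp: Zstar_def)
    from Z[OF this(1)] Z[OF this(2)]
    have "\<i> * cinner (fst Z) (v n) + cinner (snd Z) (v n) = 0"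
      "- \<i> * cinner (fst Z) (v n) + cinner (snd Z) (v n) = 0"
      using cinner_e[OF \<open>int n \<in> Zstar\<close>, of Z] cinner_e[OF \<open>- int n \<in> Zstar\<close>, of Z] n
      by (simp_all add: sgn_if)
    then show ?thesis by (auto simp: complex_eq_iff)
  qed
  then have "fst Z = 0" "snd Z = 0" using stiffness_eigenvectors_complete[OF A] by blast+
  then show "Z = 0" by (simp add: prod_eq_iff)
qed

lemma Vec_Dom: "k \<in> Zstar \<Longrightarrow> Vec \<mu> v k \<in> Dom"
proof -
  assume "k \<in> Zstar"
  then have n: "nat \<bar>k\<bar> \<ge> 1" by (auto simp: Zstar_def)
  have DA: "complex_vector.subspace DA" using lin_A by (simp add: linear_op_def)
  have "c *\<^sub>C v (nat \<bar>k\<bar>) \<in> DA \<inter> DS" for c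
    using complex_vector.subspace_scale[OF DA v_DA[OF n]] DA_iff by blast
  then show ?thesis
    by (simp add: Vec_def op_domain_def scaleC_prod_def scaleC_scaleC)
qed

lemma Dom_V: "Y \<in> Dom \<Longrightarrow> Y \<in> V"
  using DA_iff[of "fst Y"] by (simp add: op_domain_def V_iff mem_Times_iff)

lemma Dom_subspace: "complex_vector.subspace Dom"
  using skew by (simp add: skew_adjoint_def linear_op_def)

lemma undamped_V: "Y \<in> Dom \<Longrightarrow> undamped_op A Y \<in> V"
  using skew by (auto simp: skew_adjoint_def linear_op_def)

lemma undamped_Vec: "k \<in> Zstar \<Longrightarrow> undamped_op A (Vec \<mu> v k) = lam \<mu> k *\<^sub>C Vec \<mu> v k"
proof -
  assume k: "k \<in> Zstar"
  then have n: "nat \<bar>k\<bar> \<ge> 1" by (auto simp: Zstar_def)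
  have Ac: "A (c *\<^sub>C v (nat \<bar>k\<bar>)) = (c * complex_of_real (\<mu> (nat \<bar>k\<bar>))) *\<^sub>C v (nat \<bar>k\<bar>)" for c
  proof -
    have "\<forall>c. \<forall>x\<in>DA. A (c *\<^sub>C x) = c *\<^sub>C A x" using lin_A unfolding linear_op_def by (elim conjE)
    then have "A (c *\<^sub>C v (nat \<bar>k\<bar>)) = c *\<^sub>C A (v (nat \<bar>k\<bar>))" using v_DA[OF n] by blast
    then show ?thesis unfolding A_v[OF n] scaleC_scaleC .
  qed
  have "complex_of_real (\<mu> (nat \<bar>k\<bar>)) = - (lam \<mu> k * lam \<mu> k)" using lam_square(1)[OF k] by simp
  then have mu: "1 / lam \<mu> k * complex_of_real (\<mu> (nat \<bar>k\<bar>)) = - lam \<mu> k"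
    using lam_square(2)[OF k] by simp
  have 1: "r *\<^sub>C v (nat \<bar>k\<bar>) = lam \<mu> k *\<^sub>C r *\<^sub>C (1 / lam \<mu> k) *\<^sub>C v (nat \<bar>k\<bar>)" for r
    using lam_square(2)[OF k] by (simp add: scaleC_scaleC)
  have 2: "- A (r *\<^sub>C (1 / lam \<mu> k) *\<^sub>C v (nat \<bar>k\<bar>)) = lam \<mu> k *\<^sub>C r *\<^sub>C v (nat \<bar>k\<bar>)" for r
    unfolding scaleC_scaleC Ac mult.assoc mu by (simp only: mult_minus_right complex_vector.scale_minus_left minus_minus mult.commute)
  show ?thesis
    unfolding Vec_def undamped_op_def scaleC_prod_def fst_conv snd_conv
    by (intro arg_cong2[where f = Pair] 1 2)
qed

lemma skew_ip: "Y \<in> Dom \<Longrightarrow> Z \<in> Dom \<Longrightarrow> ip (undamped_op A Y) Z = - ip Y (undamped_op A Z)"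
proof -
  assume YZ: "Y \<in> Dom" "Z \<in> Dom"
  have "adjoint_graph V ip Dom (undamped_op A) = {(Y, - undamped_op A Y) | Y. Y \<in> Dom}"
    using skew unfolding skew_adjoint_def by (elim conjE)
  then have "(Z, - undamped_op A Z) \<in> adjoint_graph V ip Dom (undamped_op A)"
    using YZ by blast
  then have "\<forall>Y\<in>Dom. ip (undamped_op A Y) Z = ip Y (- undamped_op A Z)"
    unfolding adjoint_graph_def by blast
  then have "ip (undamped_op A Y) Z = ip Y (- undamped_op A Z)" using YZ(1) by blast
  moreover have "\<Phi> (- undamped_op A Z) = - \<Phi> (undamped_op A Z)"
    using \<Phi>_diff[of 0 "undamped_op A Z"] undamped_V[OF YZ(2)] V_subspace
    by (simp add: complex_vector.subspace_0)
  ultimately show ?thesis by (simp add: ip_eq)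
qed

text \<open>
  Skew-adjointness moves the unbounded operator onto \<open>V\<^sub>k\<close>, and \<open>\<lambda>\<^sub>k\<close> is imaginary.
\<close>
lemma undamped_coordinate:
  assumes "Y \<in> Dom" "k \<in> Zstar"
  shows "cinner (\<Phi> (undamped_op A Y)) (e k) = lam \<mu> k * cinner (\<Phi> Y) (e k)"
proof -
  have "ip (undamped_op A Y) (Vec \<mu> v k) = - ip Y (lam \<mu> k *\<^sub>C Vec \<mu> v k)"
    using skew_ip[OF assms(1) Vec_Dom[OF assms(2)]] undamped_Vec[OF assms(2)] by simp
  then show ?thesis using lam_square(3)[OF assms(2)] Dom_V[OF Vec_Dom[OF assms(2)]]
    by (simp add: ip_eq e_def \<Phi>_scale cinner_simps)
qed

text \<open>The damping operator transported to \<open>H \<times> H\<close>.\<close>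
definition BB :: "'h \<times> 'h \<Rightarrow> 'h \<times> 'h" where "BB Z = \<Phi> (B (\<Psi> Z))"

lemma B_V: "Y \<in> V \<Longrightarrow> B Y \<in> V"
  using B by (auto simp: damping_operator_def linear_op_def)

lemma BB_\<Phi>: "Y \<in> V \<Longrightarrow> BB (\<Phi> Y) = \<Phi> (B Y)"
  by (simp add: BB_def \<Psi>\<Phi>)

lemma BB_add: "BB (Y + Z) = BB Y + BB Z"
  using B B_V by (simp add: BB_def \<Psi>_add damping_operator_def linear_op_def \<Phi>_add)

lemma BB_scale: "BB (c *\<^sub>C Z) = c *\<^sub>C BB Z"
  using B B_V by (simp add: BB_def \<Psi>_scale damping_operator_def linear_op_def \<Phi>_scale)

lemma BB_pos: "cinner (BB Z) Z \<in> \<real>\<^sub>\<ge>\<^sub>0"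
proof -
  have "ip (B (\<Psi> Z)) (\<Psi> Z) \<in> \<real>\<^sub>\<ge>\<^sub>0"
    using B by (auto simp: damping_operator_def positive_op_def)
  then show ?thesis by (simp add: ip_eq BB_def)
qed

lemma norm_BB: "norm (BB Z) \<le> b * norm Z"
proof -
  have "\<exists>K. \<forall>Y\<in>V. norm (\<Phi> (B Y)) \<le> K * norm (\<Phi> Y)"
    using B by (simp add: damping_operator_def bounded_op_def vnorm_eq)
  then obtain K where K: "\<And>Z. norm (BB Z) \<le> K * norm Z"
    unfolding BB_def by (metis \<Psi>_in \<Phi>\<Psi>)
  let ?T = "{norm (\<Phi> (B Y)) | Y. Y \<in> V \<and> norm (\<Phi> Y) \<le> 1}"
  have bdd: "bdd_above ?T"
  proof (rule bdd_aboveI)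
    fix t assume "t \<in> ?T"
    then obtain Y where Y: "t = norm (\<Phi> (B Y))" "Y \<in> V" "norm (\<Phi> Y) \<le> 1" by blast
    have "t \<le> K * norm (\<Phi> Y)" using K[of "\<Phi> Y"] Y by (simp add: BB_\<Phi>)
    also have "\<dots> \<le> \<bar>K\<bar> * 1" using Y(3) by (intro mult_mono) auto
    finally show "t \<le> \<bar>K\<bar>" by simp
  qed
  have unit: "norm (BB Z) \<le> b" if "norm Z \<le> 1" for Z
  proof -
    have "norm (\<Phi> (B (\<Psi> Z))) \<in> ?T" using that by (intro CollectI exI[of _ "\<Psi> Z"]) simp
    from cSup_upper[OF this bdd] show ?thesis by (simp add: b_def op_norm_def vnorm_eq BB_def)
  qed
  show ?thesis
  proof (cases "Z = 0")
    case True
    then show ?thesis using BB_scale[of 0 0] by simp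
  next
    case False
    have "norm (BB (complex_of_real (1 / norm Z) *\<^sub>C Z)) \<le> b"
      by (rule unit) (use False in \<open>simp add: norm_scaleC norm_divide\<close>)
    then show ?thesis using False
      by (simp add: BB_scale norm_scaleC norm_divide divide_le_eq)
  qed
qed

lemma b_nonneg: "b \<ge> 0"
proof -
  have "norm (e 1) = 1" by (rule norm_basis) (simp add: Zstar_def)
  then have "norm (BB (e 1)) \<le> b" using norm_BB[of "e 1"] by simp
  with norm_ge_zero show ?thesis by (rule order_trans)
qed

end

section \<open>The damped operator and its spectrum\<close>

context damped_system
begin

lemma undamped_linear:
  shows undamped_add: "Y \<in> Dom \<Longrightarrow> Z \<in> Dom \<Longrightarrow>
      undamped_op A (Y + Z) = undamped_op A Y + undamped_op A Z"
    and undamped_scale: "Y \<in> Dom \<Longrightarrow> undamped_op A (c *\<^sub>C Y) = c *\<^sub>C undamped_op A Y"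
proof -
  have "linear_op V Dom (undamped_op A)" using skew unfolding skew_adjoint_def by (elim conjE)
  then show "Y \<in> Dom \<Longrightarrow> Z \<in> Dom \<Longrightarrow> undamped_op A (Y + Z) = undamped_op A Y + undamped_op A Z"
    "Y \<in> Dom \<Longrightarrow> undamped_op A (c *\<^sub>C Y) = c *\<^sub>C undamped_op A Y"
    unfolding linear_op_def by blast+
qed

lemma B_linear:
  shows B_add: "Y \<in> V \<Longrightarrow> Z \<in> V \<Longrightarrow> B (Y + Z) = B Y + B Z"
    and B_scale: "Y \<in> V \<Longrightarrow> B (c *\<^sub>C Y) = c *\<^sub>C B Y"
proof -
  have "linear_op V V B" using B unfolding damping_operator_def by (elim conjE)
  then show "Y \<in> V \<Longrightarrow> Z \<in> V \<Longrightarrow> B (Y + Z) = B Y + B Z" "Y \<in> V \<Longrightarrow> B (c *\<^sub>C Y) = c *\<^sub>C B Y"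
    unfolding linear_op_def by blast+
qed

abbreviation "T \<equiv> damped_op A B"

lemma T_V: "Y \<in> Dom \<Longrightarrow> T Y \<in> V"
  unfolding damped_op_def
  by (intro complex_vector.subspace_diff[OF V_subspace] undamped_V B_V Dom_V)

lemma T_add: "Y \<in> Dom \<Longrightarrow> Z \<in> Dom \<Longrightarrow> T (Y + Z) = T Y + T Z"
  by (simp add: damped_op_def undamped_add B_add Dom_V)

lemma T_scale: "Y \<in> Dom \<Longrightarrow> T (c *\<^sub>C Y) = c *\<^sub>C T Y"
  by (simp add: damped_op_def undamped_scale B_scale Dom_V complex_vector.scale_right_diff_distrib)

lemma T_diff:
  assumes "Y \<in> Dom" "Z \<in> Dom"
  shows "T (Y - Z) = T Y - T Z"
  using T_add[of "Y - Z" Z] assms complex_vector.subspace_diff[OF Dom_subspace assms]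
  by (simp add: algebra_simps)

lemma T_0: "T 0 = 0"
  using T_scale[of 0 0] Dom_subspace by (simp add: complex_vector.subspace_0)

lemma T_sum: "(\<And>i. i \<in> F \<Longrightarrow> f i \<in> Dom) \<Longrightarrow> T (sum f F) = (\<Sum>i\<in>F. T (f i))"
  by (induction F rule: infinite_finite_induct)
    (auto simp: T_add T_0 complex_vector.subspace_sum[OF Dom_subspace])

lemma T_coordinate:
  assumes "Y \<in> Dom" "k \<in> Zstar"
  shows "cinner (\<Phi> (T Y)) (e k) = lam \<mu> k * cinner (\<Phi> Y) (e k) - cinner (BB (\<Phi> Y)) (e k)"
  using assms undamped_coordinate[OF assms]
  by (simp add: damped_op_def \<Phi>_diff undamped_V B_V Dom_V BB_\<Phi> cinner_simps)

text \<open>The graph of a skew-adjoint operator is an adjoint graph, hence closed.\<close>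
lemma undamped_closed:
  assumes y: "\<And>n. y n \<in> Dom" and x: "(\<lambda>n. \<Phi> (y n)) \<longlonglongrightarrow> \<Phi> x" "x \<in> V"
    and w: "(\<lambda>n. \<Phi> (undamped_op A (y n))) \<longlonglongrightarrow> \<Phi> w" "w \<in> V"
  shows "x \<in> Dom" "undamped_op A x = w"
proof -
  have "ip (undamped_op A u) x = ip u (- w)" if u: "u \<in> Dom" for u
  proof -
    have "(\<lambda>n. cinner (\<Phi> (undamped_op A u)) (\<Phi> (y n))) \<longlonglongrightarrow> cinner (\<Phi> (undamped_op A u)) (\<Phi> x)"
      by (intro tendsto_cinner tendsto_const x)
    moreover have "cinner (\<Phi> (undamped_op A u)) (\<Phi> (y n)) = - cinner (\<Phi> u) (\<Phi> (undamped_op A (y n)))" for n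
      using skew_ip[OF u y[of n]] by (simp add: ip_eq)
    moreover have "(\<lambda>n. - cinner (\<Phi> u) (\<Phi> (undamped_op A (y n)))) \<longlonglongrightarrow> - cinner (\<Phi> u) (\<Phi> w)"
      by (intro tendsto_minus tendsto_cinner tendsto_const w)
    ultimately have "cinner (\<Phi> (undamped_op A u)) (\<Phi> x) = - cinner (\<Phi> u) (\<Phi> w)"
      using LIMSEQ_unique by simp
    moreover have "\<Phi> (- w) = - \<Phi> w"
      using \<Phi>_diff[of 0 w] w(2) V_subspace by (simp add: complex_vector.subspace_0)
    ultimately show ?thesis by (simp add: ip_eq)
  qed
  then have "(x, - w) \<in> adjoint_graph V ip Dom (undamped_op A)"
    using x(2) w(2) V_subspace by (simp add: adjoint_graph_def complex_vector.subspace_neg)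
  moreover have "adjoint_graph V ip Dom (undamped_op A) = {(Y, - undamped_op A Y) | Y. Y \<in> Dom}"
    using skew unfolding skew_adjoint_def by (elim conjE)
  ultimately have "\<exists>Y\<in>Dom. x = Y \<and> - w = - undamped_op A Y" by auto
  then show "x \<in> Dom" "undamped_op A x = w" by auto
qed

end

lemma span_image_finite_sum:
  assumes "x \<in> complex_vector.span (U ` J)"
  obtains F c where "finite F" "F \<subseteq> J" "x = (\<Sum>j\<in>F. c j *\<^sub>C U j)"
proof -
  have "\<exists>F c. finite F \<and> F \<subseteq> J \<and> x = (\<Sum>j\<in>F. c j *\<^sub>C U j)"
    using assms
  proof (induction rule: complex_vector.span_induct_alt)
    case base
    show ?case by (intro exI[of _ "{}"]) simp
  next
    case (step a x y)
    then obtain i F c where i: "i \<in> J" "x = U i" and F: "finite F" "F \<subseteq> J" "y = (\<Sum>j\<in>F. c j *\<^sub>C U j)"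
      by blast
    let ?c = "\<lambda>j. (if j = i then a else 0) + (if j \<in> F then c j else 0)"
    have "(\<Sum>j\<in>insert i F. ?c j *\<^sub>C U j) =
        (\<Sum>j\<in>insert i F. (if j = i then a else 0) *\<^sub>C U j) + (\<Sum>j\<in>insert i F. (if j \<in> F then c j else 0) *\<^sub>C U j)"
      by (simp only: scaleC_add_left sum.distrib)
    also have "(\<Sum>j\<in>insert i F. (if j = i then a else 0) *\<^sub>C U j) = (\<Sum>j\<in>{i}. a *\<^sub>C U j)"
      using F(1) by (intro sum.mono_neutral_cong_right) auto
    also have "(\<Sum>j\<in>insert i F. (if j \<in> F then c j else 0) *\<^sub>C U j) = (\<Sum>j\<in>F. c j *\<^sub>C U j)"
      using F(1) by (intro sum.mono_neutral_cong_right) auto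
    finally have "a *\<^sub>C x + y = (\<Sum>j\<in>insert i F. ?c j *\<^sub>C U j)" using i F by simp
    then show ?case using i F by (intro exI[of _ "insert i F"] exI[of _ ?c]) auto
  qed
  then show ?thesis using that by blast
qed

locale damped_riesz_system = damped_system A S DA DS \<mu> v B
  for A S :: "'h::chilbert_space \<Rightarrow> 'h" and DA DS :: "'h set"
    and \<mu> :: "nat \<Rightarrow> real" and v :: "nat \<Rightarrow> 'h"
    and B :: "'h \<times> 'h \<Rightarrow> 'h \<times> 'h" +
  fixes \<nu> :: "int \<Rightarrow> complex" and U :: "int \<Rightarrow> 'h \<times> 'h"
  assumes nu: "damped_eigensystem DA A DS S B \<nu> U"
    and riesz: "riesz_basis (energy_space DS) (energy_inner S) Zstar U"
begin

lemma U_props: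
  shows eigenvalues_T: "eigenvalues Dom T = \<nu> ` Zstar"
    and U_Dom: "k \<in> Zstar \<Longrightarrow> U k \<in> Dom"
    and T_U: "k \<in> Zstar \<Longrightarrow> T (U k) = \<nu> k *\<^sub>C U k"
    and norm_U: "k \<in> Zstar \<Longrightarrow> norm (\<Phi> (U k)) = 1"
proof -
  have "\<forall>k\<in>Zstar. U k \<in> Dom \<and> T (U k) = \<nu> k *\<^sub>C U k \<and> norm (\<Phi> (U k)) = 1"
    using nu unfolding damped_eigensystem_def vnorm_eq by (elim conjE)
  then show "k \<in> Zstar \<Longrightarrow> U k \<in> Dom" "k \<in> Zstar \<Longrightarrow> T (U k) = \<nu> k *\<^sub>C U k"
    "k \<in> Zstar \<Longrightarrow> norm (\<Phi> (U k)) = 1" by blast+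
  show "eigenvalues Dom T = \<nu> ` Zstar" using nu unfolding damped_eigensystem_def by (elim conjE)
qed

lemma Re_\<nu>_nonpos: "k \<in> Zstar \<Longrightarrow> Re (\<nu> k) \<le> 0"
proof -
  assume k: "k \<in> Zstar"
  note UD = U_Dom[OF k]
  have "\<Phi> (T (U k)) = \<nu> k *\<^sub>C \<Phi> (U k)" using T_U[OF k] \<Phi>_scale[OF Dom_V[OF UD]] by simp
  moreover have "\<Phi> (T (U k)) = \<Phi> (undamped_op A (U k)) - BB (\<Phi> (U k))"
    by (simp add: damped_op_def \<Phi>_diff undamped_V B_V Dom_V BB_\<Phi> UD)
  ultimately have "\<nu> k *\<^sub>C \<Phi> (U k) = \<Phi> (undamped_op A (U k)) - BB (\<Phi> (U k))" by simp
  then have "cinner (\<nu> k *\<^sub>C \<Phi> (U k)) (\<Phi> (U k)) =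
      cinner (\<Phi> (undamped_op A (U k))) (\<Phi> (U k)) - cinner (BB (\<Phi> (U k))) (\<Phi> (U k))"
    by (simp add: cinner_simps)
  then have "\<nu> k = cinner (\<Phi> (undamped_op A (U k))) (\<Phi> (U k)) - cinner (BB (\<Phi> (U k))) (\<Phi> (U k))"
    using norm_U[OF k] by (simp add: cinner_scaleC_left cinner_self)
  moreover have "Re (cinner (\<Phi> (undamped_op A (U k))) (\<Phi> (U k))) = 0"
  proof -
    have "cinner (\<Phi> (undamped_op A (U k))) (\<Phi> (U k)) = - cnj (cinner (\<Phi> (undamped_op A (U k))) (\<Phi> (U k)))"
      using skew_ip[OF UD UD] cinner_commute[of "\<Phi> (U k)"] by (simp add: ip_eq)
    then show ?thesis by (simp add: complex_eq_iff)
  qed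
  moreover have "Re (cinner (BB (\<Phi> (U k))) (\<Phi> (U k))) \<ge> 0"
    using BB_pos by (simp add: complex_nonneg_Reals_iff)
  ultimately show ?thesis by simp
qed

text \<open>
  For finitely supported coefficients the sum in the definition of a Riesz basis is an
  ordinary finite sum.
\<close>
lemma riesz_finite_sums:
  obtains m M where "m > 0" "M > 0"
    "\<And>F c. finite F \<Longrightarrow> F \<subseteq> Zstar \<Longrightarrow>
      m * (\<Sum>j\<in>F. (cmod (c j))\<^sup>2) \<le> (norm (\<Phi> (\<Sum>j\<in>F. c j *\<^sub>C U j)))\<^sup>2 \<and>
      (norm (\<Phi> (\<Sum>j\<in>F. c j *\<^sub>C U j)))\<^sup>2 \<le> M * (\<Sum>j\<in>F. (cmod (c j))\<^sup>2)"
proof -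
  obtain m M where mM: "m > 0" "M > 0" and R: "\<And>c :: int \<Rightarrow> complex. (\<lambda>j. (cmod (c j))\<^sup>2) summable_on Zstar \<Longrightarrow>
        (\<exists>x. has_ip_sum V ip Zstar (\<lambda>j. c j *\<^sub>C U j) x \<and>
             m * (\<Sum>\<^sub>\<infinity>j\<in>Zstar. (cmod (c j))\<^sup>2) \<le> (vnorm ip x)\<^sup>2 \<and>
             (vnorm ip x)\<^sup>2 \<le> M * (\<Sum>\<^sub>\<infinity>j\<in>Zstar. (cmod (c j))\<^sup>2))"
    using riesz unfolding riesz_basis_def by auto
  show ?thesis
  proof (rule that[OF mM])
    fix F :: "int set" and c :: "int \<Rightarrow> complex" assume F: "finite F" "F \<subseteq> Zstar"
    define d where "d j = (if j \<in> F then c j else 0)" for j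
    have "((\<lambda>j. (cmod (d j))\<^sup>2) has_sum (\<Sum>j\<in>F. (cmod (c j))\<^sup>2)) Zstar"
      by (rule has_sum_finite_neutralI) (use F in \<open>auto simp: d_def\<close>)
    then have d: "(\<lambda>j. (cmod (d j))\<^sup>2) summable_on Zstar"
        "(\<Sum>\<^sub>\<infinity>j\<in>Zstar. (cmod (d j))\<^sup>2) = (\<Sum>j\<in>F. (cmod (c j))\<^sup>2)"
      by (auto simp: has_sum_imp_summable infsumI)
    from R[OF d(1)] obtain x where x: "has_ip_sum V ip Zstar (\<lambda>j. d j *\<^sub>C U j) x"
      "m * (\<Sum>j\<in>F. (cmod (c j))\<^sup>2) \<le> (vnorm ip x)\<^sup>2" "(vnorm ip x)\<^sup>2 \<le> M * (\<Sum>j\<in>F. (cmod (c j))\<^sup>2)"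
      unfolding d(2) by blast
    let ?s = "\<Sum>j\<in>F. c j *\<^sub>C U j"
    have sV: "?s \<in> V"
      by (intro complex_vector.subspace_sum[OF V_subspace] complex_vector.subspace_scale[OF V_subspace]
          Dom_V U_Dom) (use F in auto)
    have "eventually (\<lambda>G. vnorm ip (x - (\<Sum>j\<in>G. d j *\<^sub>C U j)) = vnorm ip (x - ?s)) (finite_subsets_at_top Zstar)"
      unfolding eventually_finite_subsets_at_top
    proof (intro exI[of _ F] conjI allI impI F)
      fix G assume "finite G \<and> F \<subseteq> G \<and> G \<subseteq> Zstar"
      then have "(\<Sum>j\<in>G. d j *\<^sub>C U j) = ?s"
        by (intro sum.mono_neutral_cong_right) (auto simp: d_def)
      then show "vnorm ip (x - (\<Sum>j\<in>G. d j *\<^sub>C U j)) = vnorm ip (x - ?s)" by simp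
    qed
    moreover have "x \<in> V" "((\<lambda>G. vnorm ip (x - (\<Sum>j\<in>G. d j *\<^sub>C U j))) \<longlongrightarrow> 0) (finite_subsets_at_top Zstar)"
      using x(1) by (auto simp: has_ip_sum_def)
    ultimately have "vnorm ip (x - ?s) = 0"
      using tendsto_cong tendsto_const_iff[OF finite_subsets_at_top_neq_bot] by force
    then have "x = ?s" using \<Phi>_inj[OF \<open>x \<in> V\<close> sV] \<Phi>_diff[OF \<open>x \<in> V\<close> sV] by (simp add: vnorm_eq)
    then show "m * (\<Sum>j\<in>F. (cmod (c j))\<^sup>2) \<le> (norm (\<Phi> ?s))\<^sup>2 \<and> (norm (\<Phi> ?s))\<^sup>2 \<le> M * (\<Sum>j\<in>F. (cmod (c j))\<^sup>2)"
      using x by (simp add: vnorm_eq)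
  qed
qed

lemma shifted_inj:
  assumes z: "z \<notin> \<nu> ` Zstar" and xy: "x \<in> Dom" "y \<in> Dom" "z *\<^sub>C x - T x = z *\<^sub>C y - T y"
  shows "x = y"
proof (rule ccontr)
  assume "x \<noteq> y"
  let ?w = "x - y"
  have w: "?w \<in> Dom" by (rule complex_vector.subspace_diff[OF Dom_subspace xy(1,2)])
  have "T ?w = z *\<^sub>C ?w"
    using xy(3) unfolding T_diff[OF xy(1,2)] complex_vector.scale_right_diff_distrib
    by (simp add: algebra_simps)
  moreover have "?w \<noteq> 0" using \<open>x \<noteq> y\<close> by simp
  ultimately have "z \<in> eigenvalues Dom T"
    using w unfolding eigenvalues_def by (intro CollectI bexI[of _ ?w] conjI)
  then show False using z eigenvalues_T by blast
qed

text \<open>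
  On finite combinations of the \<open>U j\<close> the resolvent divides the coefficients by \<open>z - \<nu> j\<close>, and
  the Riesz inequalities bound its norm by \<open>sqrt (M / m) / d\<close>.  A general right-hand side is a limit
  of such combinations; their preimages form a Cauchy sequence, and its limit is a preimage because
  the operator is closed.
\<close>
theorem resolvent_bound:
  "\<exists>K>0. \<forall>z d. d > 0 \<longrightarrow> (\<forall>j\<in>Zstar. cmod (z - \<nu> j) \<ge> d) \<longrightarrow>
      bij_betw (\<lambda>x. z *\<^sub>C x - T x) Dom V \<and>
      (\<forall>x\<in>Dom. norm (\<Phi> x) \<le> K / d * norm (\<Phi> (z *\<^sub>C x - T x)))"
proof -
  obtain m M where mM: "m > 0" "M > 0" and R:
    "\<And>F c. finite F \<Longrightarrow> F \<subseteq> Zstar \<Longrightarrow>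
      m * (\<Sum>j\<in>F. (cmod (c j))\<^sup>2) \<le> (norm (\<Phi> (\<Sum>j\<in>F. c j *\<^sub>C U j)))\<^sup>2 \<and>
      (norm (\<Phi> (\<Sum>j\<in>F. c j *\<^sub>C U j)))\<^sup>2 \<le> M * (\<Sum>j\<in>F. (cmod (c j))\<^sup>2)"
    by (rule riesz_finite_sums) blast
  define K where "K = sqrt (M / m)"
  have K: "K > 0" using mM by (simp add: K_def)
  show ?thesis
  proof (intro exI[of _ K] conjI[OF K] allI impI)
    fix z and d :: real assume d: "d > 0" and "\<forall>j\<in>Zstar. cmod (z - \<nu> j) \<ge> d"
    then have far: "cmod (z - \<nu> j) \<ge> d" if "j \<in> Zstar" for j using that by blast
    let ?R = "\<lambda>x. z *\<^sub>C x - T x"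
    have z: "z \<notin> \<nu> ` Zstar" using far d by force
    have R_diff: "?R (x - y) = ?R x - ?R y" if "x \<in> Dom" "y \<in> Dom" for x y
      using that by (simp add: T_diff complex_vector.scale_right_diff_distrib)
    have R_V: "?R x \<in> V" if "x \<in> Dom" for x
      using that Dom_V T_V V_subspace
      by (simp add: complex_vector.subspace_diff complex_vector.subspace_scale)
    have on_span: "\<exists>x\<in>Dom. ?R x = y \<and> norm (\<Phi> x) \<le> K / d * norm (\<Phi> y)"
      if y: "y \<in> complex_vector.span (U ` Zstar)" for y
    proof -
      obtain F c where F: "finite F" "F \<subseteq> Zstar" "y = (\<Sum>j\<in>F. c j *\<^sub>C U j)"
        using span_image_finite_sum[OF y] .
      define c' where "c' j = c j / (z - \<nu> j)" for j
      let ?x = "\<Sum>j\<in>F. c' j *\<^sub>C U j"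
      have cU: "c' j *\<^sub>C U j \<in> Dom" if "j \<in> F" for j
        using that F(2) U_Dom complex_vector.subspace_scale[OF Dom_subspace] by blast
      have "?R ?x = (\<Sum>j\<in>F. z *\<^sub>C c' j *\<^sub>C U j - T (c' j *\<^sub>C U j))"
        using cU by (simp add: T_sum sum_subtractf complex_vector.scale_sum_right)
      also have "\<dots> = y" unfolding F(3)
      proof (rule sum.cong[OF refl])
        fix j assume "j \<in> F"
        then have j: "j \<in> Zstar" using F(2) by blast
        then have "z - \<nu> j \<noteq> 0" using far[OF j] d by auto
        then have *: "(z - \<nu> j) * c' j = c j" by (simp add: c'_def)
        have "z *\<^sub>C c' j *\<^sub>C U j - T (c' j *\<^sub>C U j) = ((z - \<nu> j) * c' j) *\<^sub>C U j"
          unfolding T_scale[OF U_Dom[OF j]] T_U[OF j] scaleC_scaleC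
            complex_vector.scale_left_diff_distrib[symmetric] by (simp add: algebra_simps)
        then show "z *\<^sub>C c' j *\<^sub>C U j - T (c' j *\<^sub>C U j) = c j *\<^sub>C U j" unfolding * .
      qed
      finally have 1: "?R ?x = y" .
      have 2: "?x \<in> Dom" using cU by (rule complex_vector.subspace_sum[OF Dom_subspace])
      have "(norm (\<Phi> ?x))\<^sup>2 \<le> M * (\<Sum>j\<in>F. (cmod (c' j))\<^sup>2)" using R[OF F(1,2)] by blast
      also have "\<dots> \<le> M * (\<Sum>j\<in>F. (cmod (c j))\<^sup>2 / d\<^sup>2)"
      proof (intro mult_left_mono sum_mono)
        fix j assume "j \<in> F"
        then have dj: "d \<le> cmod (z - \<nu> j)" using far[of j] F(2) by blast
        then have "cmod (c' j) \<le> cmod (c j) / d"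
          unfolding c'_def norm_divide using d by (intro divide_left_mono mult_pos_pos) auto
        then have "(cmod (c' j))\<^sup>2 \<le> (cmod (c j) / d)\<^sup>2" by (intro power_mono) auto
        then show "(cmod (c' j))\<^sup>2 \<le> (cmod (c j))\<^sup>2 / d\<^sup>2" by (simp add: power_divide)
      qed (use mM in simp)
      also have "\<dots> = M / d\<^sup>2 * (\<Sum>j\<in>F. (cmod (c j))\<^sup>2)" by (simp add: sum_divide_distrib[symmetric])
      also have "\<dots> \<le> M / d\<^sup>2 * ((norm (\<Phi> y))\<^sup>2 / m)"
      proof (rule mult_left_mono)
        show "(\<Sum>j\<in>F. (cmod (c j))\<^sup>2) \<le> (norm (\<Phi> y))\<^sup>2 / m"
          using R[OF F(1,2), of c] mM by (simp add: F(3) pos_le_divide_eq mult.commute)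
      qed (use mM in simp)
      also have "\<dots> = (K / d * norm (\<Phi> y))\<^sup>2"
        using mM by (simp add: K_def power_mult_distrib power_divide field_simps)
      finally have "norm (\<Phi> ?x) \<le> K / d * norm (\<Phi> y)"
        by (rule power2_le_imp_le) (use K d in simp)
      with 1 2 show ?thesis by blast
    qed
    have solve: "\<exists>x\<in>Dom. ?R x = y \<and> norm (\<Phi> x) \<le> K / d * norm (\<Phi> y)" if y: "y \<in> V" for y
    proof -
      have "dense_in V ip (complex_vector.span (U ` Zstar))" using riesz unfolding riesz_basis_def by (elim conjE)
      then have sub: "complex_vector.span (U ` Zstar) \<subseteq> V"
        and dense: "\<forall>\<epsilon>>0. \<exists>w\<in>complex_vector.span (U ` Zstar). norm (\<Phi> (y - w)) < \<epsilon>"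
        using y unfolding dense_in_def vnorm_eq by blast+
      have "\<exists>w. w \<in> complex_vector.span (U ` Zstar) \<and> w \<in> V \<and> norm (\<Phi> (y - w)) < 1 / Suc n" for n
        using dense[rule_format, of "1 / Suc n"] sub by auto
      then obtain w where w: "\<And>n. w n \<in> complex_vector.span (U ` Zstar)" "\<And>n. w n \<in> V"
        "\<And>n. norm (\<Phi> (y - w n)) < 1 / Suc n" by metis
      from w(1) on_span have "\<forall>n. \<exists>x\<in>Dom. ?R x = w n \<and> norm (\<Phi> x) \<le> K / d * norm (\<Phi> (w n))" by blast
      then obtain x where x: "\<And>n. x n \<in> Dom" "\<And>n. ?R (x n) = w n"
        "\<And>n. norm (\<Phi> (x n)) \<le> K / d * norm (\<Phi> (w n))" by metis
      have wlim: "(\<lambda>n. \<Phi> (w n)) \<longlonglongrightarrow> \<Phi> y"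
      proof (rule LIM_zero_cancel, rule Lim_null_comparison)
        show "\<forall>\<^sub>F n in sequentially. norm (\<Phi> (w n) - \<Phi> y) \<le> 1 / Suc n"
          using w(3) by (auto simp: \<Phi>_diff[OF y w(2)] norm_minus_commute intro!: always_eventually less_imp_le)
        show "(\<lambda>n. 1 / real (Suc n)) \<longlonglongrightarrow> 0"
          using LIMSEQ_inverse_real_of_nat by (simp add: inverse_eq_divide)
      qed
      have xdiff: "norm (\<Phi> (x p) - \<Phi> (x q)) \<le> K / d * norm (\<Phi> (w p) - \<Phi> (w q))" for p q
      proof -
        obtain u where u: "u \<in> Dom" "?R u = w p - w q" "norm (\<Phi> u) \<le> K / d * norm (\<Phi> (w p - w q))"
          using on_span[OF complex_vector.span_diff[OF w(1)[of p] w(1)[of q]]] by blast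
        have D: "x p - x q \<in> Dom" using x(1) Dom_subspace by (simp add: complex_vector.subspace_diff)
        have "?R (x p - x q) = w p - w q" using R_diff[OF x(1) x(1), of p q] x(2) by simp
        then have "u = x p - x q" using shifted_inj[OF z u(1) D] u(2) by simp
        then show ?thesis using u(3) by (simp add: \<Phi>_diff Dom_V x(1) w(2))
      qed
      have "Cauchy (\<lambda>n. \<Phi> (x n))"
      proof (rule metric_CauchyI)
        fix \<epsilon> :: real assume "\<epsilon> > 0"
        then have "\<epsilon> * d / K > 0" using K d by simp
        then obtain N where N: "\<And>p q. p \<ge> N \<Longrightarrow> q \<ge> N \<Longrightarrow> dist (\<Phi> (w p)) (\<Phi> (w q)) < \<epsilon> * d / K"
          using LIMSEQ_imp_Cauchy[OF wlim] unfolding Cauchy_def by meson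
        have "dist (\<Phi> (x p)) (\<Phi> (x q)) < \<epsilon>" if "p \<ge> N" "q \<ge> N" for p q
        proof -
          have "dist (\<Phi> (x p)) (\<Phi> (x q)) \<le> K / d * dist (\<Phi> (w p)) (\<Phi> (w q))"
            using xdiff by (simp add: dist_norm)
          also have "\<dots> < K / d * (\<epsilon> * d / K)" using N[OF that] K d by (intro mult_strict_left_mono) auto
          also have "\<dots> = \<epsilon>" using K d by simp
          finally show ?thesis .
        qed
        then show "\<exists>N. \<forall>p\<ge>N. \<forall>q\<ge>N. dist (\<Phi> (x p)) (\<Phi> (x q)) < \<epsilon>" by blast
      qed
      then obtain Z where Z: "(\<lambda>n. \<Phi> (x n)) \<longlonglongrightarrow> Z" using Cauchy_convergent convergent_def by blast
      have BBlim: "(\<lambda>n. BB (\<Phi> (x n))) \<longlonglongrightarrow> BB Z"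
      proof (rule LIM_zero_cancel, rule Lim_null_comparison)
        have "BB (p - q) = BB p - BB q" for p q using BB_add[of "p - q" q] by (simp add: algebra_simps)
        then show "\<forall>\<^sub>F n in sequentially. norm (BB (\<Phi> (x n)) - BB Z) \<le> b * norm (\<Phi> (x n) - Z)"
          using norm_BB by (metis (mono_tags, lifting) always_eventually)
        show "(\<lambda>n. b * norm (\<Phi> (x n) - Z)) \<longlonglongrightarrow> 0"
          using Z by (intro tendsto_mult_right_zero tendsto_norm_zero) (rule LIM_zero)
      qed
      have ux: "undamped_op A (x n) = z *\<^sub>C x n - w n + B (x n)" for n
        using x(2)[of n] by (simp add: damped_op_def algebra_simps)
      have "\<Phi> (undamped_op A (x n)) = z *\<^sub>C \<Phi> (x n) - \<Phi> (w n) + BB (\<Phi> (x n))" for n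
        unfolding ux using x(1)[of n] w(2)[of n] V_subspace
        by (simp add: \<Phi>_add \<Phi>_diff \<Phi>_scale Dom_V B_V BB_\<Phi> complex_vector.subspace_diff
            complex_vector.subspace_scale)
      moreover have "(\<lambda>n. z *\<^sub>C \<Phi> (x n) - \<Phi> (w n) + BB (\<Phi> (x n))) \<longlonglongrightarrow> z *\<^sub>C Z - \<Phi> y + BB Z"
        by (intro tendsto_intros tendsto_scaleC Z wlim BBlim)
      ultimately have ulim: "(\<lambda>n. \<Phi> (undamped_op A (x n))) \<longlonglongrightarrow> \<Phi> (\<Psi> (z *\<^sub>C Z - \<Phi> y + BB Z))"
        by simp
      have Zlim: "(\<lambda>n. \<Phi> (x n)) \<longlonglongrightarrow> \<Phi> (\<Psi> Z)" using Z by simp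
      note cl = undamped_closed[OF x(1) Zlim \<Psi>_in ulim \<Psi>_in]
      have "\<Phi> (?R (\<Psi> Z)) = \<Phi> y"
        unfolding damped_op_def cl(2) using V_subspace cl(1)
        by (simp add: \<Phi>_diff \<Phi>_scale B_V BB_\<Phi>[symmetric] complex_vector.subspace_diff
            complex_vector.subspace_scale)
      then have "?R (\<Psi> Z) = y" using \<Phi>_inj[OF R_V[OF cl(1)] y] by blast
      moreover have "norm (\<Phi> (\<Psi> Z)) \<le> K / d * norm (\<Phi> y)"
        by (rule LIMSEQ_le[OF tendsto_norm[OF Zlim] tendsto_mult_left[OF tendsto_norm[OF wlim]]])
          (use x(3) in auto)
      ultimately show ?thesis using cl(1) by blast
    qed
    have "bij_betw ?R Dom V"
    proof (rule bij_betw_imageI)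
      show "inj_on ?R Dom" by (rule inj_onI) (use shifted_inj[OF z] in blast)
      show "?R ` Dom = V" using solve R_V by blast
    qed
    moreover have "norm (\<Phi> x) \<le> K / d * norm (\<Phi> (?R x))" if "x \<in> Dom" for x
      using solve[OF R_V[OF that]] shifted_inj[OF z _ that] by metis
    ultimately show "bij_betw ?R Dom V \<and> (\<forall>x\<in>Dom. norm (\<Phi> x) \<le> K / d * norm (\<Phi> (?R x)))" by blast
  qed
qed

abbreviation "abscissa \<equiv> spectral_abscissa V ip Dom T"

text \<open>
  If \<open>Re z\<close> exceeds the supremum \<open>s\<close>, then \<open>z\<close> keeps the distance \<open>Re z - s\<close> from all \<open>\<nu> j\<close>
  and lies in the resolvent set.
\<close>
lemma spectral_abscissa_eq: "abscissa = Sup (Re ` \<nu> ` Zstar)"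
proof -
  define s where "s = Sup (Re ` \<nu> ` Zstar)"
  have bdd: "bdd_above (Re ` \<nu> ` Zstar)" using Re_\<nu>_nonpos by (auto intro!: bdd_aboveI[of _ 0])
  have in_spec: "\<nu> j \<in> spectrum V ip Dom T" if j: "j \<in> Zstar" for j
  proof -
    have "0 \<in> Dom" using Dom_subspace by (simp add: complex_vector.subspace_0)
    moreover have "U j \<noteq> 0" using norm_U[OF j] by auto
    ultimately have "\<not> inj_on (\<lambda>x. \<nu> j *\<^sub>C x - T x) Dom"
      using U_Dom[OF j] T_U[OF j] T_0 unfolding inj_on_def by force
    then show ?thesis by (auto simp: spectrum_def resolvent_set_def bij_betw_def)
  qed
  have le_s: "Re z \<le> s" if z: "z \<in> spectrum V ip Dom T" for z
  proof (rule ccontr)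
    assume "\<not> Re z \<le> s"
    then have d: "Re z - s > 0" by simp
    have far: "cmod (z - \<nu> j) \<ge> Re z - s" if "j \<in> Zstar" for j
    proof -
      have "Re (\<nu> j) \<le> s" unfolding s_def by (rule cSup_upper[OF _ bdd]) (use that in blast)
      then show ?thesis using complex_Re_le_cmod[of "z - \<nu> j"] by simp
    qed
    obtain K where "\<forall>z d. d > 0 \<longrightarrow> (\<forall>j\<in>Zstar. cmod (z - \<nu> j) \<ge> d) \<longrightarrow>
        bij_betw (\<lambda>x. z *\<^sub>C x - T x) Dom V \<and>
        (\<forall>x\<in>Dom. norm (\<Phi> x) \<le> K / d * norm (\<Phi> (z *\<^sub>C x - T x)))"
      using resolvent_bound by blast
    with d far have K: "bij_betw (\<lambda>x. z *\<^sub>C x - T x) Dom V"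
        "\<And>x. x \<in> Dom \<Longrightarrow> norm (\<Phi> x) \<le> K / (Re z - s) * norm (\<Phi> (z *\<^sub>C x - T x))"
      by blast+
    have "bounded_op ip V (inv_into Dom (\<lambda>x. z *\<^sub>C x - T x))"
      unfolding bounded_op_def vnorm_eq
    proof (intro exI ballI)
      fix y assume "y \<in> V"
      then have y: "y \<in> (\<lambda>x. z *\<^sub>C x - T x) ` Dom" using K(1) by (simp add: bij_betw_def)
      let ?x = "inv_into Dom (\<lambda>x. z *\<^sub>C x - T x) y"
      have "?x \<in> Dom" "z *\<^sub>C ?x - T ?x = y"
        using inv_into_into[OF y] f_inv_into_f[OF y] by auto
      then show "norm (\<Phi> ?x) \<le> K / (Re z - s) * norm (\<Phi> y)" using K(2) by metis
    qed
    then show False using z K(1) by (simp add: spectrum_def resolvent_set_def)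
  qed
  have ne: "(1::int) \<in> Zstar" by (simp add: Zstar_def)
  have "Sup (Re ` spectrum V ip Dom T) \<le> s"
    by (rule cSup_least) (use le_s in_spec[OF ne] in auto)
  moreover have "s \<le> Sup (Re ` spectrum V ip Dom T)"
    unfolding s_def
  proof (rule cSup_subset_mono)
    show "Re ` \<nu> ` Zstar \<noteq> {}" using ne by blast
    show "bdd_above (Re ` spectrum V ip Dom T)" using le_s by (auto intro!: bdd_aboveI[of _ s])
    show "Re ` \<nu> ` Zstar \<subseteq> Re ` spectrum V ip Dom T" using in_spec by blast
  qed
  ultimately show ?thesis by (simp add: spectral_abscissa_def s_def)
qed

lemma Re_\<nu>_le_abscissa: "j \<in> Zstar \<Longrightarrow> Re (\<nu> j) \<le> abscissa"
  unfolding spectral_abscissa_eq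
  by (rule cSup_upper) (use Re_\<nu>_nonpos in \<open>auto intro!: bdd_aboveI[of _ 0]\<close>)

lemma abscissa_approx:
  assumes "\<epsilon> > 0"
  obtains j where "j \<in> Zstar" "Re (\<nu> j) > abscissa - \<epsilon>"
proof -
  have "(1::int) \<in> Zstar" by (simp add: Zstar_def)
  then have "Re ` \<nu> ` Zstar \<noteq> {}" by blast
  moreover have "abscissa - \<epsilon> < Sup (Re ` \<nu> ` Zstar)" using assms spectral_abscissa_eq by simp
  ultimately have "\<exists>t \<in> Re ` \<nu> ` Zstar. abscissa - \<epsilon> < t" by (rule less_cSupD[unfolded Bex_def[symmetric]])
  then show ?thesis using that by blast
qed

end

section \<open>The Galerkin operators in coordinates\<close>

definition modes :: "nat \<Rightarrow> int set" where
  "modes N = {k \<in> Zstar. \<bar>k\<bar> \<le> int N}"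

lemma modes_subset: "modes N \<subseteq> Zstar"
  by (auto simp: modes_def)

lemma finite_modes: "finite (modes N)"
  by (rule finite_subset[of _ "{- int N..int N}"]) (auto simp: modes_def)

context damped_system
begin

abbreviation "M N \<equiv> galerkin_space \<mu> v N"
abbreviation "G N \<equiv> galerkin_op A S B \<mu> v N"

lemma Vec_V: "k \<in> Zstar \<Longrightarrow> Vec \<mu> v k \<in> V"
  by (rule Dom_V[OF Vec_Dom])

lemma M_subspace: "complex_vector.subspace (M N)"
  by (simp add: galerkin_space_def)

lemma M_Dom: "x \<in> M N \<Longrightarrow> x \<in> Dom"
proof -
  have "M N \<subseteq> Dom"
    unfolding galerkin_space_def
    by (rule complex_vector.span_minimal[OF _ Dom_subspace]) (use Vec_Dom in auto)
  then show "x \<in> M N \<Longrightarrow> x \<in> Dom" by blast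
qed

lemma M_V: "x \<in> M N \<Longrightarrow> x \<in> V"
  using M_Dom Dom_V by blast

lemma M_coordinate:
  assumes x: "x \<in> M N" and j: "j \<in> Zstar - modes N"
  shows "cinner (\<Phi> x) (e j) = 0"
proof -
  have "M N \<subseteq> {x \<in> V. cinner (\<Phi> x) (e j) = 0}"
    unfolding galerkin_space_def
  proof (rule complex_vector.span_minimal)
    show "Vec \<mu> v ` {k \<in> Zstar. \<bar>k\<bar> \<le> int N} \<subseteq> {x \<in> V. cinner (\<Phi> x) (e j) = 0}"
      using j by (auto simp: Vec_V e_def[symmetric] orthonormal modes_def)
    show "complex_vector.subspace {x \<in> V. cinner (\<Phi> x) (e j) = 0}"
      using V_subspace unfolding complex_vector.subspace_def
      by (simp add: \<Phi>_add \<Phi>_scale cinner_simps)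
  qed
  then show ?thesis using x by blast
qed

text \<open>The explicit form of the orthogonal projection onto the Galerkin space.\<close>
definition P :: "nat \<Rightarrow> 'h \<times> 'h \<Rightarrow> 'h \<times> 'h" where
  "P N y = (\<Sum>j\<in>modes N. cinner (\<Phi> y) (e j) *\<^sub>C Vec \<mu> v j)"

lemma P_in: "P N y \<in> M N"
  unfolding P_def
  by (intro complex_vector.subspace_sum[OF M_subspace] complex_vector.subspace_scale[OF M_subspace])
    (auto simp: galerkin_space_def modes_def intro: complex_vector.span_base)

lemma \<Phi>_P: "\<Phi> (P N y) = expansion (\<Phi> y) (modes N)"
proof -
  have "\<Phi> (P N y) = (\<Sum>j\<in>modes N. \<Phi> (cinner (\<Phi> y) (e j) *\<^sub>C Vec \<mu> v j))"
    unfolding P_def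
    by (rule \<Phi>_sum, rule complex_vector.subspace_scale[OF V_subspace Vec_V])
      (use modes_subset in blast)
  also have "\<dots> = expansion (\<Phi> y) (modes N)"
    unfolding expansion_def
    by (rule sum.cong[OF refl], subst \<Phi>_scale[OF Vec_V]) (use modes_subset in \<open>auto simp: e_def\<close>)
  finally show ?thesis .
qed

lemma P_coordinate:
  "j \<in> Zstar \<Longrightarrow> cinner (\<Phi> (P N y)) (e j) = (if j \<in> modes N then cinner (\<Phi> y) (e j) else 0)"
  unfolding \<Phi>_P expansion_def by (rule cinner_basis_sum[OF finite_modes modes_subset])

lemma orth_proj_eq_P:
  assumes y: "y \<in> V"
  shows "orth_proj ip (M N) y = P N y"
  unfolding orth_proj_def
proof (rule the_equality)
  have orth: "ip (y - P N y) w = 0" if w: "w \<in> M N" for w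
  proof -
    have "\<Phi> w = expansion (\<Phi> w) (modes N)"
      using M_coordinate[OF w] P_coordinate[of _ N w] \<Phi>_P[of N w]
      by (intro coordinate_eqI) (metis DiffI)
    then have "cinner (\<Phi> y - \<Phi> (P N y)) (\<Phi> w) = cinner (\<Phi> y - \<Phi> (P N y)) (expansion (\<Phi> w) (modes N))"
      by simp
    also have "\<dots> = 0"
      unfolding expansion_def cinner_sum_right
      by (rule sum.neutral) (simp add: cinner_simps P_coordinate subsetD[OF modes_subset])
    finally show ?thesis using \<Phi>_diff[OF y M_V[OF P_in]] by (simp add: ip_eq)
  qed
  then show "P N y \<in> M N \<and> (\<forall>w\<in>M N. ip (y - P N y) w = 0)" using P_in by blast
  fix x assume x: "x \<in> M N \<and> (\<forall>w\<in>M N. ip (y - x) w = 0)"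
  let ?d = "P N y - x"
  have d: "?d \<in> M N" using x P_in M_subspace by (simp add: complex_vector.subspace_diff)
  have V: "x \<in> V" "P N y \<in> V" using x P_in M_V by blast+
  have "cinner (\<Phi> ?d) (\<Phi> ?d) = ip (y - x) ?d - ip (y - P N y) ?d"
    using V y by (simp add: ip_eq \<Phi>_diff flip: cinner_diff_left)
  also have "\<dots> = 0" using x orth[OF d] d by simp
  finally have "\<Phi> ?d = \<Phi> 0" by (simp add: cinner_self)
  then have "?d = 0" by (rule \<Phi>_inj[OF M_V[OF d] complex_vector.subspace_0[OF V_subspace]])
  then show "x = P N y" by simp
qed

lemma G_eq_P: "x \<in> M N \<Longrightarrow> G N x = P N (T x)"
  unfolding galerkin_op_def by (rule orth_proj_eq_P[OF T_V[OF M_Dom]])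

lemma G_in: "x \<in> M N \<Longrightarrow> G N x \<in> M N"
  by (simp add: G_eq_P P_in)

lemma G_coordinate:
  assumes "x \<in> M N" "j \<in> modes N"
  shows "cinner (\<Phi> (G N x)) (e j) = lam \<mu> j * cinner (\<Phi> x) (e j) - cinner (BB (\<Phi> x)) (e j)"
  using assms modes_subset[of N]
  by (simp add: G_eq_P P_coordinate T_coordinate M_Dom subsetD)

lemma P_add: "x \<in> V \<Longrightarrow> y \<in> V \<Longrightarrow> P N (x + y) = P N x + P N y"
  by (simp add: P_def \<Phi>_add cinner_simps scaleC_add_left sum.distrib)

lemma P_scale: "x \<in> V \<Longrightarrow> P N (c *\<^sub>C x) = c *\<^sub>C P N x"
  by (simp add: P_def \<Phi>_scale cinner_simps complex_vector.scale_sum_right scaleC_scaleC)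

lemma G_add: "x \<in> M N \<Longrightarrow> y \<in> M N \<Longrightarrow> G N (x + y) = G N x + G N y"
  using M_subspace by (simp add: G_eq_P P_add T_add T_V M_Dom complex_vector.subspace_add)

lemma G_scale: "x \<in> M N \<Longrightarrow> G N (c *\<^sub>C x) = c *\<^sub>C G N x"
  using M_subspace by (simp add: G_eq_P P_scale T_scale T_V M_Dom complex_vector.subspace_scale)

lemma lam_eq: "lam \<mu> k = \<i> * complex_of_real (of_int (sgn k) * sqrt (\<mu> (nat \<bar>k\<bar>)))"
  by (simp add: lam_def)

text \<open>Without damping, any nonzero coordinate of an eigenvector identifies its eigenvalue as a \<open>\<lambda>\<^sub>j\<close>.\<close>
lemma undamped_eigenvalue_imaginary:
  assumes b: "b = 0" and x: "x \<noteq> 0" "x \<in> V"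
    and eig: "\<And>j. j \<in> Zstar \<Longrightarrow> cinner (\<Phi> x) (e j) \<noteq> 0 \<Longrightarrow>
      z * cinner (\<Phi> x) (e j) = lam \<mu> j * cinner (\<Phi> x) (e j) - cinner (BB (\<Phi> x)) (e j)"
  shows "Re z = 0"
proof -
  have "\<Phi> x \<noteq> 0" using x \<Phi>_inj[of x 0] V_subspace by (auto simp: complex_vector.subspace_0)
  then obtain j where j: "j \<in> Zstar" "cinner (\<Phi> x) (e j) \<noteq> 0" using complete by blast
  have "BB (\<Phi> x) = 0" using norm_BB[of "\<Phi> x"] b by simp
  then have "z = lam \<mu> j" using eig[OF j] j(2) by simp
  then show ?thesis by (simp add: lam_eq)
qed

end

lemma discrete_abscissa_close:
  assumes r: "r < N"
    and upper: "\<And>k. k \<in> Zstar \<Longrightarrow> \<bar>k\<bar> \<le> int N - int r \<Longrightarrow> Re (\<eta> k) \<le> s + \<epsilon>"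
    and k: "k \<in> Zstar" "\<bar>k\<bar> \<le> int N - int r" "Re (\<eta> k) \<ge> s - \<epsilon>"
  shows "\<bar>s - discrete_abscissa \<eta> N r\<bar> \<le> \<epsilon>"
proof -
  let ?X = "(\<lambda>j. Re (\<eta> j)) ` {j \<in> Zstar. \<bar>j\<bar> \<le> int N - int r}"
  have fin: "finite ?X"
    by (rule finite_imageI, rule finite_subset[of _ "{- int N..int N}"]) auto
  have "Re (\<eta> k) \<le> Max ?X" using fin k by (intro Max_ge) auto
  moreover have "Max ?X \<le> s + \<epsilon>" using fin k upper by (subst Max_le_iff) auto
  ultimately show ?thesis using k(3) unfolding discrete_abscissa_def by linarith
qed

section \<open>Convergence of the spectral abscissas\<close>

locale galerkin_system = damped_riesz_system A S DA DS \<mu> v B \<nu> U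
  for A S :: "'h::chilbert_space \<Rightarrow> 'h" and DA DS :: "'h set"
    and \<mu> :: "nat \<Rightarrow> real" and v :: "nat \<Rightarrow> 'h"
    and B :: "'h \<times> 'h \<Rightarrow> 'h \<times> 'h"
    and \<nu> :: "int \<Rightarrow> complex" and U :: "int \<Rightarrow> 'h \<times> 'h" +
  fixes \<eta> :: "nat \<Rightarrow> int \<Rightarrow> complex"
  assumes eta: "\<And>N. N \<ge> 1 \<Longrightarrow> galerkin_eigenvalues A S B \<mu> v N (\<eta> N)"
begin

lemma \<eta>_count:
  assumes "N \<ge> 1"
  shows "card {k \<in> modes N. \<eta> N k = z} = alg_multiplicity (M N) (G N) z"
proof -
  have "\<forall>z. card {k\<in>Zstar. \<bar>k\<bar> \<le> int N \<and> \<eta> N k = z} = alg_multiplicity (M N) (G N) z"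
    using eta[OF assms] unfolding galerkin_eigenvalues_def by (elim conjE)
  moreover have "{k \<in> modes N. \<eta> N k = z} = {k\<in>Zstar. \<bar>k\<bar> \<le> int N \<and> \<eta> N k = z}"
    by (auto simp: modes_def)
  ultimately show ?thesis by simp
qed

lemma \<eta>_mono:
  assumes N: "N \<ge> 1" and k: "k \<in> modes N" and l: "l \<in> modes N" and kl: "k \<le> l"
  shows "Im (\<eta> N k) \<le> Im (\<eta> N l)"
proof -
  have succ: "\<And>k. k \<in> Zstar \<Longrightarrow> \<bar>k\<bar> \<le> int N \<Longrightarrow> \<bar>zsucc k\<bar> \<le> int N \<Longrightarrow>
      Im (\<eta> N k) \<le> Im (\<eta> N (zsucc k))"
    using eta[OF N] unfolding galerkin_eigenvalues_def by blast
  (* the value at 0 is replaced by the value at -1, so that the induction can step over 0 *)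
  define \<pi> where "\<pi> l = (if l = 0 then - 1 else l)" for l :: int
  have "\<pi> l \<in> modes N \<longrightarrow> Im (\<eta> N k) \<le> Im (\<eta> N (\<pi> l))" using kl
  proof (induction l rule: int_ge_induct)
    case base
    have "\<pi> k = k" using k by (simp add: \<pi>_def modes_def Zstar_def)
    then show ?case by simp
  next
    case (step l)
    show ?case
    proof (cases "l = - 1")
      case True
      then show ?thesis using step.IH by (simp add: \<pi>_def)
    next
      case False
      show ?thesis
      proof
        assume sl: "\<pi> (l + 1) \<in> modes N"
        have eq: "\<pi> (l + 1) = zsucc (\<pi> l)" using False by (simp add: \<pi>_def zsucc_def)
        have "\<pi> l \<in> modes N"
          using sl k step.hyps False N by (auto simp: \<pi>_def modes_def Zstar_def split: if_splits)
        then show "Im (\<eta> N k) \<le> Im (\<eta> N (\<pi> (l + 1)))"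
          using step.IH succ[of "\<pi> l"] sl unfolding eq by (auto simp: modes_def)
      qed
    qed
  qed
  moreover have "\<pi> l = l" using l by (simp add: \<pi>_def modes_def Zstar_def)
  ultimately show ?thesis using l by simp
qed

lemma \<eta>_eigenvector:
  assumes "N \<ge> 1" "k \<in> modes N"
  shows "\<exists>x\<in>M N. x \<noteq> 0 \<and> G N x = \<eta> N k *\<^sub>C x"
proof (rule eigenvector_of_alg_multiplicity)
  have "card {l \<in> modes N. \<eta> N l = \<eta> N k} \<noteq> 0"
    using assms(2) finite_modes by auto
  then show "alg_multiplicity (M N) (G N) (\<eta> N k) > 0" using \<eta>_count[OF assms(1)] by simp
  show "x \<in> M N \<Longrightarrow> G N x - \<eta> N k *\<^sub>C x \<in> M N" for x
    using M_subspace G_in by (simp add: complex_vector.subspace_diff complex_vector.subspace_scale)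
qed

lemma eigenvector_coordinate:
  assumes x: "x \<in> M N" "G N x = z *\<^sub>C x" and j: "j \<in> modes N"
  shows "z * cinner (\<Phi> x) (e j) = lam \<mu> j * cinner (\<Phi> x) (e j) - cinner (BB (\<Phi> x)) (e j)"
  using G_coordinate[OF x(1) j] x M_V[OF x(1)] by (simp add: \<Phi>_scale cinner_simps)

lemma U_coordinate:
  assumes "k \<in> Zstar" "j \<in> Zstar"
  shows "\<nu> k * cinner (\<Phi> (U k)) (e j) = lam \<mu> j * cinner (\<Phi> (U k)) (e j) - cinner (BB (\<Phi> (U k))) (e j)"
  using T_coordinate[OF U_Dom[OF assms(1)] assms(2)] T_U[OF assms(1)] Dom_V[OF U_Dom[OF assms(1)]]
  by (simp add: \<Phi>_scale cinner_simps)

lemma zero_damping: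
  assumes b: "b = 0" and rN: "0 < r" "r < N"
  shows "\<bar>abscissa - discrete_abscissa (\<eta> N) N r\<bar> \<le> 0"
proof -
  have "Re (\<nu> k) = 0" if k: "k \<in> Zstar" for k
  proof (rule undamped_eigenvalue_imaginary[OF b _ Dom_V[OF U_Dom[OF k]]])
    show "U k \<noteq> 0" using norm_U[OF k] by auto
  qed (rule U_coordinate[OF k])
  moreover have "(1::int) \<in> Zstar" by (simp add: Zstar_def)
  ultimately have "Re ` \<nu> ` Zstar = {0}" by force
  then have s: "abscissa = 0" by (simp add: spectral_abscissa_eq)
  have N: "N \<ge> 1" using rN by simp
  have \<eta>: "Re (\<eta> N k) = 0" if k: "k \<in> modes N" for k
  proof -
    obtain x where x: "x \<in> M N" "x \<noteq> 0" "G N x = \<eta> N k *\<^sub>C x" using \<eta>_eigenvector[OF N k] by blast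
    show ?thesis
      by (rule undamped_eigenvalue_imaginary[OF b x(2) M_V[OF x(1)]], rule eigenvector_coordinate[OF x(1,3)])
        (use M_coordinate[OF x(1)] in blast)
  qed
  have "1 \<in> modes N" using N by (simp add: modes_def Zstar_def)
  show ?thesis unfolding s
    by (rule discrete_abscissa_close[OF rN(2), where k = 1])
      (use \<eta> rN in \<open>auto simp: modes_def Zstar_def\<close>)
qed

end

locale separated_galerkin_system = galerkin_system A S DA DS \<mu> v B \<nu> U \<eta>
  for A S :: "'h::chilbert_space \<Rightarrow> 'h" and DA DS :: "'h set"
    and \<mu> :: "nat \<Rightarrow> real" and v :: "nat \<Rightarrow> 'h"
    and B :: "'h \<times> 'h \<Rightarrow> 'h \<times> 'h"
    and \<nu> :: "int \<Rightarrow> complex" and U :: "int \<Rightarrow> 'h \<times> 'h"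
    and \<eta> :: "nat \<Rightarrow> int \<Rightarrow> complex" +
  assumes separation: "\<And>j. j \<in> Zstar \<Longrightarrow> j + 1 \<in> Zstar \<Longrightarrow> cmod (lam \<mu> (j + 1) - lam \<mu> j) > 2 * b"
    and first: "b \<le> cmod (lam \<mu> 1)"
    and b_pos: "b > 0"
    and localized: "\<And>\<epsilon>. \<epsilon> > 0 \<Longrightarrow> \<exists>r1::int. r1 > 0 \<and> (\<forall>p::int. p > 0 \<longrightarrow>
      (MAX i\<in>{i\<in>Zstar. \<bar>i\<bar> \<le> p}.
         \<Sum>\<^sub>\<infinity>j\<in>{j\<in>Zstar. \<bar>j\<bar> \<ge> p + r1}.
           (cmod (energy_inner S (B (Vec \<mu> v i)) (Vec \<mu> v j)))\<^sup>2) < \<epsilon>)"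
begin

definition \<omega> :: "int \<Rightarrow> real" where "\<omega> k = of_int (sgn k) * sqrt (\<mu> (nat \<bar>k\<bar>))"

lemma sqrt_\<mu>_1: "sqrt (\<mu> 1) \<ge> b"
  using first \<mu>_1 by (simp add: lam_def norm_mult)

lemma sqrt_\<mu>_diff:
  assumes m: "1 \<le> m" and "m \<le> n"
  shows "sqrt (\<mu> n) - sqrt (\<mu> m) \<ge> 2 * b * (real n - real m)"
  using assms(2)
proof (induction n rule: dec_induct)
  case (step n)
  have "lam \<mu> (int n + 1) - lam \<mu> (int n) = \<i> * complex_of_real (sqrt (\<mu> (Suc n)) - sqrt (\<mu> n))"
    using step.hyps(1) m by (simp add: lam_def algebra_simps nat_add_distrib)
  then have "cmod (lam \<mu> (int n + 1) - lam \<mu> (int n)) = \<bar>sqrt (\<mu> (Suc n)) - sqrt (\<mu> n)\<bar>"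
    by (simp only: norm_mult norm_ii norm_of_real mult_1_left)
  moreover have "sqrt (\<mu> n) < sqrt (\<mu> (Suc n))" using \<mu>_less[of n "Suc n"] step.hyps(1) m by simp
  moreover have "2 * b < cmod (lam \<mu> (int n + 1) - lam \<mu> (int n))"
    using step.hyps(1) m by (intro separation) (auto simp: Zstar_def)
  ultimately show ?case using step.IH by (simp add: algebra_simps)
qed simp

lemma sqrt_\<mu>_ge: "1 \<le> n \<Longrightarrow> sqrt (\<mu> n) \<ge> b * real n"
proof -
  assume n: "1 \<le> n"
  have "b * (real n - 1) \<ge> 0" using n b_pos by simp
  then show ?thesis using sqrt_\<mu>_diff[OF order_refl n] sqrt_\<mu>_1 by (simp add: algebra_simps)
qed

text \<open>
  The growth of the gaps with the index distance localizes Galerkin eigenvectors, and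
  the uniform bound \<open>2b\<close> separates the discs.  The linear bound has slope \<open>b\<close> instead of \<open>2b\<close> because
  \<open>l - k\<close> counts the missing index \<open>0\<close> when \<open>k\<close> and \<open>l\<close> have opposite signs.
\<close>
lemma \<omega>_gap:
  assumes "k \<in> Zstar" "l \<in> Zstar" "k < l"
  shows "\<omega> l - \<omega> k \<ge> b * real_of_int (l - k)" "\<omega> l - \<omega> k \<ge> 2 * b"
proof -
  let ?m = "nat \<bar>k\<bar>" and ?n = "nat \<bar>l\<bar>"
  have pos: "1 \<le> ?m" "1 \<le> ?n" using assms by (auto simp: Zstar_def)
  have lk: "b * real_of_int (l - k) \<ge> b" using assms(3) b_pos by simp
  have "\<omega> l - \<omega> k \<ge> b * real_of_int (l - k) \<and> \<omega> l - \<omega> k \<ge> 2 * b"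
  proof (cases "0 < k \<or> l < 0")
    case True
    have "\<omega> l - \<omega> k \<ge> 2 * b * real_of_int (l - k)"
    proof (cases "0 < k")
      case True
      then show ?thesis using assms sqrt_\<mu>_diff[OF pos(1), of ?n] by (simp add: \<omega>_def)
    next
      case False
      with \<open>0 < k \<or> l < 0\<close> have "k < 0" "l < 0" using assms by (auto simp: Zstar_def)
      then show ?thesis using assms sqrt_\<mu>_diff[OF pos(2), of ?m] by (simp add: \<omega>_def)
    qed
    then show ?thesis using lk b_pos unfolding mult.assoc by (intro conjI; linarith)
  next
    case False
    then have "k < 0" "0 < l" using assms by (auto simp: Zstar_def)
    then have eq: "\<omega> l - \<omega> k = sqrt (\<mu> ?n) + sqrt (\<mu> ?m)"
      and dist: "real_of_int (l - k) = real ?n + real ?m" by (simp_all add: \<omega>_def)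
    have "b * 1 \<le> b * real ?n" "b * 1 \<le> b * real ?m"
      using pos b_pos by (intro mult_left_mono; simp)+
    then show ?thesis
      using sqrt_\<mu>_ge[OF pos(1)] sqrt_\<mu>_ge[OF pos(2)] unfolding eq dist distrib_left
      by (intro conjI; linarith)
  qed
  then show "\<omega> l - \<omega> k \<ge> b * real_of_int (l - k)" "\<omega> l - \<omega> k \<ge> 2 * b" by blast+
qed

text \<open>Moving \<open>b/2\<close> from the damping into the diagonal halves the norm of the perturbation.\<close>
definition a :: "int \<Rightarrow> complex" where "a k = lam \<mu> k - complex_of_real (b / 2)"

definition C :: "'h \<times> 'h \<Rightarrow> 'h \<times> 'h" where "C Z = BB Z - complex_of_real (b / 2) *\<^sub>C Z"

lemma a_diff: "cmod (a k - a l) = \<bar>\<omega> k - \<omega> l\<bar>"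
proof -
  have "a k - a l = \<i> * complex_of_real (\<omega> k - \<omega> l)"
    by (simp add: a_def lam_eq \<omega>_def algebra_simps)
  then show ?thesis by (simp only: norm_mult norm_ii norm_of_real mult_1_left)
qed

sublocale diagonal_perturbation Zstar e a C "b / 2"
proof
  show "C (x + y) = C x + C y" for x y
    by (simp add: C_def BB_add scaleC_add_right)
  show "C (c *\<^sub>C x) = c *\<^sub>C C x" for c x
    by (simp add: C_def BB_scale complex_vector.scale_right_diff_distrib scaleC_scaleC mult.commute)
  show "norm (C x) \<le> b / 2 * norm x" for x
    unfolding C_def by (rule norm_positive_minus_half_bound[OF BB_add BB_scale BB_pos norm_BB b_pos])
  show "b / 2 > 0" using b_pos by simp
  show "4 * (b / 2) \<le> cmod (a i - a j)" if "i \<in> Zstar" "j \<in> Zstar" "i \<noteq> j" for i j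
    using \<omega>_gap(2)[of i j] \<omega>_gap(2)[of j i] that unfolding a_diff by (cases "i < j") auto
qed

lemma cinner_C: "cinner (C Z) (e j) = cinner (BB Z) (e j) - complex_of_real (b / 2) * cinner Z (e j)"
  by (simp add: C_def cinner_simps)

lemma galerkin_section: "finite_section Zstar e a C (b / 2) (modes N) (M N) (G N) \<Phi>"
proof
  show "cinner (\<Phi> (G N x)) (e j) = a j * cinner (\<Phi> x) (e j) - cinner (C (\<Phi> x)) (e j)"
    if "x \<in> M N" "j \<in> modes N" for x j
    unfolding G_coordinate[OF that] cinner_C by (simp add: a_def algebra_simps)
  show "x = 0" if "x \<in> M N" "\<Phi> x = 0" for x
    using that \<Phi>_inj[of x 0] M_V V_subspace by (auto simp: complex_vector.subspace_0)
qed (use modes_subset finite_modes M_subspace G_in G_add G_scale M_V \<Phi>_diff \<Phi>_scale M_coordinate in auto)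

lemma \<eta>_in_disc:
  assumes N: "N \<ge> 1" and k: "k \<in> modes N"
  shows "in_disc (\<eta> N k) k" "\<exists>x\<in>M N. norm (\<Phi> x) = 1 \<and> G N x = \<eta> N k *\<^sub>C x"
proof -
  interpret sec: finite_section Zstar e a C "b / 2" "modes N" "M N" "G N" \<Phi> by (rule galerkin_section)
  have sep: "Im (a k) + 3 * (b / 2) \<le> Im (a l)" if "k \<in> modes N" "l \<in> modes N" "k < l" for k l
  proof -
    have "\<omega> l - \<omega> k \<ge> 2 * b" using that modes_subset by (intro \<omega>_gap(2)) auto
    then show ?thesis using b_pos by (simp add: a_def lam_eq \<omega>_def)
  qed
  note * = sec.enumerated_eigenvalue_in_disc[OF \<eta>_count[OF N] \<eta>_mono[OF N] sep k]
  show "in_disc (\<eta> N k) k" by (rule *(1))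
  obtain x where x: "x \<in> M N" "x \<noteq> 0" "G N x = \<eta> N k *\<^sub>C x" using *(2) by blast
  have nz: "\<Phi> x \<noteq> 0" using x sec.\<Phi>_inj by blast
  let ?x = "complex_of_real (1 / norm (\<Phi> x)) *\<^sub>C x"
  have "?x \<in> M N" using x(1) M_subspace by (simp add: complex_vector.subspace_scale)
  moreover have "norm (\<Phi> ?x) = 1"
    using nz by (simp add: \<Phi>_scale[OF M_V[OF x(1)]] norm_scaleC norm_divide)
  moreover have "G N ?x = \<eta> N k *\<^sub>C ?x"
    using x(1,3) by (simp add: G_scale scaleC_scaleC mult.commute)
  ultimately show "\<exists>x\<in>M N. norm (\<Phi> x) = 1 \<and> G N x = \<eta> N k *\<^sub>C x" by blast
qed

lemma tail_small:
  assumes "\<epsilon> > 0"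
  shows "\<exists>r1::nat. \<forall>N i. i \<in> Zstar \<longrightarrow> \<bar>i\<bar> \<le> int N - int r1 \<longrightarrow>
    norm (BB (e i) - expansion (BB (e i)) (modes N)) \<le> \<epsilon>"
proof -
  obtain r1 :: int where r1: "r1 > 0" and H: "\<And>p::int. p > 0 \<Longrightarrow>
      (MAX i\<in>{i\<in>Zstar. \<bar>i\<bar> \<le> p}. \<Sum>\<^sub>\<infinity>j\<in>{j\<in>Zstar. \<bar>j\<bar> \<ge> p + r1}.
           (cmod (energy_inner S (B (Vec \<mu> v i)) (Vec \<mu> v j)))\<^sup>2) < \<epsilon>\<^sup>2"
    using localized[of "\<epsilon>\<^sup>2"] assms by auto
  show ?thesis
  proof (intro exI[of _ "nat r1"] allI impI)
    fix N :: nat and i :: int assume i: "i \<in> Zstar" "\<bar>i\<bar> \<le> int N - int (nat r1)"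
    define p where "p = int N + 1 - r1"
    have p: "p > 0" "\<bar>i\<bar> \<le> p" using i r1 by (auto simp: p_def Zstar_def)
    let ?f = "\<lambda>i. \<Sum>\<^sub>\<infinity>j\<in>{j\<in>Zstar. \<bar>j\<bar> \<ge> p + r1}. (cmod (energy_inner S (B (Vec \<mu> v i)) (Vec \<mu> v j)))\<^sup>2"
    have "finite {i\<in>Zstar. \<bar>i\<bar> \<le> p}" by (rule finite_subset[of _ "{- p..p}"]) auto
    then have "?f i \<le> (MAX i\<in>{i\<in>Zstar. \<bar>i\<bar> \<le> p}. ?f i)" using i p by (intro Max_ge) auto
    then have fi: "?f i < \<epsilon>\<^sup>2" using H[OF p(1)] by linarith
    have idx: "{j\<in>Zstar. \<bar>j\<bar> \<ge> p + r1} = Zstar - modes N" by (auto simp: p_def modes_def)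
    have eq: "energy_inner S (B (Vec \<mu> v i)) (Vec \<mu> v j) = cinner (BB (e i)) (e j)" for j
      using BB_\<Phi>[OF Dom_V[OF Vec_Dom[OF i(1)]]] by (simp add: ip_eq e_def)
    let ?R = "BB (e i) - expansion (BB (e i)) (modes N)"
    have "((\<lambda>j. (cmod (cinner ?R (e j)))\<^sup>2) has_sum (norm ?R)\<^sup>2) Zstar" by (rule parseval)
    also have "?this \<longleftrightarrow> ((\<lambda>j. (cmod (cinner (BB (e i)) (e j)))\<^sup>2) has_sum (norm ?R)\<^sup>2) (Zstar - modes N)"
      using cinner_minus_expansion[OF finite_modes modes_subset]
      by (intro has_sum_cong_neutral) auto
    finally have "(norm ?R)\<^sup>2 = ?f i" unfolding idx eq by (simp add: infsumI)
    with fi have "(norm ?R)\<^sup>2 \<le> \<epsilon>\<^sup>2" by simp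
    then show "norm ?R \<le> \<epsilon>" by (rule power2_le_imp_le) (use assms in simp)
  qed
qed

lemma far_mode_separation:
  assumes k: "in_disc z k" "k \<in> Zstar" and i: "i \<in> Zstar" "\<bar>i - k\<bar> > int L"
  shows "cmod (a i - z) \<ge> b * L"
proof -
  have "\<bar>\<omega> i - \<omega> k\<bar> \<ge> b * (real L + 1)"
  proof -
    have "b * (real L + 1) \<le> b * real_of_int \<bar>i - k\<bar>" using i(2) b_pos by (intro mult_left_mono) auto
    then show ?thesis using \<omega>_gap(1)[of i k] \<omega>_gap(1)[of k i] i k(2) by (cases "i < k") auto
  qed
  moreover have "cmod (a i - a k) \<le> cmod (a i - z) + cmod (a k - z)"
    by (metis norm_triangle_ineq4 diff_diff_eq2 diff_add_cancel)
  moreover have "cmod (a k - z) < 3 / 2 * (b / 2)" using k(1) by (simp add: in_disc_def)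
  ultimately show ?thesis using b_pos unfolding a_diff by (simp add: algebra_simps)
qed

text \<open>
  The residual is the part \<open>Q (B x)\<close> of \<open>B x\<close> outside the Galerkin space.  The coordinates of \<open>x\<close> at
  distance more than \<open>L\<close> from \<open>k\<close> have norm at most \<open>1 / (2L)\<close>, because there the eigenvalue
  equation divides by at least \<open>b L\<close> an element of norm at most \<open>b/2\<close>; the at most \<open>2L + 1\<close> others
  contribute \<open>\<delta>\<close> each.
\<close>
lemma galerkin_residual:
  assumes x: "x \<in> M N" "norm (\<Phi> x) = 1" "G N x = z *\<^sub>C x"
    and k: "in_disc z k" "k \<in> Zstar" and L: "L \<ge> 1"
    and near: "\<And>i. i \<in> Zstar \<Longrightarrow> \<bar>i - k\<bar> \<le> int L \<Longrightarrow>
      norm (BB (e i) - expansion (BB (e i)) (modes N)) \<le> \<delta>"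
  shows "norm (\<Phi> (z *\<^sub>C x - T x)) \<le> (2 * real L + 1) * \<delta> + b / (2 * real L)"
proof -
  define Q where "Q y = y - expansion y (modes N)" for y
  have Q_coord: "cinner (Q y) (e j) = (if j \<in> modes N then 0 else cinner y (e j))" if "j \<in> Zstar" for y j
    unfolding Q_def by (rule cinner_minus_expansion[OF finite_modes modes_subset that])
  define K where "K = {i \<in> modes N. \<bar>i - k\<bar> \<le> int L}"
  have K: "finite K" "K \<subseteq> Zstar" using finite_modes modes_subset by (auto simp: K_def)
  define far where "far = \<Phi> x - expansion (\<Phi> x) K"
  have far_coord: "cinner far (e j) = (if j \<in> K then 0 else cinner (\<Phi> x) (e j))" if "j \<in> Zstar" for j
    unfolding far_def by (rule cinner_minus_expansion[OF K that])
  have xD: "x \<in> Dom" "x \<in> V" using M_Dom[OF x(1)] M_V[OF x(1)] by auto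
  have eig: "(a j - z) * cinner (\<Phi> x) (e j) = cinner (C (\<Phi> x)) (e j)" if "j \<in> modes N" for j
    using eigenvector_coordinate[OF x(1,3) that] unfolding cinner_C a_def by (simp add: algebra_simps)
  have "b * L * norm far \<le> norm (C (\<Phi> x))"
  proof (rule norm_le_coordinatewise)
    fix j assume j: "j \<in> Zstar"
    show "b * L * cmod (cinner far (e j)) \<le> cmod (cinner (C (\<Phi> x)) (e j))"
    proof (cases "j \<in> modes N \<and> \<bar>j - k\<bar> > int L")
      case True
      then have "b * L * cmod (cinner (\<Phi> x) (e j)) \<le> cmod (a j - z) * cmod (cinner (\<Phi> x) (e j))"
        by (intro mult_right_mono far_mode_separation[OF k j]) auto
      also have "\<dots> = cmod (cinner (C (\<Phi> x)) (e j))" using eig[of j] True by (simp flip: norm_mult)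
      finally show ?thesis using True far_coord[OF j] by (auto simp: K_def)
    next
      case False
      then have "cinner far (e j) = 0"
        using far_coord[OF j] M_coordinate[OF x(1)] j by (auto simp: K_def)
      then show ?thesis by simp
    qed
  qed (use b_pos in simp)
  also have "\<dots> \<le> b / 2" using norm_C[of "\<Phi> x"] x(2) by simp
  finally have far: "norm far \<le> 1 / (2 * real L)"
    using b_pos L by (simp add: field_simps)
  have "\<Phi> (z *\<^sub>C x - T x) = Q (BB (\<Phi> x))"
  proof (rule coordinate_eqI)
    fix j assume j: "j \<in> Zstar"
    have *: "cinner (\<Phi> (z *\<^sub>C x - T x)) (e j) =
        z * cinner (\<Phi> x) (e j) - (lam \<mu> j * cinner (\<Phi> x) (e j) - cinner (BB (\<Phi> x)) (e j))"
      using xD V_subspace T_V[OF xD(1)] T_coordinate[OF xD(1) j]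
      by (simp add: \<Phi>_diff \<Phi>_scale cinner_simps complex_vector.subspace_scale)
    show "cinner (\<Phi> (z *\<^sub>C x - T x)) (e j) = cinner (Q (BB (\<Phi> x))) (e j)"
    proof (cases "j \<in> modes N")
      case True
      then show ?thesis using eigenvector_coordinate[OF x(1,3) True] by (simp add: * Q_coord[OF j])
    next
      case False
      then show ?thesis using M_coordinate[OF x(1), of j] j by (simp add: * Q_coord[OF j])
    qed
  qed
  also have "\<dots> = Q (BB (expansion (\<Phi> x) K)) + Q (BB far)"
  proof (rule coordinate_eqI)
    fix j assume j: "j \<in> Zstar"
    have "BB (\<Phi> x) = BB (expansion (\<Phi> x) K) + BB far" unfolding BB_add[symmetric] far_def by simp
    then show "cinner (Q (BB (\<Phi> x))) (e j) = cinner (Q (BB (expansion (\<Phi> x) K)) + Q (BB far)) (e j)"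
      by (simp add: cinner_simps Q_coord[OF j])
  qed
  also have "Q (BB (expansion (\<Phi> x) K)) = (\<Sum>i\<in>K. cinner (\<Phi> x) (e i) *\<^sub>C Q (BB (e i)))"
  proof (rule coordinate_eqI)
    have BB0: "BB 0 = 0" using BB_scale[of 0 0] by simp
    have BB_sum: "BB (expansion (\<Phi> x) F) = (\<Sum>i\<in>F. cinner (\<Phi> x) (e i) *\<^sub>C BB (e i))" for F
      unfolding expansion_def
      by (induction F rule: infinite_finite_induct) (auto simp: BB0 BB_add BB_scale)
    fix j assume j: "j \<in> Zstar"
    show "cinner (Q (BB (expansion (\<Phi> x) K))) (e j) =
        cinner (\<Sum>i\<in>K. cinner (\<Phi> x) (e i) *\<^sub>C Q (BB (e i))) (e j)"
      unfolding Q_coord[OF j] BB_sum cinner_sum_left cinner_scaleC_left by simp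
  qed
  finally have "norm (\<Phi> (z *\<^sub>C x - T x)) \<le>
      norm (\<Sum>i\<in>K. cinner (\<Phi> x) (e i) *\<^sub>C Q (BB (e i))) + norm (Q (BB far))"
    by (simp only: norm_triangle_ineq)
  also have "norm (\<Sum>i\<in>K. cinner (\<Phi> x) (e i) *\<^sub>C Q (BB (e i))) \<le> (\<Sum>i\<in>K. \<delta>)"
  proof (rule sum_norm_le)
    fix i assume i: "i \<in> K"
    then have iZ: "i \<in> Zstar" using K by blast
    have "cmod (cinner (\<Phi> x) (e i)) \<le> 1"
      using norm_cinner_le[of "\<Phi> x" "e i"] x(2) norm_basis[OF iZ] by simp
    then have "norm (cinner (\<Phi> x) (e i) *\<^sub>C Q (BB (e i))) \<le> norm (Q (BB (e i)))"
      by (simp add: norm_scaleC mult_left_le_one_le)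
    also have "\<dots> \<le> \<delta>" unfolding Q_def by (rule near) (use i iZ in \<open>auto simp: K_def\<close>)
    finally show "norm (cinner (\<Phi> x) (e i) *\<^sub>C Q (BB (e i))) \<le> \<delta>" .
  qed
  also have "(\<Sum>i\<in>K. \<delta>) \<le> (2 * real L + 1) * \<delta>"
  proof -
    have "card K \<le> card {k - int L..k + int L}" by (rule card_mono) (auto simp: K_def)
    then have "real (card K) \<le> 2 * real L + 1" by simp
    moreover have "\<delta> \<ge> 0" by (rule order_trans[OF norm_ge_zero near[OF k(2)]]) simp
    ultimately show ?thesis by (simp add: mult_right_mono)
  qed
  also have "norm (Q (BB far)) \<le> b / (2 * real L)"
  proof -
    have "1 * norm (Q (BB far)) \<le> norm (BB far)"
      by (rule norm_le_coordinatewise) (auto simp: Q_coord)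
    also have "\<dots> \<le> b * norm far" by (rule norm_BB)
    also have "\<dots> \<le> b * (1 / (2 * real L))" using far b_pos by (intro mult_left_mono) auto
    finally show ?thesis by simp
  qed
  finally show ?thesis by simp
qed

text \<open>
  \<open>r = r1 + L\<close> guarantees that all indices within \<open>L\<close> of an admissible \<open>k\<close> are at least \<open>r1\<close>
  away from the cut-off \<open>N\<close>.
\<close>
lemma galerkin_abscissa_upper:
  assumes \<epsilon>: "\<epsilon> > 0"
  shows "\<exists>r>0. \<forall>N>r. \<forall>k\<in>Zstar. \<bar>k\<bar> \<le> int N - int r \<longrightarrow> Re (\<eta> N k) \<le> abscissa + \<epsilon>"
proof -
  obtain K where K: "K > 0" and res: "\<forall>z d. d > 0 \<longrightarrow> (\<forall>j\<in>Zstar. cmod (z - \<nu> j) \<ge> d) \<longrightarrow>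
      bij_betw (\<lambda>x. z *\<^sub>C x - T x) Dom V \<and>
      (\<forall>x\<in>Dom. norm (\<Phi> x) \<le> K / d * norm (\<Phi> (z *\<^sub>C x - T x)))"
    using resolvent_bound by blast
  obtain L :: nat where L: "real L > K * b / \<epsilon>" using reals_Archimedean2 by blast
  then have L1: "real L > 0" using K b_pos \<epsilon> by (smt (verit) divide_pos_pos mult_pos_pos)
  \<comment> \<open>with this \<open>\<delta>\<close> and \<open>L\<close> the two parts of the residual bound are at most \<open>\<epsilon> / (3K)\<close> and \<open>\<epsilon> / (2K)\<close>\<close>
  define \<delta> where "\<delta> = \<epsilon> / (3 * K) / (2 * real L + 1)"
  have \<delta>: "\<delta> > 0" using \<epsilon> K by (simp add: \<delta>_def)
  have "2 * real L + 1 \<noteq> 0" using L1 by simp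
  then have L\<delta>: "(2 * real L + 1) * \<delta> = \<epsilon> / (3 * K)" by (simp add: \<delta>_def)
  obtain r1 :: nat where r1: "\<forall>N i. i \<in> Zstar \<longrightarrow> \<bar>i\<bar> \<le> int N - int r1 \<longrightarrow>
      norm (BB (e i) - expansion (BB (e i)) (modes N)) \<le> \<delta>"
    using tail_small[OF \<delta>] by blast
  have small: "K / \<epsilon> * ((2 * real L + 1) * \<delta> + b / (2 * real L)) < 1"
  proof -
    have "K / \<epsilon> * ((2 * real L + 1) * \<delta>) = 1 / 3"
      unfolding L\<delta> using K \<epsilon> by simp
    moreover have "K / \<epsilon> * (b / (2 * real L)) < 1 / 2"
      using L L1 \<epsilon> by (simp add: field_simps)
    ultimately show ?thesis unfolding distrib_left by linarith
  qed
  show ?thesis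
  proof (intro exI[of _ "r1 + L"] conjI allI ballI impI)
    show "0 < r1 + L" using L1 by simp
    fix N k assume N: "r1 + L < N" and k: "k \<in> Zstar" "\<bar>k\<bar> \<le> int N - int (r1 + L)"
    have kN: "k \<in> modes N" using k by (auto simp: modes_def)
    have N1: "N \<ge> 1" using N by simp
    obtain x where x: "x \<in> M N" "norm (\<Phi> x) = 1" "G N x = \<eta> N k *\<^sub>C x"
      using \<eta>_in_disc(2)[OF N1 kN] by blast
    have R: "norm (\<Phi> (\<eta> N k *\<^sub>C x - T x)) \<le> (2 * real L + 1) * \<delta> + b / (2 * real L)"
    proof (rule galerkin_residual[OF x \<eta>_in_disc(1)[OF N1 kN] k(1)])
      show "L \<ge> 1" using L1 by simp
      show "norm (BB (e i) - expansion (BB (e i)) (modes N)) \<le> \<delta>"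
        if "i \<in> Zstar" "\<bar>i - k\<bar> \<le> int L" for i
        using r1 that k(2) by auto
    qed
    have "\<not> (\<forall>j\<in>Zstar. cmod (\<eta> N k - \<nu> j) \<ge> \<epsilon>)"
    proof
      assume "\<forall>j\<in>Zstar. cmod (\<eta> N k - \<nu> j) \<ge> \<epsilon>"
      then have "norm (\<Phi> x) \<le> K / \<epsilon> * norm (\<Phi> (\<eta> N k *\<^sub>C x - T x))"
        using res \<epsilon> M_Dom[OF x(1)] by blast
      also have "\<dots> \<le> K / \<epsilon> * ((2 * real L + 1) * \<delta> + b / (2 * real L))"
        using R K \<epsilon> by (intro mult_left_mono) auto
      finally show False using small x(2) by simp
    qed
    then obtain j where j: "j \<in> Zstar" "cmod (\<eta> N k - \<nu> j) < \<epsilon>" by force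
    then show "Re (\<eta> N k) \<le> abscissa + \<epsilon>"
      using Re_\<nu>_le_abscissa[OF j(1)] complex_Re_le_cmod[of "\<eta> N k - \<nu> j"] by simp
  qed
qed

text \<open>
  The truncation to \<open>modes N\<close> of the eigenvector \<open>w\<close> for \<open>\<nu> j\<close> solves the Galerkin eigenvalue
  equation up to the residual \<open>C\<close> applied to the tail of \<open>w\<close>.
\<close>
lemma galerkin_eigenvalues_converge:
  assumes j: "j \<in> Zstar" and \<epsilon>: "\<epsilon> > 0"
  shows "\<exists>k\<in>Zstar. \<exists>N0. \<forall>N\<ge>N0. k \<in> modes N \<and> cmod (\<nu> j - \<eta> N k) \<le> \<epsilon>"
proof -
  define u where "u = \<Phi> (U j)"
  have u: "solves Zstar (\<nu> j) u 0"
    using U_coordinate[OF j] unfolding solves_def u_def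
    by (auto simp: cinner_C a_def algebra_simps)
  have "u \<noteq> 0" using norm_U[OF j] by (auto simp: u_def)
  obtain k where k: "k \<in> Zstar" "in_disc (\<nu> j) k"
    using eigenvector_disc[OF order_refl u \<open>u \<noteq> 0\<close>] .
  define w where "w = (1 / cinner u (e k)) *\<^sub>C u"
  note w = normalized_eigenvector[OF order_refl u \<open>u \<noteq> 0\<close> k, folded w_def]
  have "eventually (\<lambda>F. norm (w - expansion w F) < 2 * \<epsilon> / (3 * b)) (finite_subsets_at_top Zstar)"
    using order_tendstoD(2)[OF expansion_tendsto] \<epsilon> b_pos by simp
  then obtain F where F: "finite F" "F \<subseteq> Zstar"
    and F': "\<forall>F'. finite F' \<and> F \<subseteq> F' \<and> F' \<subseteq> Zstar \<longrightarrow> norm (w - expansion w F') < 2 * \<epsilon> / (3 * b)"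
    unfolding eventually_finite_subsets_at_top by (elim exE conjE)
  define N0 where "N0 = nat (\<bar>k\<bar> + (\<Sum>i\<in>F. \<bar>i\<bar>))"
  have "k \<in> modes N \<and> cmod (\<nu> j - \<eta> N k) \<le> \<epsilon>" if N: "N \<ge> N0" for N
  proof -
    have N0: "int N \<ge> \<bar>k\<bar> + (\<Sum>i\<in>F. \<bar>i\<bar>)" using N by (simp add: N0_def)
    have "(\<Sum>i\<in>F. \<bar>i\<bar>) \<ge> 0" by (simp add: sum_nonneg)
    then have "\<bar>k\<bar> \<le> int N" using N0 by linarith
    then have kN: "k \<in> modes N" using k(1) by (simp add: modes_def)
    then have N1: "N \<ge> 1" by (auto simp: modes_def Zstar_def)
    have "F \<subseteq> modes N"
    proof
      fix i assume i: "i \<in> F"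
      have "\<bar>i\<bar> \<le> (\<Sum>i\<in>F. \<bar>i\<bar>)" using member_le_sum[OF i, of abs] F(1) by simp
      then have "\<bar>i\<bar> \<le> int N" using N0 by linarith
      then show "i \<in> modes N" using i F(2) by (auto simp: modes_def)
    qed
    then have close: "norm (w - expansion w (modes N)) < 2 * \<epsilon> / (3 * b)"
      using F'[rule_format, of "modes N"] finite_modes modes_subset by blast
    interpret sec: finite_section Zstar e a C "b / 2" "modes N" "M N" "G N" \<Phi> by (rule galerkin_section)
    obtain x where x: "x \<in> M N" "norm (\<Phi> x) = 1" "G N x = \<eta> N k *\<^sub>C x"
      using \<eta>_in_disc(2)[OF N1 kN] by blast
    let ?p = "expansion w (modes N)" and ?f = "C (w - expansion w (modes N))"
    have p: "cinner ?p (e i) = (if i \<in> modes N then cinner w (e i) else 0)" if "i \<in> Zstar" for i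
      unfolding expansion_def by (rule cinner_basis_sum[OF finite_modes modes_subset that])
    have "cmod (\<nu> j - \<eta> N k) \<le> 3 * norm ?f"
    proof (rule eigenvalue_near_approximate_eigenvalue[OF modes_subset kN \<eta>_in_disc(1)[OF N1 kN]
          sec.solves_eigenvector[OF x(1,3)]])
      show "\<Phi> x \<noteq> 0" using x(2) by auto
      show "solves (modes N) (\<nu> j) ?p ?f"
        unfolding solves_def
      proof (intro conjI ballI)
        fix i assume i: "i \<in> modes N"
        then have "i \<in> Zstar" using modes_subset by blast
        then show "(a i - \<nu> j) * cinner ?p (e i) = cinner (C ?p) (e i) + cinner ?f (e i)"
          using i p w(1) by (simp add: solves_def C_diff cinner_simps)
      qed (use p in auto)
      show "cinner ?p (e k) = 1" using p[OF k(1)] kN w(2) by simp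
      have "1 * norm (?p - e k) \<le> norm (w - e k)"
      proof (rule norm_le_coordinatewise)
        fix i assume i: "i \<in> Zstar"
        show "1 * cmod (cinner (?p - e k) (e i)) \<le> cmod (cinner (w - e k) (e i))"
          using i k(1) kN by (auto simp: cinner_simps p orthonormal)
      qed simp
      then show "norm (?p - e k) \<le> 2 / 3" using w(3) by simp
    qed
    also have "\<dots> \<le> 3 * (b / 2 * norm (w - expansion w (modes N)))"
      by (intro mult_left_mono norm_C) simp
    also have "\<dots> \<le> 3 * (b / 2 * (2 * \<epsilon> / (3 * b)))"
      using close b_pos by (intro mult_left_mono) auto
    also have "\<dots> = \<epsilon>" using b_pos by simp
    finally show ?thesis using kN by blast
  qed
  then show ?thesis using k(1) by blast
qed

theorem abscissa_convergence:
  assumes \<epsilon>: "\<epsilon> > 0"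
  shows "\<exists>N1 r::nat. 0 < r \<and> r \<le> N1 \<and> (\<forall>N>N1. \<bar>abscissa - discrete_abscissa (\<eta> N) N r\<bar> \<le> \<epsilon>)"
proof -
  obtain r where r: "r > 0" "\<And>N k. N > r \<Longrightarrow> k \<in> Zstar \<Longrightarrow> \<bar>k\<bar> \<le> int N - int r \<Longrightarrow> Re (\<eta> N k) \<le> abscissa + \<epsilon>"
    using galerkin_abscissa_upper[OF \<epsilon>] by blast
  have \<epsilon>2: "\<epsilon> / 2 > 0" using \<epsilon> by simp
  obtain j where j: "j \<in> Zstar" "Re (\<nu> j) > abscissa - \<epsilon> / 2" using abscissa_approx[OF \<epsilon>2] .
  obtain k N0 where k: "k \<in> Zstar" "\<And>N. N \<ge> N0 \<Longrightarrow> cmod (\<nu> j - \<eta> N k) \<le> \<epsilon> / 2"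
    using galerkin_eigenvalues_converge[OF j(1) \<epsilon>2] by blast
  define N1 where "N1 = N0 + r + nat \<bar>k\<bar>"
  have "\<bar>abscissa - discrete_abscissa (\<eta> N) N r\<bar> \<le> \<epsilon>" if N: "N > N1" for N
  proof (rule discrete_abscissa_close)
    show "r < N" using N by (simp add: N1_def)
    show "Re (\<eta> N l) \<le> abscissa + \<epsilon>" if "l \<in> Zstar" "\<bar>l\<bar> \<le> int N - int r" for l
      by (rule r(2)[OF \<open>r < N\<close> that])
    show "k \<in> Zstar" by (rule k(1))
    show "\<bar>k\<bar> \<le> int N - int r" using N by (simp add: N1_def)
    have "cmod (\<nu> j - \<eta> N k) \<le> \<epsilon> / 2" using N by (intro k(2)) (simp add: N1_def)
    then show "Re (\<eta> N k) \<ge> abscissa - \<epsilon>"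
      using j(2) complex_Re_le_cmod[of "\<nu> j - \<eta> N k"] by simp
  qed
  then show ?thesis using r(1) by (intro exI[of _ N1] exI[of _ r]) (auto simp: N1_def)
qed

end

theorem corollary3p4:
  fixes A S :: "'h::chilbert_space \<Rightarrow> 'h" and DA DS :: "'h set"
    and \<mu> :: "nat \<Rightarrow> real" and v :: "nat \<Rightarrow> 'h"
    and B :: "'h \<times> 'h \<Rightarrow> 'h \<times> 'h"
    and \<nu> :: "int \<Rightarrow> complex" and U :: "int \<Rightarrow> 'h \<times> 'h"
    and \<eta> :: "nat \<Rightarrow> int \<Rightarrow> complex"
  assumes A: "stiffness_operator DA A \<mu> v"
    and S: "is_sqrt_of DS S DA A"
    and B: "damping_operator DS S B"
    and nu: "damped_eigensystem DA A DS S B \<nu> U"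
    and eta: "\<And>N. N \<ge> 1 \<Longrightarrow> galerkin_eigenvalues A S B \<mu> v N (\<eta> N)"
    and H1: "skew_adjoint (energy_space DS) (energy_inner S) (op_domain DA DS) (undamped_op A)"
      "eigenvalues (op_domain DA DS) (undamped_op A) = lam \<mu> ` Zstar"
      "\<forall>k\<in>Zstar. simple_eigenvalue (op_domain DA DS) (undamped_op A) (lam \<mu> k)"
    and H2: "\<forall>j. j \<in> Zstar \<and> j + 1 \<in> Zstar \<longrightarrow>
      cmod (lam \<mu> (j + 1) - lam \<mu> j) > 2 * op_norm (energy_space DS) (energy_inner S) B"
    and H3: "op_norm (energy_space DS) (energy_inner S) B \<le> cmod (lam \<mu> 1)"
    and H4: "riesz_basis (energy_space DS) (energy_inner S) Zstar U"
    and H5: "\<forall>\<epsilon>>0. \<exists>r1::int. r1 > 0 \<and> (\<forall>p::int. p > 0 \<longrightarrow>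
      (MAX i\<in>{i\<in>Zstar. \<bar>i\<bar> \<le> p}.
         \<Sum>\<^sub>\<infinity>j\<in>{j\<in>Zstar. \<bar>j\<bar> \<ge> p + r1}.
           (cmod (energy_inner S (B (Vec \<mu> v i)) (Vec \<mu> v j)))\<^sup>2) < \<epsilon>)"
    and H6: "\<forall>\<epsilon>>0. \<exists>N1::int. \<exists>\<alpha>::real. \<forall>k\<in>Zstar. \<bar>k\<bar> > N1 \<longrightarrow> \<bar>Re (\<nu> k) - \<alpha>\<bar> \<le> \<epsilon>"
  shows "\<forall>\<epsilon>>0. \<exists>N1 r::nat. 0 < r \<and> r \<le> N1 \<and> (\<forall>N>N1.
    \<bar>spectral_abscissa (energy_space DS) (energy_inner S) (op_domain DA DS) (damped_op A B)
      - discrete_abscissa (\<eta> N) N r\<bar> \<le> \<epsilon>)"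
proof (intro allI impI)
  fix \<epsilon> :: real assume \<epsilon>: "\<epsilon> > 0"
  interpret galerkin_system A S DA DS \<mu> v B \<nu> U \<eta>
    by unfold_locales (fact A S B H1(1) nu H4 eta)+
  show "\<exists>N1 r::nat. 0 < r \<and> r \<le> N1 \<and> (\<forall>N>N1. \<bar>abscissa - discrete_abscissa (\<eta> N) N r\<bar> \<le> \<epsilon>)"
  proof (cases "b = 0")
    case True
    have "\<bar>abscissa - discrete_abscissa (\<eta> N) N 1\<bar> \<le> \<epsilon>" if "N > 1" for N
      using zero_damping[OF True, of 1 N] that \<epsilon> by simp
    then show ?thesis by (intro exI[of _ 1]) simp
  next
    case False
    then have "b > 0" using b_nonneg by simp
    then interpret separated_galerkin_system A S DA DS \<mu> v B \<nu> U \<eta>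
      using H2 H3 H5 by unfold_locales (auto simp: b_def)
    show ?thesis by (rule abscissa_convergence[OF \<epsilon>])
  qed
qed

end
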